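(* Let $U,V,W$ be objects of $C_2\mathcal{J}_{0,0}$ and let $\mathbb{R}^\alpha$ be either the trivial or the sign one-dimensional representation of $C_2$. Then the homotopy cofibre of the restricted composition map $$C_2\mathcal{J}_W(U\oplus\mathbb{R}^\alpha,V)\wedge S^{W\otimes\mathbb{R}^\alpha}\to C_2\mathcal{J}_W(U,V)$$ is $C_2$-equivariantly homeomorphic to $C_2\mathcal{J}_{W\oplus\mathbb{R}^\alpha}(U,V)$.
   Context: $C_2=\{e,\sigma\}$. Objects of $C_2\mathcal{J}_{0,0}$ are finite-dimensional subrepresentations of $\bigoplus_{i=1}^\infty\mathbb{R}[C_2]$ with ($C_2$-invariant) inner product. $\mathcal{L}(U,V)$ is the space of (not necessarily equivariant) linear isometries $U\to V$ with $C_2$-action $\sigma*f=\sigma f\sigma$. For a $C_2$-representation $W$, $C_2\gamma_W(U,V)=\{(f,x):f\in\mathcal{L}(U,V),\ x\in W\otimes f(U)^\perp\}$ is a $C_2$-vector bundle over $\mathcal{L}(U,V)$ with $\sigma(f,x)=(\sigma*f,\sigma x)$ (diagonal action on the tensor product), and $C_2\mathcal{J}_W(U,V)$ is its Thom space (the one-point compactification of the total space), a pointed $C_2$-space. Composition $C_2\mathcal{J}_W(V,X)\wedge C_2\mathcal{J}_W(U,V)\to C_2\mathcal{J}_W(U,X)$ is induced by $((f,x),(g,y))\mapsto(f\circ g,\,x+(\mathrm{id}\otimes f)(y))$. $S^{W\otimes\mathbb{R}^\alpha}$ is the one-point compactification of $W\otimes\mathbb{R}^\alpha$, identified $C_2$-equivariantly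 with the closure of the subspace of pairs $(i,x)$ in $C_2\mathcal{J}_W(U,U\oplus\mathbb{R}^\alpha)$, with $i:U\to U\oplus\mathbb{R}^\alpha$ the standard inclusion; the restricted composition map is the composition map restricted to this subspace. *)

theory Defs
  imports "HOL-Analysis.Analysis" "HOL-Analysis.Finite_Function_Topology"
begin

section \<open>Finite-dimensional orthogonal representations of the group with two elements\<close>

text \<open>
  Every representation in sight is a finite-dimensional subspace of a real vector space
  \<^typ>\<open>'i \<Rightarrow>\<^sub>0 real\<close> of finitely supported functions, the direct sum of copies of the
  real line indexed by \<^typ>\<open>'i\<close>. Such a subspace inherits its canonical topology from the
  normed topology of \<^typ>\<open>'i \<Rightarrow>\<^sub>0 real\<close>.

  An action of the group with elements \<open>e\<close> and \<open>\<sigma>\<close> is given by the involution by which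
  \<open>\<sigma>\<close> acts. The fields of the following record are meaningful on the carrier only.
\<close>

record 'i rep =
  rcarrier :: "('i \<Rightarrow>\<^sub>0 real) set"
  ract :: "('i \<Rightarrow>\<^sub>0 real) \<Rightarrow> ('i \<Rightarrow>\<^sub>0 real)"
  rinner :: "('i \<Rightarrow>\<^sub>0 real) \<Rightarrow> ('i \<Rightarrow>\<^sub>0 real) \<Rightarrow> real"

definition linear_on_subspace :: "'a::real_vector set \<Rightarrow> ('a \<Rightarrow> 'b::real_vector) \<Rightarrow> bool"
  where "linear_on_subspace S f \<longleftrightarrow>
    (\<forall>x\<in>S. \<forall>y\<in>S. f (x + y) = f x + f y) \<and> (\<forall>c. \<forall>x\<in>S. f (c *\<^sub>R x) = c *\<^sub>R f x)"

definition inner_product_on :: "'a::real_vector set \<Rightarrow> ('a \<Rightarrow> 'a \<Rightarrow> real) \<Rightarrow> bool"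
  where "inner_product_on S b \<longleftrightarrow>
    (\<forall>y\<in>S. linear_on_subspace S (\<lambda>x. b x y)) \<and>
    (\<forall>x\<in>S. \<forall>y\<in>S. b x y = b y x) \<and>
    (\<forall>x\<in>S. x \<noteq> 0 \<longrightarrow> b x x > 0)"

definition orthogonal_rep :: "'i rep \<Rightarrow> bool"
  where "orthogonal_rep R \<longleftrightarrow>
    subspace (rcarrier R) \<and> (\<exists>B. finite B \<and> span B = rcarrier R) \<and>
    linear_on_subspace (rcarrier R) (ract R) \<and>
    (\<forall>x\<in>rcarrier R. ract R x \<in> rcarrier R \<and> ract R (ract R x) = x) \<and>
    inner_product_on (rcarrier R) (rinner R) \<and>
    (\<forall>x\<in>rcarrier R. \<forall>y\<in>rcarrier R. rinner R (ract R x) (ract R y) = rinner R x y)"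

datatype c2 = C2_e | C2_sigma

fun sigma_times :: "c2 \<Rightarrow> c2"
  where
    "sigma_times C2_e = C2_sigma"
  | "sigma_times C2_sigma = C2_e"

text \<open>
  The direct sum of countably many copies of the regular representation is
  \<^typ>\<open>nat \<times> c2 \<Rightarrow>\<^sub>0 real\<close>; its standard basis vector at \<open>(n, g)\<close> is the group element \<open>g\<close>
  in the \<open>n\<close>-th copy, and \<open>\<sigma>\<close> maps it to the basis vector at \<open>(n, \<sigma>g)\<close>.
\<close>

definition regular_act :: "(nat \<times> c2 \<Rightarrow>\<^sub>0 real) \<Rightarrow> (nat \<times> c2 \<Rightarrow>\<^sub>0 real)"
  where "regular_act = Poly_Mapping.map_key (map_prod id sigma_times)"

text \<open>
  The objects of the category \<open>C\<^sub>2J\<^sub>0\<^sub>,\<^sub>0\<close>. The inner product is any invariant one, not necessarily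
  the restriction of the standard inner product.
\<close>

definition C2J00_object :: "(nat \<times> c2) rep \<Rightarrow> bool"
  where "C2J00_object U \<longleftrightarrow>
    orthogonal_rep U \<and> (\<forall>x\<in>rcarrier U. ract U x = regular_act x)"

lemma inj_map_prod_sigma: "inj (map_prod id sigma_times :: nat \<times> c2 \<Rightarrow> nat \<times> c2)"
proof (rule prod.inj_map)
  show "inj sigma_times"
    by (rule injI) (case_tac x; case_tac y; simp)
qed simp

lemma regular_act_single: "regular_act (Poly_Mapping.single (n, g) c) = Poly_Mapping.single (n, sigma_times g) c"
proof -
  have "map_prod id sigma_times (n, sigma_times g) = (n, g)"
    by (cases g) auto
  then show ?thesis
    unfolding regular_act_def by (metis inj_map_prod_sigma map_key_single)
qed

lemma lookup_scaleR [simp]: "Poly_Mapping.lookup (c *\<^sub>R x) i = c *\<^sub>R Poly_Mapping.lookup x i"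
proof -
  have "finite {i. c *\<^sub>R Poly_Mapping.lookup x i \<noteq> 0}"
    by (rule finite_subset[of _ "Poly_Mapping.keys x"]) (auto simp: in_keys_iff)
  then show ?thesis
    by (simp add: scaleR_poly_mapping_def)
qed

definition line :: "real \<Rightarrow> unit rep"
  where "line \<epsilon> = \<lparr>rcarrier = UNIV, ract = (\<lambda>x. \<epsilon> *\<^sub>R x),
    rinner = (\<lambda>x y. Poly_Mapping.lookup x () * Poly_Mapping.lookup y ())\<rparr>"

definition trivial_line :: "unit rep"
  where "trivial_line = line 1"

definition sign_line :: "unit rep"
  where "sign_line = line (-1)"

text \<open>Orthogonal direct sum; \<open>dsum_vec u v\<close> is the pair \<open>(u, v)\<close>.\<close>

lift_definition dsum_vec :: "('i \<Rightarrow>\<^sub>0 real) \<Rightarrow> ('j \<Rightarrow>\<^sub>0 real) \<Rightarrow> ('i + 'j \<Rightarrow>\<^sub>0 real)"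
  is case_sum
proof -
  fix f :: "'i \<Rightarrow> real" and g :: "'j \<Rightarrow> real"
  assume "finite {i. f i \<noteq> 0}" "finite {j. g j \<noteq> 0}"
  moreover have "{k. case_sum f g k \<noteq> 0} = Inl ` {i. f i \<noteq> 0} \<union> Inr ` {j. g j \<noteq> 0}"
  proof (intro equalityI subsetI)
    fix k
    assume "k \<in> {k. case_sum f g k \<noteq> 0}"
    then show "k \<in> Inl ` {i. f i \<noteq> 0} \<union> Inr ` {j. g j \<noteq> 0}"
      by (cases k) auto
  qed auto
  ultimately show "finite {k. case_sum f g k \<noteq> 0}"
    by simp
qed

definition dsum_fst :: "('i + 'j \<Rightarrow>\<^sub>0 real) \<Rightarrow> ('i \<Rightarrow>\<^sub>0 real)"
  where "dsum_fst = Poly_Mapping.map_key Inl"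

definition dsum_snd :: "('i + 'j \<Rightarrow>\<^sub>0 real) \<Rightarrow> ('j \<Rightarrow>\<^sub>0 real)"
  where "dsum_snd = Poly_Mapping.map_key Inr"

lemma dsum_fst_vec [simp]: "dsum_fst (dsum_vec u v) = u"
  by (rule poly_mapping_eqI) (simp add: dsum_fst_def map_key.rep_eq dsum_vec.rep_eq)

lemma dsum_snd_vec [simp]: "dsum_snd (dsum_vec u v) = v"
  by (rule poly_mapping_eqI) (simp add: dsum_snd_def map_key.rep_eq dsum_vec.rep_eq)

definition dsum :: "'i rep \<Rightarrow> 'j rep \<Rightarrow> ('i + 'j) rep"  (infixl "\<oplus>\<^sub>r" 65)
  where "U \<oplus>\<^sub>r V =
    \<lparr>rcarrier = {dsum_vec u v |u v. u \<in> rcarrier U \<and> v \<in> rcarrier V},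
     ract = (\<lambda>x. dsum_vec (ract U (dsum_fst x)) (ract V (dsum_snd x))),
     rinner = (\<lambda>x y. rinner U (dsum_fst x) (dsum_fst y) + rinner V (dsum_snd x) (dsum_snd y))\<rparr>"


lemma orthogonal_rep_line:
  assumes "\<epsilon> * \<epsilon> = 1"
  shows "orthogonal_rep (line \<epsilon>)"
proof -
  have eq: "x = Poly_Mapping.lookup x () *\<^sub>R Poly_Mapping.single () 1" for x :: "unit \<Rightarrow>\<^sub>0 real"
    by (rule poly_mapping_eqI) simp
  have "span {Poly_Mapping.single () (1::real)} = UNIV"
    by (subst set_eq_iff) (metis UNIV_I eq insertI1 span_base span_scale)
  moreover have "Poly_Mapping.lookup x () \<noteq> 0" if "x \<noteq> 0" for x :: "unit \<Rightarrow>\<^sub>0 real"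
    using that eq[of x] by (metis scaleR_zero_left)
  ultimately show ?thesis
    using assms unfolding orthogonal_rep_def line_def linear_on_subspace_def inner_product_on_def
    by (auto simp: algebra_simps lookup_add zero_less_mult_iff linorder_neq_iff
        intro!: exI[of _ "{Poly_Mapping.single () 1}"])
qed

lemma linear_dsum_vec: "linear (\<lambda>p. dsum_vec (fst p) (snd p))"
  by (intro linearI poly_mapping_eqI)
    (auto simp: lookup_add dsum_vec.rep_eq split: sum.splits)

lemma inner_product_on_pos:
  assumes "inner_product_on S b" "x \<in> S" "x \<noteq> 0"
  shows "b x x > 0"
  using assms by (simp add: inner_product_on_def)

lemma inner_product_on_nonneg:
  assumes "inner_product_on S b" "x \<in> S"
  shows "b x x \<ge> 0"
proof (cases "x = 0")
  case True
  have "\<forall>c. b (c *\<^sub>R x) x = c *\<^sub>R b x x"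
    using assms by (simp add: inner_product_on_def linear_on_subspace_def)
  from this[rule_format, of 0] True show ?thesis
    by simp
qed (use inner_product_on_pos[OF assms] in simp)

lemma orthogonal_rep_dsum:
  assumes "orthogonal_rep U" "orthogonal_rep V"
  shows "orthogonal_rep (U \<oplus>\<^sub>r V)"
proof -
  let ?d = "\<lambda>p. dsum_vec (fst p) (snd p)"
  let ?C = "rcarrier U \<times> rcarrier V"
  have carrier: "rcarrier (U \<oplus>\<^sub>r V) = ?d ` ?C"
    by (force simp: dsum_def)
  have sub: "subspace (rcarrier U)" "subspace (rcarrier V)"
    using assms by (auto simp: orthogonal_rep_def)
  then have "subspace ?C"
    by (rule subspace_Times)
  then have 1: "subspace (?d ` ?C)"
    by (rule linear_subspace_image[OF linear_dsum_vec])
  obtain B D where BD: "finite B" "span B = rcarrier U" "finite D" "span D = rcarrier V"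
    using assms unfolding orthogonal_rep_def by blast
  have dsum_add: "dsum_vec u v + dsum_vec u' v' = dsum_vec (u + u') (v + v')"
    for u u' :: "'a \<Rightarrow>\<^sub>0 real" and v v' :: "'b \<Rightarrow>\<^sub>0 real"
    using linear_add[OF linear_dsum_vec, of "(u, v)" "(u', v')"] by simp
  have dsum_scale: "c *\<^sub>R dsum_vec u v = dsum_vec (c *\<^sub>R u) (c *\<^sub>R v)"
    for c and u :: "'a \<Rightarrow>\<^sub>0 real" and v :: "'b \<Rightarrow>\<^sub>0 real"
    using linear_scale[OF linear_dsum_vec, of c "(u, v)"] by simp
  let ?l = "\<lambda>u :: 'a \<Rightarrow>\<^sub>0 real. dsum_vec u (0 :: 'b \<Rightarrow>\<^sub>0 real)"
  let ?r = "\<lambda>v :: 'b \<Rightarrow>\<^sub>0 real. dsum_vec (0 :: 'a \<Rightarrow>\<^sub>0 real) v"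
  have lin: "linear ?l" and lin0: "linear ?r"
    by (rule linearI; simp add: dsum_add dsum_scale)+
  have "span (?l ` B) = ?l ` rcarrier U"
    and "span (?r ` D) = ?r ` rcarrier V"
    by (simp_all add: linear_span_image[OF lin] linear_span_image[OF lin0] BD)
  then have "span (?l ` B \<union> ?r ` D) =
      {x + y |x y. x \<in> ?l ` rcarrier U \<and> y \<in> ?r ` rcarrier V}"
    by (simp only: span_Un)
  also have "\<dots> = ?d ` ?C"
  proof (intro equalityI subsetI)
    fix z
    assume "z \<in> {x + y |x y. x \<in> ?l ` rcarrier U \<and> y \<in> ?r ` rcarrier V}"
    then obtain u v where "u \<in> rcarrier U" "v \<in> rcarrier V" "z = dsum_vec u v"
      by (auto simp: dsum_add)
    then show "z \<in> ?d ` ?C"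
      by (intro image_eqI[of _ _ "(u, v)"]) auto
  next
    fix z
    assume "z \<in> ?d ` ?C"
    then obtain u v where uv: "u \<in> rcarrier U" "v \<in> rcarrier V" "z = dsum_vec u v"
      by auto
    moreover have "z = dsum_vec u 0 + dsum_vec 0 v"
      using uv by (simp add: dsum_add)
    ultimately show "z \<in> {x + y |x y. x \<in> ?l ` rcarrier U \<and> y \<in> ?r ` rcarrier V}"
      by blast
  qed
  finally have "span (?l ` B \<union> ?r ` D) = ?d ` ?C" .
  then have 2: "\<exists>B. finite B \<and> span B = ?d ` ?C"
    using BD by (metis finite_UnI finite_imageI)
  have ip: "inner_product_on (rcarrier U) (rinner U)" "inner_product_on (rcarrier V) (rinner V)"
    using assms by (simp_all add: orthogonal_rep_def)
  note pos = inner_product_on_nonneg[OF ip(1)] inner_product_on_pos[OF ip(1)]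
  note pos' = inner_product_on_nonneg[OF ip(2)] inner_product_on_pos[OF ip(2)]
  have zero: "dsum_vec 0 0 = (0 :: 'a + 'b \<Rightarrow>\<^sub>0 real)"
    using linear_0[OF linear_dsum_vec] by simp
  have act: "ract (U \<oplus>\<^sub>r V) (dsum_vec u v) = dsum_vec (ract U u) (ract V v)" for u v
    by (simp add: dsum_def)
  have inner: "rinner (U \<oplus>\<^sub>r V) (dsum_vec u v) (dsum_vec u' v') = rinner U u u' + rinner V v v'"
    for u v u' v'
    by (simp add: dsum_def)
  have 3: "linear_on_subspace (?d ` ?C) (ract (U \<oplus>\<^sub>r V))"
    using assms unfolding orthogonal_rep_def linear_on_subspace_def
    by (auto simp: act dsum_add dsum_scale)
  have 4: "\<forall>x\<in>?d ` ?C. ract (U \<oplus>\<^sub>r V) x \<in> ?d ` ?C \<and> ract (U \<oplus>\<^sub>r V) (ract (U \<oplus>\<^sub>r V) x) = x"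
  proof
    fix x
    assume "x \<in> ?d ` ?C"
    then obtain u v where uv: "u \<in> rcarrier U" "v \<in> rcarrier V" "x = dsum_vec u v"
      by auto
    have "ract U u \<in> rcarrier U" "ract U (ract U u) = u" "ract V v \<in> rcarrier V" "ract V (ract V v) = v"
      using assms uv(1,2) by (simp_all add: orthogonal_rep_def)
    then show "ract (U \<oplus>\<^sub>r V) x \<in> ?d ` ?C \<and> ract (U \<oplus>\<^sub>r V) (ract (U \<oplus>\<^sub>r V) x) = x"
      unfolding uv(3) act by (auto intro!: image_eqI[of _ _ "(ract U u, ract V v)"])
  qed
  have 5: "\<forall>x\<in>?d ` ?C. \<forall>y\<in>?d ` ?C.
      rinner (U \<oplus>\<^sub>r V) (ract (U \<oplus>\<^sub>r V) x) (ract (U \<oplus>\<^sub>r V) y) = rinner (U \<oplus>\<^sub>r V) x y"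
    using assms unfolding orthogonal_rep_def by (auto simp: act inner)
  have 6: "inner_product_on (?d ` ?C) (rinner (U \<oplus>\<^sub>r V))"
    unfolding inner_product_on_def
  proof (intro conjI)
    show "\<forall>y\<in>?d ` ?C. linear_on_subspace (?d ` ?C) (\<lambda>x. rinner (U \<oplus>\<^sub>r V) x y)"
      using assms unfolding orthogonal_rep_def inner_product_on_def linear_on_subspace_def
      by (auto simp: inner dsum_add dsum_scale algebra_simps)
    show "\<forall>x\<in>?d ` ?C. \<forall>y\<in>?d ` ?C. rinner (U \<oplus>\<^sub>r V) x y = rinner (U \<oplus>\<^sub>r V) y x"
      using assms unfolding orthogonal_rep_def inner_product_on_def by (auto simp: inner)
    show "\<forall>x\<in>?d ` ?C. x \<noteq> 0 \<longrightarrow> 0 < rinner (U \<oplus>\<^sub>r V) x x"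
    proof clarsimp
      fix u v
      assume uv: "u \<in> rcarrier U" "v \<in> rcarrier V" "dsum_vec u v \<noteq> 0"
      then have "u \<noteq> 0 \<or> v \<noteq> 0"
        using zero by auto
      then show "0 < rinner (U \<oplus>\<^sub>r V) (dsum_vec u v) (dsum_vec u v)"
        using pos(1)[OF uv(1)] pos'(1)[OF uv(2)] pos(2)[OF uv(1)] pos'(2)[OF uv(2)]
        by (auto simp: inner add_pos_nonneg add_nonneg_pos)
    qed
  qed
  show ?thesis
    unfolding orthogonal_rep_def carrier using 1 2 3 4 5 6 by blast
qed


section \<open>Tensor products\<close>

text \<open>
  The tensor product of subspaces of \<^typ>\<open>'i \<Rightarrow>\<^sub>0 real\<close> and \<^typ>\<open>'j \<Rightarrow>\<^sub>0 real\<close> is realised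
  inside \<^typ>\<open>'i \<times> 'j \<Rightarrow>\<^sub>0 real\<close>, the tensor product of the two ambient spaces: the basis
  vector at \<open>(i, j)\<close> is the tensor of the basis vectors at \<open>i\<close> and at \<open>j\<close>.
\<close>

lift_definition tensor_vec :: "('i \<Rightarrow>\<^sub>0 real) \<Rightarrow> ('j \<Rightarrow>\<^sub>0 real) \<Rightarrow> ('i \<times> 'j \<Rightarrow>\<^sub>0 real)"
  is "\<lambda>w v (i, j). w i * v j"
proof -
  fix w :: "'i \<Rightarrow> real" and v :: "'j \<Rightarrow> real"
  assume "finite {i. w i \<noteq> 0}" "finite {j. v j \<noteq> 0}"
  then have "finite ({i. w i \<noteq> 0} \<times> {j. v j \<noteq> 0})"
    by blast
  then show "finite {p. (case p of (i, j) \<Rightarrow> w i * v j) \<noteq> 0}"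
    by (rule rev_finite_subset) auto
qed

definition tensor_space ::
    "('i \<Rightarrow>\<^sub>0 real) set \<Rightarrow> ('j \<Rightarrow>\<^sub>0 real) set \<Rightarrow> ('i \<times> 'j \<Rightarrow>\<^sub>0 real) set"
  where "tensor_space W V = span {tensor_vec w v |w v. w \<in> W \<and> v \<in> V}"

text \<open>
  \<open>tensor_map W V f g\<close> is the tensor product of maps \<open>f\<close> and \<open>g\<close> that are linear on \<open>W\<close> and on
  \<open>V\<close>. Only its values on the tensor product of \<open>W\<close> and \<open>V\<close> are determined.
\<close>

definition tensor_map ::
    "('i \<Rightarrow>\<^sub>0 real) set \<Rightarrow> ('j \<Rightarrow>\<^sub>0 real) set \<Rightarrow>
     (('i \<Rightarrow>\<^sub>0 real) \<Rightarrow> ('k \<Rightarrow>\<^sub>0 real)) \<Rightarrow> (('j \<Rightarrow>\<^sub>0 real) \<Rightarrow> ('l \<Rightarrow>\<^sub>0 real)) \<Rightarrow>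
     ('i \<times> 'j \<Rightarrow>\<^sub>0 real) \<Rightarrow> ('k \<times> 'l \<Rightarrow>\<^sub>0 real)"
  where "tensor_map W V f g =
    (SOME h. linear h \<and> (\<forall>w\<in>W. \<forall>v\<in>V. h (tensor_vec w v) = tensor_vec (f w) (g v)))"

lemma lookup_tensor_vec [simp]:
  "Poly_Mapping.lookup (tensor_vec w v) (i, j) = Poly_Mapping.lookup w i * Poly_Mapping.lookup v j"
  by (simp add: tensor_vec.rep_eq)

lemma linear_tensor_vec_left: "linear (\<lambda>w. tensor_vec w v)"
  by (intro linearI poly_mapping_eqI) (auto simp: lookup_add algebra_simps split: prod.splits)

lemma linear_tensor_vec_right: "linear (tensor_vec w)"
  by (intro linearI poly_mapping_eqI) (auto simp: lookup_add algebra_simps split: prod.splits)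

lemma poly_mapping_sum_single_superset:
  fixes x :: "'i \<Rightarrow>\<^sub>0 real"
  assumes "finite K" "Poly_Mapping.keys x \<subseteq> K"
  shows "x = (\<Sum>i\<in>K. Poly_Mapping.lookup x i *\<^sub>R Poly_Mapping.single i 1)"
proof (rule poly_mapping_eqI)
  fix k
  have "Poly_Mapping.lookup (\<Sum>i\<in>K. Poly_Mapping.lookup x i *\<^sub>R Poly_Mapping.single i 1) k
      = (\<Sum>i\<in>K. if i = k then Poly_Mapping.lookup x i else 0)"
    by (simp add: lookup_sum lookup_single when_def if_distrib cong: if_cong)
  also have "\<dots> = Poly_Mapping.lookup x k"
    using assms by (auto simp: in_keys_iff)
  finally show "Poly_Mapping.lookup x k =
      Poly_Mapping.lookup (\<Sum>i\<in>K. Poly_Mapping.lookup x i *\<^sub>R Poly_Mapping.single i 1) k" ..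
qed

lemma linear_on_subspace_extend:
  assumes "subspace S" "linear_on_subspace S f"
  obtains F where "linear F" "\<And>x. x \<in> S \<Longrightarrow> F x = f x"
proof -
  obtain B where B: "B \<subseteq> S" "independent B" "S \<subseteq> span B"
    using maximal_independent_subset by blast
  then obtain F where F: "linear F" "\<forall>x\<in>B. F x = f x"
    using linear_independent_extend by blast
  have "subspace {x \<in> S. F x = f x}"
  proof -
    have "f 0 = 0"
      using assms unfolding linear_on_subspace_def by (metis scaleR_zero_left subspace_0)
    then show ?thesis
      using assms F(1) unfolding linear_on_subspace_def
      by (auto simp: subspace_def linear_0 linear_add linear_scale)
  qed
  then have "span B \<subseteq> {x \<in> S. F x = f x}"
    using B F by (intro span_minimal) auto
  then show ?thesis
    using that[OF F(1)] B by blast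
qed

lemma tensor_map_exists:
  fixes F :: "('a \<Rightarrow>\<^sub>0 real) \<Rightarrow> ('k \<Rightarrow>\<^sub>0 real)"
    and G :: "('b \<Rightarrow>\<^sub>0 real) \<Rightarrow> ('l \<Rightarrow>\<^sub>0 real)"
  assumes "linear F" "linear G"
  shows "\<exists>h. linear h \<and> (\<forall>w v. h (tensor_vec w v) = tensor_vec (F w) (G v))"
proof -
  define S where "S = range (\<lambda>p :: 'a \<times> 'b. Poly_Mapping.single p (1::real))"
  have ind: "independent S"
  proof (unfold independent_explicit_module, intro allI impI)
    fix T :: "('a \<times> 'b \<Rightarrow>\<^sub>0 real) set" and u b
    assume T: "finite T" "T \<subseteq> S" "(\<Sum>v\<in>T. u v *\<^sub>R v) = 0" "b \<in> T"
    then obtain p where p: "b = Poly_Mapping.single p 1"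
      unfolding S_def by blast
    have *: "Poly_Mapping.lookup v p = (if v = b then 1 else 0)" if "v \<in> T" for v
    proof -
      obtain q where q: "v = Poly_Mapping.single q 1"
        using \<open>v \<in> T\<close> T(2) unfolding S_def by blast
      have "v = b \<longleftrightarrow> q = p"
        unfolding p q by (metis lookup_single_eq lookup_single_not_eq zero_neq_one)
      then show ?thesis
        by (simp add: q lookup_single when_def)
    qed
    have "0 = Poly_Mapping.lookup (\<Sum>v\<in>T. u v *\<^sub>R v) p"
      using T by simp
    also have "\<dots> = (\<Sum>v\<in>T. if v = b then u v else 0)"
      using * by (auto simp: lookup_sum intro!: sum.cong)
    also have "\<dots> = u b"
      using T by simp
    finally show "u b = 0" ..
  qed
  define k where "k = (\<lambda>s. let p = (SOME p. s = Poly_Mapping.single p (1::real)) in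
      tensor_vec (F (Poly_Mapping.single (fst p) 1)) (G (Poly_Mapping.single (snd p) 1)))"
  have k: "k (Poly_Mapping.single p 1) =
      tensor_vec (F (Poly_Mapping.single (fst p) 1)) (G (Poly_Mapping.single (snd p) 1))" for p
  proof -
    have "(SOME q. Poly_Mapping.single p (1::real) = Poly_Mapping.single q 1) = p"
      by (rule some_equality) (auto, metis lookup_single_eq lookup_single_not_eq zero_neq_one)
    then show ?thesis
      by (simp add: k_def)
  qed
  obtain h where h: "linear h" "\<forall>s\<in>S. h s = k s"
    using linear_independent_extend[OF ind] by blast
  have single: "tensor_vec (Poly_Mapping.single i 1) (Poly_Mapping.single j 1)
      = Poly_Mapping.single (i, j) 1" for i :: 'a and j :: 'b
    by (rule poly_mapping_eqI) (auto simp: lookup_single when_def split: prod.splits if_splits)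
  have "h (tensor_vec w v) = tensor_vec (F w) (G v)" for w v
  proof -
    let ?e = "\<lambda>i. Poly_Mapping.single i (1::real)"
    let ?w = "Poly_Mapping.lookup w" and ?v = "Poly_Mapping.lookup v"
    let ?K = "Poly_Mapping.keys w" and ?L = "Poly_Mapping.keys v"
    have w: "w = (\<Sum>i\<in>?K. ?w i *\<^sub>R ?e i)" and v: "v = (\<Sum>j\<in>?L. ?v j *\<^sub>R ?e j)"
      by (auto intro: poly_mapping_sum_single_superset)
    have "tensor_vec w v = (\<Sum>i\<in>?K. ?w i *\<^sub>R tensor_vec (?e i) v)"
      by (subst w) (simp add: linear_sum[OF linear_tensor_vec_left] linear_scale[OF linear_tensor_vec_left])
    also have "\<dots> = (\<Sum>i\<in>?K. ?w i *\<^sub>R (\<Sum>j\<in>?L. ?v j *\<^sub>R ?e (i, j)))"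
      by (subst v) (simp add: linear_sum[OF linear_tensor_vec_right] linear_scale[OF linear_tensor_vec_right] single)
    finally have "h (tensor_vec w v) = (\<Sum>i\<in>?K. ?w i *\<^sub>R (\<Sum>j\<in>?L. ?v j *\<^sub>R tensor_vec (F (?e i)) (G (?e j))))"
      using h(2) k by (simp add: linear_sum[OF h(1)] linear_scale[OF h(1)] S_def)
    also have "\<dots> = (\<Sum>i\<in>?K. ?w i *\<^sub>R tensor_vec (F (?e i)) (G v))"
      by (subst (2) v) (simp add: linear_sum[OF assms(2)] linear_scale[OF assms(2)]
          linear_sum[OF linear_tensor_vec_right] linear_scale[OF linear_tensor_vec_right])
    also have "\<dots> = tensor_vec (F w) (G v)"
      by (subst (3) w) (simp add: linear_sum[OF assms(1)] linear_scale[OF assms(1)]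
          linear_sum[OF linear_tensor_vec_left] linear_scale[OF linear_tensor_vec_left])
    finally show ?thesis .
  qed
  with h(1) show ?thesis by blast
qed

lemma tensor_map_characterization:
  assumes "subspace W" "subspace V" "linear_on_subspace W f" "linear_on_subspace V g"
  shows "linear (tensor_map W V f g)"
    and "\<And>w v. w \<in> W \<Longrightarrow> v \<in> V \<Longrightarrow> tensor_map W V f g (tensor_vec w v) = tensor_vec (f w) (g v)"
proof -
  obtain F where F: "linear F" "\<And>x. x \<in> W \<Longrightarrow> F x = f x"
    using linear_on_subspace_extend[OF assms(1,3)] by blast
  obtain G where G: "linear G" "\<And>x. x \<in> V \<Longrightarrow> G x = g x"
    using linear_on_subspace_extend[OF assms(2,4)] by blast
  have "\<exists>h. linear h \<and> (\<forall>w\<in>W. \<forall>v\<in>V. h (tensor_vec w v) = tensor_vec (f w) (g v))"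
    using tensor_map_exists[OF F(1) G(1)] F(2) G(2) by metis
  from someI_ex[OF this]
  show "linear (tensor_map W V f g)"
    and "\<And>w v. w \<in> W \<Longrightarrow> v \<in> V \<Longrightarrow> tensor_map W V f g (tensor_vec w v) = tensor_vec (f w) (g v)"
    unfolding tensor_map_def by auto
qed


section \<open>Pointed spaces with an action of the group with two elements\<close>

record 'a c2space =
  stop :: "'a topology"
  sact :: "'a \<Rightarrow> 'a"
  spt :: 'a

definition c2_homeomorphic :: "'a c2space \<Rightarrow> 'b c2space \<Rightarrow> bool"
  where "c2_homeomorphic X Y \<longleftrightarrow>
    (\<exists>h. homeomorphic_map (stop X) (stop Y) h \<and>
         (\<forall>x\<in>topspace (stop X). h (sact X x) = sact Y (h x)) \<and>
         h (spt X) = spt Y)"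

text \<open>
  The one-point compactification of a subset of a topological space with an involution; the
  added point is \<^term>\<open>None\<close>, is the base point, and is isolated if the subset is compact.
\<close>

definition c2_compactification :: "'a::topological_space set \<Rightarrow> ('a \<Rightarrow> 'a) \<Rightarrow> 'a option c2space"
  where "c2_compactification S s =
    \<lparr>stop = Alexandroff_compactification (top_of_set S), sact = map_option s, spt = None\<rparr>"

definition quotient_topology :: "'a topology \<Rightarrow> ('a \<Rightarrow> 'b) \<Rightarrow> 'b topology"
  where "quotient_topology X q =
    topology (\<lambda>U. U \<subseteq> q ` topspace X \<and> openin X {x \<in> topspace X. q x \<in> U})"

lemma openin_quotient_topology:
  "openin (quotient_topology X q) U \<longleftrightarrow>
    U \<subseteq> q ` topspace X \<and> openin X {x \<in> topspace X. q x \<in> U}"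
proof -
  have "istopology (\<lambda>U. U \<subseteq> q ` topspace X \<and> openin X {x \<in> topspace X. q x \<in> U})"
    unfolding istopology_def
  proof (intro conjI allI impI)
    fix S T
    assume "S \<subseteq> q ` topspace X \<and> openin X {x \<in> topspace X. q x \<in> S}"
      "T \<subseteq> q ` topspace X \<and> openin X {x \<in> topspace X. q x \<in> T}"
    moreover have "{x \<in> topspace X. q x \<in> S \<inter> T} =
        {x \<in> topspace X. q x \<in> S} \<inter> {x \<in> topspace X. q x \<in> T}"
      by auto
    ultimately show "S \<inter> T \<subseteq> q ` topspace X" "openin X {x \<in> topspace X. q x \<in> S \<inter> T}"
      by auto
  next
    fix K
    assume K: "\<forall>S\<in>K. S \<subseteq> q ` topspace X \<and> openin X {x \<in> topspace X. q x \<in> S}"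
    have "{x \<in> topspace X. q x \<in> \<Union> K} = (\<Union>S\<in>K. {x \<in> topspace X. q x \<in> S})"
      by auto
    with K show "\<Union> K \<subseteq> q ` topspace X" "openin X {x \<in> topspace X. q x \<in> \<Union> K}"
      by auto
  qed
  then show ?thesis
    by (simp add: quotient_topology_def)
qed

lemma topspace_quotient_topology [simp]: "topspace (quotient_topology X q) = q ` topspace X"
proof (rule subset_antisym)
  show "topspace (quotient_topology X q) \<subseteq> q ` topspace X"
    by (metis openin_quotient_topology openin_topspace)
  have "{x \<in> topspace X. q x \<in> q ` topspace X} = topspace X"
    by auto
  then have "openin (quotient_topology X q) (q ` topspace X)"
    by (simp add: openin_quotient_topology)
  then show "q ` topspace X \<subseteq> topspace (quotient_topology X q)"
    by (rule openin_subset)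
qed

lemma quotient_map_quotient_topology: "quotient_map X (quotient_topology X q) q"
  by (simp add: quotient_map_def openin_quotient_topology)

definition disjoint_union_topology :: "'a topology \<Rightarrow> 'b topology \<Rightarrow> ('a + 'b) topology"
  where "disjoint_union_topology X Y =
    topology (\<lambda>U. openin X (Inl -` U) \<and> openin Y (Inr -` U))"

lemma openin_disjoint_union_topology:
  "openin (disjoint_union_topology X Y) U \<longleftrightarrow> openin X (Inl -` U) \<and> openin Y (Inr -` U)"
proof -
  have "istopology (\<lambda>U. openin X (Inl -` U) \<and> openin Y (Inr -` U))"
    by (auto simp: istopology_def vimage_Union)
  then show ?thesis
    by (simp add: disjoint_union_topology_def)
qed

text \<open>
  The smash product: \<^term>\<open>None\<close> is the point to which the wedge is collapsed.
\<close>

definition smash :: "'a c2space \<Rightarrow> 'b c2space \<Rightarrow> ('a \<times> 'b) option c2space"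
  where "smash X Y =
    \<lparr>stop = quotient_topology (prod_topology (stop X) (stop Y))
       (\<lambda>(x, y). if x = spt X \<or> y = spt Y then None else Some (x, y)),
     sact = map_option (map_prod (sact X) (sact Y)),
     spt = None\<rparr>"

text \<open>
  The homotopy cofibre (reduced mapping cone) of a pointed equivariant map \<open>f\<close> from \<open>X\<close> to \<open>Y\<close>:
  the quotient of the disjoint union of \<open>X \<times> [0,1]\<close> and \<open>Y\<close> that identifies \<open>(x, 0)\<close> with
  \<open>f x\<close>, and identifies all \<open>(x, 1)\<close> and all \<open>(x\<^sub>0, t)\<close>, where \<open>x\<^sub>0\<close> is the base point of \<open>X\<close>,
  with the base point of \<open>Y\<close>. The map \<open>hocofibre_proj\<close> sends a point to the representative of
  its class that is in \<open>Y\<close>, or else is the point itself.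
\<close>

definition hocofibre_proj ::
    "'a c2space \<Rightarrow> 'b c2space \<Rightarrow> ('a \<Rightarrow> 'b) \<Rightarrow> ('a \<times> real) + 'b \<Rightarrow> ('a \<times> real) + 'b"
  where "hocofibre_proj X Y f z =
    (case z of
       Inl (x, t) \<Rightarrow>
         if x = spt X \<or> t = 1 then Inr (spt Y)
         else if t = 0 then Inr (f x)
         else Inl (x, t)
     | Inr y \<Rightarrow> Inr y)"

definition hocofibre ::
    "'a c2space \<Rightarrow> 'b c2space \<Rightarrow> ('a \<Rightarrow> 'b) \<Rightarrow> (('a \<times> real) + 'b) c2space"
  where "hocofibre X Y f =
    \<lparr>stop = quotient_topology
       (disjoint_union_topology (prod_topology (stop X) (top_of_set {0..1})) (stop Y))
       (hocofibre_proj X Y f),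
     sact = map_sum (map_prod (sact X) id) (sact Y),
     spt = Inr (spt Y)\<rparr>"


section \<open>The Thom spaces and their composition\<close>

text \<open>
  Isometries are extended by \<^term>\<open>undefined\<close> outside the source. Function types carry the
  topology of pointwise convergence.
\<close>

definition isometries :: "'i rep \<Rightarrow> 'j rep \<Rightarrow> (('i \<Rightarrow>\<^sub>0 real) \<Rightarrow> ('j \<Rightarrow>\<^sub>0 real)) set"
  where "isometries U V =
    {f \<in> rcarrier U \<rightarrow>\<^sub>E rcarrier V.
       linear_on_subspace (rcarrier U) f \<and>
       (\<forall>x\<in>rcarrier U. \<forall>y\<in>rcarrier U. rinner V (f x) (f y) = rinner U x y)}"

definition isometries_act ::
    "'i rep \<Rightarrow> 'j rep \<Rightarrow> (('i \<Rightarrow>\<^sub>0 real) \<Rightarrow> ('j \<Rightarrow>\<^sub>0 real)) \<Rightarrow> (('i \<Rightarrow>\<^sub>0 real) \<Rightarrow> ('j \<Rightarrow>\<^sub>0 real))"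
  where "isometries_act U V f = restrict (\<lambda>u. ract V (f (ract U u))) (rcarrier U)"

definition orth_complement :: "'j rep \<Rightarrow> ('j \<Rightarrow>\<^sub>0 real) set \<Rightarrow> ('j \<Rightarrow>\<^sub>0 real) set"
  where "orth_complement V S = {x \<in> rcarrier V. \<forall>s\<in>S. rinner V x s = 0}"

type_synonym ('k, 'i, 'j) bundle_point =
  "(('i \<Rightarrow>\<^sub>0 real) \<Rightarrow> ('j \<Rightarrow>\<^sub>0 real)) \<times> ('k \<times> 'j \<Rightarrow>\<^sub>0 real)"

definition C2gamma :: "'k rep \<Rightarrow> 'i rep \<Rightarrow> 'j rep \<Rightarrow> ('k, 'i, 'j) bundle_point set"
  where "C2gamma W U V =
    {(f, x). f \<in> isometries U V \<and>
       x \<in> tensor_space (rcarrier W) (orth_complement V (f ` rcarrier U))}"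

definition C2gamma_act ::
    "'k rep \<Rightarrow> 'i rep \<Rightarrow> 'j rep \<Rightarrow> ('k, 'i, 'j) bundle_point \<Rightarrow> ('k, 'i, 'j) bundle_point"
  where "C2gamma_act W U V =
    map_prod (isometries_act U V) (tensor_map (rcarrier W) (rcarrier V) (ract W) (ract V))"

definition C2J :: "'k rep \<Rightarrow> 'i rep \<Rightarrow> 'j rep \<Rightarrow> ('k, 'i, 'j) bundle_point option c2space"
  where "C2J W U V = c2_compactification (C2gamma W U V) (C2gamma_act W U V)"

text \<open>\<open>C2J_comp W U V p q\<close> composes \<open>p\<close> in \<open>C2J W V X\<close> with \<open>q\<close> in \<open>C2J W U V\<close>.\<close>

definition C2J_comp ::
    "'k rep \<Rightarrow> 'i rep \<Rightarrow> 'j rep \<Rightarrow>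
     ('k, 'j, 'l) bundle_point option \<Rightarrow> ('k, 'i, 'j) bundle_point option \<Rightarrow>
     ('k, 'i, 'l) bundle_point option"
  where "C2J_comp W U V p q =
    (case (p, q) of
       (Some (f, x), Some (g, y)) \<Rightarrow>
         Some (compose (rcarrier U) f g, x + tensor_map (rcarrier W) (rcarrier V) id f y)
     | _ \<Rightarrow> None)"

definition tensor_sphere :: "'k rep \<Rightarrow> 'a rep \<Rightarrow> ('k \<times> 'a \<Rightarrow>\<^sub>0 real) option c2space"
  where "tensor_sphere W A =
    c2_compactification (tensor_space (rcarrier W) (rcarrier A))
      (tensor_map (rcarrier W) (rcarrier A) (ract W) (ract A))"

text \<open>
  The identification of \<open>tensor_sphere W A\<close> with the closure in \<open>C2J W U (U \<oplus>\<^sub>r A)\<close> of the set of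
  pairs whose first component is the standard inclusion \<open>u \<mapsto> (u, 0)\<close>. The orthogonal complement
  of the image of that inclusion consists of the vectors \<open>(0, a)\<close>.
\<close>

definition tensor_sphere_incl ::
    "'k rep \<Rightarrow> 'i rep \<Rightarrow> 'a rep \<Rightarrow> ('k \<times> 'a \<Rightarrow>\<^sub>0 real) option \<Rightarrow> ('k, 'i, 'i + 'a) bundle_point option"
  where "tensor_sphere_incl W U A =
    map_option (\<lambda>x. (restrict (\<lambda>u. dsum_vec u 0) (rcarrier U),
      tensor_map (rcarrier W) (rcarrier A) id (dsum_vec 0) x))"

definition restricted_comp ::
    "'k rep \<Rightarrow> 'i rep \<Rightarrow> 'a rep \<Rightarrow>
     (('k, 'i + 'a, 'j) bundle_point option \<times> ('k \<times> 'a \<Rightarrow>\<^sub>0 real) option) option \<Rightarrow>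
     ('k, 'i, 'j) bundle_point option"
  where "restricted_comp W U A z =
    (case z of
       None \<Rightarrow> None
     | Some (p, s) \<Rightarrow> C2J_comp W U (U \<oplus>\<^sub>r A) p (tensor_sphere_incl W U A s))"

end

theory Submission
  imports Defs
begin

text \<open>
  A point of the Thom space over \<open>W \<oplus> \<real>\<^sup>\<alpha>\<close> is an isometry \<open>f\<close> together with \<open>y\<close> in
  \<open>W \<otimes> f(U)\<^sup>\<bottom>\<close> and \<open>v\<close> in \<open>f(U)\<^sup>\<bottom>\<close>. Where \<open>v = 0\<close> this is a point of the Thom space over \<open>W\<close>.
  Where \<open>v \<noteq> 0\<close>, write \<open>v = t/(1 - t) \<cdot> e\<close> with \<open>e\<close> a unit vector and \<open>0 < t < 1\<close>: then \<open>f\<close> and \<open>e\<close>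
  form an isometry \<open>F\<close> from \<open>U \<oplus> \<real>\<^sup>\<alpha>\<close>, and \<open>y = x + s \<otimes> e\<close> for a unique \<open>s\<close>, the contraction of \<open>y\<close>
  with \<open>e\<close>, and a unique \<open>x\<close> in \<open>W \<otimes> F(U \<oplus> \<real>\<^sup>\<alpha>)\<^sup>\<bottom>\<close>. So \<open>(F, x, s, t)\<close> is a point of the open cone,
  and \<open>(f, y)\<close> is the image of \<open>(F, x, s)\<close> under composition. The resulting bijection is continuous because
  \<open>(F, x, s, t) \<mapsto> (f, y, v)\<close> is proper, and a continuous bijection from a compact space to a
  Hausdorff space is a homeomorphism.
\<close>

section \<open>One-point compactifications and mapping cones\<close>

text \<open>The parameter \<open>t/(1 - t)\<close> makes both ends of the cone fit. It vanishes at t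
  = 0, where the cone point becomes the image of the composite with vanishing line component, and it
  tends to infinity at t = 1, which is collapsed to the base point. On the cone the map is therefore
  one formula on the finite points with t in [0,1) and infinity elsewhere, so that continuity at
  infinity is exactly a norm estimate for that formula. Equivariance hinges on the sign \<epsilon>
  by which \<sigma> acts on the line: it multiplies both s and e, hence cancels in s \<otimes> e,
  and it survives in v, where it is the action on the line summand. Two features shape the rest. The
  inner product is arbitrary and meaningful only on a finite-dimensional subspace of a normed space
  that may be infinite-dimensional; finiteness of supports reduces this to finitely many
  coordinates. And the fibre moves with f; contraction with vectors of f(U) replaces the moving
  fibre by equations in one fixed space, continuous in (f, y).\<close>

lemma continuous_map_the_Alexandroff:
  "continuous_map (subtopology (Alexandroff_compactification X) (Some ` topspace X)) X the"
proof -
  have "{x \<in> Some ` topspace X. the x \<in> U} = Some ` U" if "openin X U" for U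
    using openin_subset[OF that] by (auto simp: image_iff)
  moreover have "openin (subtopology (Alexandroff_compactification X) (Some ` topspace X)) (Some ` U)"
    if "openin X U" for U
    unfolding openin_subtopology using that openin_subset[OF that]
    by (intro exI[of _ "Some ` U"]) auto
  ultimately show ?thesis
    by (auto simp: continuous_map_def)
qed

text \<open>Neighbourhoods of infinity are complements of closed compact sets C, so continuity there
  asks that the preimage of C be closed in all of Z. It is closed in \<Omega> by continuity of
  \<open>g\<close>, and \<open>proper\<close> traps it in a compact, hence closed, subset of Z that
  lies inside \<Omega>.\<close>

lemma continuous_map_into_Alexandroff:
  assumes "Hausdorff_space Z" "openin Z \<Omega>"
    and g: "continuous_map (subtopology Z \<Omega>) X g"
    and some: "\<And>z. z \<in> \<Omega> \<Longrightarrow> \<phi> z = Some (g z)"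
    and none: "\<And>z. z \<in> topspace Z - \<Omega> \<Longrightarrow> \<phi> z = None"
    and proper: "\<And>K. compactin X K \<Longrightarrow> \<exists>C. compactin Z C \<and> C \<subseteq> \<Omega> \<and> {z \<in> \<Omega>. g z \<in> K} \<subseteq> C"
  shows "continuous_map Z (Alexandroff_compactification X) \<phi>"
  unfolding continuous_map_def
proof (intro conjI allI impI)
  have sub: "\<Omega> \<subseteq> topspace Z"
    using assms(2) by (rule openin_subset)
  have gX: "g z \<in> topspace X" if "z \<in> \<Omega>" for z
    using continuous_map_image_subset_topspace[OF g] that sub by auto
  show "\<phi> \<in> topspace Z \<rightarrow> topspace (Alexandroff_compactification X)"
    using some none gX by (force simp: Pi_iff)
  fix N
  assume "openin (Alexandroff_compactification X) N"
  then consider U where "openin X U" "N = Some ` U"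
    | C where "compactin X C" "closedin X C" "N = insert None (Some ` (topspace X - C))"
    by (auto simp: openin_Alexandroff_compactification)
  then show "openin Z {z \<in> topspace Z. \<phi> z \<in> N}"
  proof cases
    case 1
    have "openin (subtopology Z \<Omega>) {z \<in> topspace (subtopology Z \<Omega>). g z \<in> U}"
      using g 1(1) by (simp add: continuous_map_def)
    then have "openin Z {z \<in> topspace (subtopology Z \<Omega>). g z \<in> U}"
      using assms(2) openin_trans_full by blast
    moreover have "\<phi> z \<in> N \<longleftrightarrow> z \<in> \<Omega> \<and> g z \<in> U" if "z \<in> topspace Z" for z
      using that some[of z] none[of z] 1(2) by (cases "z \<in> \<Omega>") auto
    then have "{z \<in> topspace Z. \<phi> z \<in> N} = {z \<in> topspace (subtopology Z \<Omega>). g z \<in> U}"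
      by auto
    ultimately show ?thesis
      by simp
  next
    case 2
    obtain D where D: "compactin Z D" "D \<subseteq> \<Omega>" "{z \<in> \<Omega>. g z \<in> C} \<subseteq> D"
      using proper[OF 2(1)] by blast
    have "closedin (subtopology Z \<Omega>) {z \<in> topspace (subtopology Z \<Omega>). g z \<in> C}"
      using g 2(2) closedin_continuous_map_preimage by blast
    then have "closedin (subtopology (subtopology Z \<Omega>) D) ({z \<in> topspace (subtopology Z \<Omega>). g z \<in> C} \<inter> D)"
      by (auto simp: closedin_subtopology)
    moreover have "{z \<in> topspace (subtopology Z \<Omega>). g z \<in> C} \<inter> D = {z \<in> \<Omega>. g z \<in> C}"
      using D sub by auto
    ultimately have "closedin (subtopology Z D) {z \<in> \<Omega>. g z \<in> C}"
      using D(2) by (simp add: subtopology_subtopology inf_absorb2)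
    then have "closedin Z {z \<in> \<Omega>. g z \<in> C}"
      using compactin_imp_closedin[OF assms(1) D(1)] closedin_trans_full by blast
    moreover have "\<phi> z \<in> N \<longleftrightarrow> \<not> (z \<in> \<Omega> \<and> g z \<in> C)" if "z \<in> topspace Z" for z
      using that some[of z] none[of z] 2(3) gX[of z] by (cases "z \<in> \<Omega>") auto
    then have "{z \<in> topspace Z. \<phi> z \<in> N} = topspace Z - {z \<in> \<Omega>. g z \<in> C}"
      by auto
    ultimately show ?thesis
      by auto
  qed
qed

section \<open>Disjoint unions and cones of smash products\<close>

lemma topspace_disjoint_union_topology [simp]:
  "topspace (disjoint_union_topology X Y) = Inl ` topspace X \<union> Inr ` topspace Y"
proof (rule subset_antisym)
  let ?T = "topspace (disjoint_union_topology X Y)"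
  have "openin X (Inl -` ?T)" "openin Y (Inr -` ?T)"
    using openin_topspace[of "disjoint_union_topology X Y"]
    by (simp_all only: openin_disjoint_union_topology)
  then have "Inl -` ?T \<subseteq> topspace X" "Inr -` ?T \<subseteq> topspace Y"
    by (simp_all add: openin_subset)
  then show "?T \<subseteq> Inl ` topspace X \<union> Inr ` topspace Y"
    by (auto simp: image_iff) (metis sum.exhaust vimageI subsetD)
  have "Inl -` (Inl ` topspace X \<union> Inr ` topspace Y) = topspace X"
    "Inr -` (Inl ` topspace X \<union> Inr ` topspace Y) = topspace Y"
    by auto
  then have "openin (disjoint_union_topology X Y) (Inl ` topspace X \<union> Inr ` topspace Y)"
    by (simp add: openin_disjoint_union_topology)
  then show "Inl ` topspace X \<union> Inr ` topspace Y \<subseteq> ?T"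
    by (rule openin_subset)
qed

lemma continuous_map_disjoint_union_topology:
  "continuous_map (disjoint_union_topology X Y) Z f \<longleftrightarrow>
    continuous_map X Z (f \<circ> Inl) \<and> continuous_map Y Z (f \<circ> Inr)"
proof -
  have "Inl -` {x \<in> Inl ` topspace X \<union> Inr ` topspace Y. f x \<in> U} = {x \<in> topspace X. f (Inl x) \<in> U}"
    "Inr -` {x \<in> Inl ` topspace X \<union> Inr ` topspace Y. f x \<in> U} = {x \<in> topspace Y. f (Inr x) \<in> U}" for U
    by auto
  then show ?thesis
    unfolding continuous_map_def
    by (auto simp: openin_disjoint_union_topology Pi_iff)
qed

lemma compact_space_disjoint_union_topology:
  assumes "compact_space X" "compact_space Y"
  shows "compact_space (disjoint_union_topology X Y)"
proof -
  \<comment> \<open>The universal property applied to the identity shows that both injections are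
    continuous.\<close>
  have "continuous_map X (disjoint_union_topology X Y) Inl" "continuous_map Y (disjoint_union_topology X Y) Inr"
    using continuous_map_disjoint_union_topology[of X Y "disjoint_union_topology X Y" id]
    by (simp_all add: comp_def)
  then have "compactin (disjoint_union_topology X Y) (Inl ` topspace X \<union> Inr ` topspace Y)"
    using assms by (intro compactin_Un image_compactin) (auto simp: compact_space_def)
  then show ?thesis
    by (simp add: compact_space_def)
qed

text \<open>The collapse that \<open>smash\<close> writes inline gets a name, since continuity out
  of the smash product is tested by composing with it.\<close>

definition smash_proj :: "'a c2space \<Rightarrow> 'b c2space \<Rightarrow> 'a \<times> 'b \<Rightarrow> ('a \<times> 'b) option"
  where "smash_proj X Y = (\<lambda>(x, y). if x = spt X \<or> y = spt Y then None else Some (x, y))"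

lemma stop_smash:
  "stop (smash X Y) = quotient_topology (prod_topology (stop X) (stop Y)) (smash_proj X Y)"
  by (simp add: smash_def smash_proj_def)

text \<open>
  Since the interval is locally compact, multiplying with it preserves quotient maps, so
  continuity out of the cone of a smash product can be tested on the product.
\<close>

lemma hocofibre_smash_homeomorphic:
  assumes "compact_space (stop X)" "compact_space (stop X')" "compact_space (stop Y)"
    and "Hausdorff_space (stop T)"
    and cone: "continuous_map (prod_topology (prod_topology (stop X) (stop X')) (top_of_set {0..1})) (stop T)
      (\<lambda>(p, t). h (hocofibre_proj (smash X X') Y f (Inl (smash_proj X X' p, t))))"
    and base: "continuous_map (stop Y) (stop T) (h \<circ> Inr)"
    and bij: "bij_betw h (topspace (stop (hocofibre (smash X X') Y f))) (topspace (stop T))"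
    and equivariant: "\<And>z. z \<in> topspace (stop (hocofibre (smash X X') Y f)) \<Longrightarrow>
      h (sact (hocofibre (smash X X') Y f) z) = sact T (h z)"
    and pt: "h (Inr (spt Y)) = spt T"
  shows "c2_homeomorphic (hocofibre (smash X X') Y f) T"
proof -
  let ?S = "smash X X'" and ?I = "top_of_set {0..1::real}"
  let ?H = "hocofibre ?S Y f"
  let ?P = "prod_topology (stop X) (stop X')"
  let ?D = "disjoint_union_topology (prod_topology (stop ?S) ?I) (stop Y)"
  have I: "compact_space ?I" "Hausdorff_space ?I"
    by (simp_all add: compact_space_subtopology Hausdorff_space_subtopology)
  have qS: "quotient_map ?P (stop ?S) (smash_proj X X')"
    unfolding stop_smash by (rule quotient_map_quotient_topology)
  then have q: "quotient_map (prod_topology ?P ?I) (prod_topology (stop ?S) ?I)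
      (\<lambda>(p, t). (smash_proj X X' p, t))"
    using I by (intro quotient_map_prod_left) (auto simp: compact_imp_locally_compact_space)
  have qH: "quotient_map ?D (stop ?H) (hocofibre_proj ?S Y f)"
    unfolding hocofibre_def by (simp add: quotient_map_quotient_topology)
  have "compact_space (stop ?S)"
    using image_compactin[OF _ quotient_imp_continuous_map[OF qS]] quotient_imp_surjective_map[OF qS]
      assms(1,2) by (metis compact_space_def compact_space_prod_topology)
  then have "compact_space ?D"
    using assms(3) I by (intro compact_space_disjoint_union_topology) (simp_all add: compact_space_prod_topology)
  then have compact: "compact_space (stop ?H)"
    using image_compactin[OF _ quotient_imp_continuous_map[OF qH]] quotient_imp_surjective_map[OF qH]
    by (metis compact_space_def)
  have "continuous_map (prod_topology (stop ?S) ?I) (stop T) (h \<circ> hocofibre_proj ?S Y f \<circ> Inl)"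
    using cone by (intro continuous_compose_quotient_map[OF q]) (simp add: comp_def case_prod_unfold)
  moreover have "h \<circ> hocofibre_proj ?S Y f \<circ> Inr = h \<circ> Inr"
    by (auto simp: hocofibre_proj_def)
  ultimately have "continuous_map ?D (stop T) (h \<circ> hocofibre_proj ?S Y f)"
    using base by (simp add: continuous_map_disjoint_union_topology)
  then have "continuous_map (stop ?H) (stop T) h"
    by (rule continuous_compose_quotient_map[OF qH])
  then have "homeomorphic_map (stop ?H) (stop T) h"
    using compact assms(4) bij by (intro continuous_imp_homeomorphic_map) (auto simp: bij_betw_def)
  moreover have "spt ?H = Inr (spt Y)"
    by (simp add: hocofibre_def)
  ultimately show ?thesis
    unfolding c2_homeomorphic_def using equivariant pt by auto
qed

section \<open>The normed space of finitely supported functions\<close>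

text \<open>This is the l1 norm. The terms outside the support vanish, which leaves the index set
  free and lets norms of different vectors be compared over related sets.\<close>

lemma norm_poly_mapping_eq_sum:
  fixes x :: "'i \<Rightarrow>\<^sub>0 real"
  assumes "finite K" "Poly_Mapping.keys x \<subseteq> K"
  shows "norm x = (\<Sum>i\<in>K. \<bar>Poly_Mapping.lookup x i\<bar>)"
proof -
  have "norm x = (\<Sum>i\<in>Poly_Mapping.keys x. \<bar>Poly_Mapping.lookup x i\<bar>)"
    by (simp add: norm_poly_mapping_def dist_poly_mapping_def)
  also have "\<dots> = (\<Sum>i\<in>K. \<bar>Poly_Mapping.lookup x i\<bar>)"
    using assms by (intro sum.mono_neutral_left) (auto simp: in_keys_iff)
  finally show ?thesis .
qed

lemma abs_lookup_le_norm: "\<bar>Poly_Mapping.lookup x i\<bar> \<le> norm x" for x :: "'i \<Rightarrow>\<^sub>0 real"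
proof -
  have "norm x = (\<Sum>j\<in>insert i (Poly_Mapping.keys x). \<bar>Poly_Mapping.lookup x j\<bar>)"
    by (intro norm_poly_mapping_eq_sum) auto
  also have "\<dots> \<ge> \<bar>Poly_Mapping.lookup x i\<bar>"
    by (intro member_le_sum) auto
  finally show ?thesis .
qed

lemma bounded_linear_lookup: "bounded_linear (\<lambda>x :: 'i \<Rightarrow>\<^sub>0 real. Poly_Mapping.lookup x i)"
  by (rule bounded_linear_intro[where K = 1]) (auto simp: lookup_add abs_lookup_le_norm)

text \<open>Reindexing along an injection only forgets coordinates, so it cannot increase the l1
  norm. Slices and the components of a tensor over a sum are all of this kind.\<close>

lemma bounded_linear_map_key:
  assumes "inj f"
  shows "bounded_linear (Poly_Mapping.map_key f :: ('i \<Rightarrow>\<^sub>0 real) \<Rightarrow> _)"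
proof (rule bounded_linear_intro[where K = 1])
  show "Poly_Mapping.map_key f (x + y) = Poly_Mapping.map_key f x + Poly_Mapping.map_key f y"
    and "Poly_Mapping.map_key f (c *\<^sub>R x) = c *\<^sub>R Poly_Mapping.map_key f x"
    and "norm (Poly_Mapping.map_key f x) \<le> norm x * 1" for x y :: "'i \<Rightarrow>\<^sub>0 real" and c
  proof -
    show "Poly_Mapping.map_key f (x + y) = Poly_Mapping.map_key f x + Poly_Mapping.map_key f y"
      and "Poly_Mapping.map_key f (c *\<^sub>R x) = c *\<^sub>R Poly_Mapping.map_key f x"
      by (rule poly_mapping_eqI; simp add: map_key.rep_eq[OF assms] lookup_add)+
    let ?K = "Poly_Mapping.keys (Poly_Mapping.map_key f x)"
    have "norm (Poly_Mapping.map_key f x) = (\<Sum>k\<in>?K. \<bar>Poly_Mapping.lookup x (f k)\<bar>)"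
      by (subst norm_poly_mapping_eq_sum[of ?K]) (simp_all add: map_key.rep_eq[OF assms])
    also have "\<dots> = (\<Sum>i\<in>f ` ?K. \<bar>Poly_Mapping.lookup x i\<bar>)"
      using assms by (simp add: sum.reindex inj_on_subset)
    also have "\<dots> \<le> (\<Sum>i\<in>Poly_Mapping.keys x. \<bar>Poly_Mapping.lookup x i\<bar>)"
      by (intro sum_mono2) (auto simp: keys_map_key[OF assms])
    also have "\<dots> = norm x"
      by (subst norm_poly_mapping_eq_sum[of "Poly_Mapping.keys x"]) auto
    finally show "norm (Poly_Mapping.map_key f x) \<le> norm x * 1"
      by simp
  qed
qed

text \<open>For the l1 norm the double sum factors. The tensor map is thus bounded with constant 1,
  and a tensor with a line is measured by its slice.\<close>

lemma norm_tensor_vec: "norm (tensor_vec w v) = norm w * norm v"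
proof -
  let ?K = "Poly_Mapping.keys w" and ?L = "Poly_Mapping.keys v"
  have "norm (tensor_vec w v) = (\<Sum>p\<in>?K \<times> ?L. \<bar>Poly_Mapping.lookup (tensor_vec w v) p\<bar>)"
    by (rule norm_poly_mapping_eq_sum) (auto simp: in_keys_iff)
  also have "\<dots> = (\<Sum>i\<in>?K. \<Sum>j\<in>?L. \<bar>Poly_Mapping.lookup w i\<bar> * \<bar>Poly_Mapping.lookup v j\<bar>)"
    unfolding sum.cartesian_product by (intro sum.cong) (auto simp: abs_mult)
  also have "\<dots> = norm w * norm v"
    by (subst (1 2) norm_poly_mapping_eq_sum[OF finite_keys subset_refl]) (simp add: sum_product)
  finally show ?thesis .
qed

lemma bounded_bilinear_tensor_vec: "bounded_bilinear tensor_vec"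
  by unfold_locales
    (simp_all add: linear_add[OF linear_tensor_vec_left] linear_scale[OF linear_tensor_vec_left]
      linear_add[OF linear_tensor_vec_right] linear_scale[OF linear_tensor_vec_right]
      norm_tensor_vec exI[of _ 1])

lemmas continuous_on_tensor_vec [continuous_intros] =
  bounded_bilinear.continuous_on[OF bounded_bilinear_tensor_vec]

subsection \<open>Finite-dimensional subspaces\<close>

text \<open>The finiteness clause of \<open>orthogonal_rep\<close>; it already contains being a
  subspace.\<close>

definition fin_dim :: "'a::real_vector set \<Rightarrow> bool"
  where "fin_dim S \<longleftrightarrow> (\<exists>B. finite B \<and> span B = S)"

lemma fin_dim_subspace: "fin_dim S \<Longrightarrow> subspace S"
  by (auto simp: fin_dim_def)

text \<open>Only coordinates that occur in a finite spanning set can occur at all. Through this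
  finite index set the analysis on \<open>S\<close> is reduced to finitely many coordinates.\<close>

lemma finite_keys_fin_dim:
  fixes S :: "('i \<Rightarrow>\<^sub>0 real) set"
  assumes "fin_dim S"
  shows "finite (\<Union>x\<in>S. Poly_Mapping.keys x)"
proof -
  obtain B where B: "finite B" "span B = S"
    using assms by (auto simp: fin_dim_def)
  let ?K = "\<Union>b\<in>B. Poly_Mapping.keys b"
  have "subspace {x :: 'i \<Rightarrow>\<^sub>0 real. Poly_Mapping.keys x \<subseteq> ?K}"
  proof (rule subspaceI)
    fix x y :: "'i \<Rightarrow>\<^sub>0 real" and c
    assume xy: "x \<in> {x. Poly_Mapping.keys x \<subseteq> ?K}" "y \<in> {x. Poly_Mapping.keys x \<subseteq> ?K}"
    then show "x + y \<in> {x. Poly_Mapping.keys x \<subseteq> ?K}"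
      using keys_add[of x y] by blast
    have "Poly_Mapping.keys (c *\<^sub>R x) \<subseteq> Poly_Mapping.keys x"
      by (auto simp: in_keys_iff)
    with xy show "c *\<^sub>R x \<in> {x. Poly_Mapping.keys x \<subseteq> ?K}"
      by blast
  qed simp
  then have "span B \<subseteq> {x. Poly_Mapping.keys x \<subseteq> ?K}"
    by (intro span_minimal) auto
  then have "(\<Union>x\<in>S. Poly_Mapping.keys x) \<subseteq> ?K"
    using B by blast
  then show ?thesis
    using B by (elim finite_subset) auto
qed

text \<open>A linear map on the ambient space need not be bounded. Rewritten as a sum over the
  finitely many coordinates that occur in \<open>S\<close>, it becomes bounded and keeps its values
  on \<open>S\<close>.\<close>

lemma bounded_linear_extension:
  fixes S :: "('i \<Rightarrow>\<^sub>0 real) set" and F :: "('i \<Rightarrow>\<^sub>0 real) \<Rightarrow> 'b::real_normed_vector"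
  assumes "fin_dim S" "linear F"
  obtains g where "bounded_linear g" "\<And>x. g x \<in> span (range F)" "\<And>x. x \<in> S \<Longrightarrow> g x = F x"
proof
  let ?K = "\<Union>x\<in>S. Poly_Mapping.keys x"
  let ?g = "\<lambda>x. \<Sum>i\<in>?K. Poly_Mapping.lookup x i *\<^sub>R F (Poly_Mapping.single i 1)"
  show "bounded_linear ?g"
    by (intro bounded_linear_sum bounded_linear_compose[OF bounded_linear_scaleR_left bounded_linear_lookup])
  show "?g x \<in> span (range F)" for x
    by (intro span_sum span_scale span_base rangeI)
  show "?g x = F x" if "x \<in> S" for x
  proof -
    have "x = (\<Sum>i\<in>?K. Poly_Mapping.lookup x i *\<^sub>R Poly_Mapping.single i 1)"
      using that by (intro poly_mapping_sum_single_superset finite_keys_fin_dim assms) auto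
    then have "F x = F (\<Sum>i\<in>?K. Poly_Mapping.lookup x i *\<^sub>R Poly_Mapping.single i 1)"
      by simp
    then show ?thesis
      using assms(2) by (simp add: linear_sum linear_scale)
  qed
qed

text \<open>Linear algebra gives some linear retraction onto \<open>S\<close>; its bounded
  replacement agrees with it on \<open>S\<close> and still takes values in \<open>S\<close>.\<close>

lemma ex_bounded_projection:
  fixes S :: "('i \<Rightarrow>\<^sub>0 real) set"
  assumes "fin_dim S"
  shows "\<exists>p. bounded_linear p \<and> range p \<subseteq> S \<and> (\<forall>x\<in>S. p x = x)"
proof -
  obtain B where B: "B \<subseteq> S" "independent B" "S \<subseteq> span B"
    using maximal_independent_subset by blast
  then have span: "span B = S"
    using fin_dim_subspace[OF assms] by (metis span_minimal subset_antisym)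
  obtain g where g: "linear g" "\<forall>x\<in>B. g x = x" "range g = span B"
    using linear_independent_extend_subspace[OF B(2), of "\<lambda>x. x"] by auto
  have "g x = x" if "x \<in> S" for x
    using linear_eq_on_span[OF g(1) linear_id, of B x] g(2) that span by auto
  moreover obtain p where p: "bounded_linear p" "\<And>x. p x \<in> span (range g)" "\<And>x. x \<in> S \<Longrightarrow> p x = g x"
    using bounded_linear_extension[OF assms g(1)] by blast
  moreover have "span (range g) = S"
    using g(3) span by (metis span_span)
  ultimately show ?thesis
    by (intro exI[of _ p]) auto
qed

text \<open>An arbitrary choice of a bounded retraction, with no relation to the inner product of a
  representation.\<close>

definition projection :: "('i \<Rightarrow>\<^sub>0 real) set \<Rightarrow> ('i \<Rightarrow>\<^sub>0 real) \<Rightarrow> ('i \<Rightarrow>\<^sub>0 real)"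
  where "projection S = (SOME p. bounded_linear p \<and> range p \<subseteq> S \<and> (\<forall>x\<in>S. p x = x))"

lemma
  assumes "fin_dim S"
  shows bounded_linear_projection: "bounded_linear (projection S)"
    and projection_in: "projection S x \<in> S"
    and projection_eq: "x \<in> S \<Longrightarrow> projection S x = x"
  using someI_ex[OF ex_bounded_projection[OF assms]] unfolding projection_def[symmetric] by auto

text \<open>\<open>S\<close> is the fixed point set of a continuous retraction.\<close>

lemma closed_fin_dim:
  assumes "fin_dim S"
  shows "closed (S :: ('i \<Rightarrow>\<^sub>0 real) set)"
proof -
  have "S = {x. projection S x = x}"
    using projection_in[OF assms] projection_eq[OF assms] by (auto, metis)
  moreover have "continuous_on UNIV (projection S)"
    using bounded_linear_projection[OF assms] by (simp add: linear_continuous_on)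
  ultimately show ?thesis
    using closed_Collect_eq[of "projection S" "\<lambda>x. x"] by simp
qed

text \<open>Heine-Borel for \<open>S\<close>: the coordinates of the vectors in question lie in a
  compact cube, the cube has compact image under the linear combination map, and a closed subset of
  that image is compact.\<close>

lemma compact_fin_dim_cball:
  assumes "fin_dim S"
  shows "compact (S \<inter> cball (0 :: 'i \<Rightarrow>\<^sub>0 real) r)"
proof -
  let ?K = "\<Union>x\<in>S. Poly_Mapping.keys x"
  \<comment> \<open>Off the relevant coordinates the factor is {0}, so the cube is a product of
    compact sets over the whole index type.\<close>
  let ?C = "PiE UNIV (\<lambda>i. if i \<in> ?K then {-r..r} else {0::real})"
  let ?g = "\<lambda>c. \<Sum>i\<in>?K. c i *\<^sub>R Poly_Mapping.single i (1::real)"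
  have "compactin (product_topology (\<lambda>i. euclidean) UNIV) ?C"
    by (auto simp: compactin_PiE)
  then have "compact ?C"
    by (simp add: euclidean_product_topology compactin_euclidean_iff)
  moreover have "continuous_on ?C ?g"
    by (intro continuous_intros continuous_on_product_coordinates[THEN continuous_on_subset]) auto
  ultimately have "compact (?g ` ?C)"
    by (rule compact_continuous_image[rotated])
  moreover have "S \<inter> cball 0 r \<subseteq> ?g ` ?C"
  proof
    fix x
    assume x: "x \<in> S \<inter> cball 0 r"
    then have "x = ?g (Poly_Mapping.lookup x)"
      by (intro poly_mapping_sum_single_superset finite_keys_fin_dim assms) auto
    moreover have "Poly_Mapping.lookup x i \<in> {-r..r}" for i
      using abs_lookup_le_norm[of x i] x by auto
    then have "Poly_Mapping.lookup x \<in> ?C"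
      using x by (auto simp: in_keys_iff)
    ultimately show "x \<in> ?g ` ?C"
      by blast
  qed
  moreover have "closed (S \<inter> cball 0 r)"
    using closed_fin_dim[OF assms] by (intro closed_Int) auto
  ultimately show ?thesis
    using compact_Int_closed[of "?g ` ?C" "S \<inter> cball 0 r"] by (simp add: inf_absorb2)
qed

subsection \<open>Tensors\<close>

lemma tensor_vec_in_tensor_space: "w \<in> W \<Longrightarrow> v \<in> V \<Longrightarrow> tensor_vec w v \<in> tensor_space W V"
  unfolding tensor_space_def by (auto intro: span_base)

lemma subspace_tensor_space: "subspace (tensor_space W V)"
  by (simp add: tensor_space_def)

text \<open>Span induction for tensors. In this form and the two that follow, claims about all
  tensors are reduced to elementary ones.\<close>

lemma tensor_space_subset:
  assumes "x \<in> tensor_space W V" "subspace S" "\<And>w v. w \<in> W \<Longrightarrow> v \<in> V \<Longrightarrow> tensor_vec w v \<in> S"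
  shows "x \<in> S"
proof -
  have "tensor_space W V \<subseteq> S"
    unfolding tensor_space_def using assms(2,3) by (intro span_minimal) auto
  then show ?thesis
    using assms(1) by blast
qed

lemma linear_tensor_space_image:
  assumes "x \<in> tensor_space W V" "linear f" "subspace S" "\<And>w v. w \<in> W \<Longrightarrow> v \<in> V \<Longrightarrow> f (tensor_vec w v) \<in> S"
  shows "f x \<in> S"
  using tensor_space_subset[OF assms(1) linear_subspace_vimage[OF assms(2,3)]] assms(4) by auto

lemma linear_eq_on_tensor_space:
  assumes "x \<in> tensor_space W V" "linear f" "linear g"
    and "\<And>w v. w \<in> W \<Longrightarrow> v \<in> V \<Longrightarrow> f (tensor_vec w v) = g (tensor_vec w v)"
  shows "f x = g x"
  using assms unfolding tensor_space_def by (elim linear_eq_on_span[rotated 3]) auto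

lemma fin_dim_tensor_space:
  assumes "fin_dim W" "fin_dim V"
  shows "fin_dim (tensor_space W V)"
proof -
  obtain B D where BD: "finite B" "span B = W" "finite D" "span D = V"
    using assms by (auto simp: fin_dim_def)
  let ?E = "(\<lambda>(b, d). tensor_vec b d) ` (B \<times> D)"
  \<comment> \<open>Bilinearity is used in one variable at a time; here the right factor is still a
    spanning vector.\<close>
  have *: "tensor_vec w d \<in> span ?E" if "w \<in> W" "d \<in> D" for w d
  proof -
    have "W \<subseteq> {w. tensor_vec w d \<in> span ?E}"
      using that BD linear_subspace_vimage[OF linear_tensor_vec_left, of "span ?E" d]
      by (subst BD(2)[symmetric], intro span_minimal) (auto simp: vimage_def intro!: span_base)
    then show ?thesis
      using that by auto
  qed
  have "tensor_vec w v \<in> span ?E" if "w \<in> W" "v \<in> V" for w v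
  proof -
    have "V \<subseteq> {v. tensor_vec w v \<in> span ?E}"
      using * that
        linear_subspace_vimage[OF linear_tensor_vec_right, of "span ?E" w]
      by (subst BD(4)[symmetric], intro span_minimal) (auto simp: vimage_def)
    then show ?thesis
      using that by auto
  qed
  then have "tensor_space W V \<subseteq> span ?E"
    by (auto intro: tensor_space_subset)
  moreover have "span ?E \<subseteq> tensor_space W V"
    using BD by (intro span_minimal subspace_tensor_space) (auto intro!: tensor_vec_in_tensor_space span_base)
  ultimately show ?thesis
    unfolding fin_dim_def using BD by (intro exI[of _ ?E]) auto
qed

section \<open>Coordinate slices, and tensors over a sum with a line\<close>

definition slice :: "'j \<Rightarrow> ('k \<times> 'j \<Rightarrow>\<^sub>0 real) \<Rightarrow> ('k \<Rightarrow>\<^sub>0 real)"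
  where "slice j = Poly_Mapping.map_key (\<lambda>k. (k, j))"

lemma lookup_slice [simp]: "Poly_Mapping.lookup (slice j x) k = Poly_Mapping.lookup x (k, j)"
  by (simp add: slice_def map_key.rep_eq inj_def)

lemma bounded_linear_slice: "bounded_linear (slice j)"
  unfolding slice_def by (rule bounded_linear_map_key) (simp add: inj_def)

lemma slice_tensor_vec: "slice j (tensor_vec w v) = Poly_Mapping.lookup v j *\<^sub>R w"
  by (rule poly_mapping_eqI) simp

text \<open>\<open>slice j\<close> is the identity tensored with the j-th coordinate functional. For
  the index type of the line, \<open>slice ()\<close> is the identification of W \<otimes> \<real>
  with W.\<close>

lemma slice_in:
  assumes "x \<in> tensor_space W V" "subspace W"
  shows "slice j x \<in> W"
  using assms(1) bounded_linear.linear[OF bounded_linear_slice] assms(2)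
  by (rule linear_tensor_space_image) (simp add: slice_tensor_vec subspace_scale assms(2))

lift_definition tensor_inl :: "('k \<times> 'j \<Rightarrow>\<^sub>0 real) \<Rightarrow> (('k + 'a) \<times> 'j \<Rightarrow>\<^sub>0 real)"
  is "\<lambda>y (q, j). case q of Inl k \<Rightarrow> y (k, j) | Inr _ \<Rightarrow> 0"
proof -
  fix y :: "'k \<times> 'j \<Rightarrow> real"
  assume "finite {p. y p \<noteq> 0}"
  then show "finite {p. (case p of (q :: 'k + 'a, j) \<Rightarrow> case q of Inl k \<Rightarrow> y (k, j) | Inr _ \<Rightarrow> 0) \<noteq> 0}"
    by (elim finite_subset[rotated, OF finite_imageI[of _ "map_prod Inl id"]])
      (auto simp: image_iff split: sum.splits)
qed

lemma lookup_tensor_inl [simp]: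
  "Poly_Mapping.lookup (tensor_inl y) (Inl k, j) = Poly_Mapping.lookup y (k, j)"
  "Poly_Mapping.lookup (tensor_inl y) (Inr a, j) = 0"
  by (simp_all add: tensor_inl.rep_eq)

lemma lookup_dsum_vec [simp]:
  "Poly_Mapping.lookup (dsum_vec u v) (Inl i) = Poly_Mapping.lookup u i"
  "Poly_Mapping.lookup (dsum_vec u v) (Inr j) = Poly_Mapping.lookup v j"
  by (simp_all add: dsum_vec.rep_eq)

lemma tensor_sum_eqI:
  fixes a b :: "('k + 'a) \<times> 'j \<Rightarrow>\<^sub>0 real"
  assumes "\<And>k j. Poly_Mapping.lookup a (Inl k, j) = Poly_Mapping.lookup b (Inl k, j)"
    and "\<And>k j. Poly_Mapping.lookup a (Inr k, j) = Poly_Mapping.lookup b (Inr k, j)"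
  shows "a = b"
  using assms by (intro poly_mapping_eqI) (metis old.sum.exhaust surj_pair)

text \<open>Extension by zero only relabels the support, so the l1 norm is preserved.\<close>

lemma bounded_linear_tensor_inl: "bounded_linear (tensor_inl :: ('k \<times> 'j \<Rightarrow>\<^sub>0 real) \<Rightarrow> (('k + 'a) \<times> 'j \<Rightarrow>\<^sub>0 real))"
proof (rule bounded_linear_intro[where K = 1])
  fix x y :: "'k \<times> 'j \<Rightarrow>\<^sub>0 real" and c
  let ?J = "tensor_inl :: _ \<Rightarrow> (('k + 'a) \<times> 'j \<Rightarrow>\<^sub>0 real)"
  show "?J (x + y) = ?J x + ?J y" "?J (c *\<^sub>R x) = c *\<^sub>R ?J x"
    by (rule tensor_sum_eqI; simp add: lookup_add)+
  let ?K = "Poly_Mapping.keys x"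
  have "norm (?J x) = (\<Sum>p\<in>map_prod Inl id ` ?K. \<bar>Poly_Mapping.lookup (?J x) p\<bar>)"
  proof (rule norm_poly_mapping_eq_sum)
    show "Poly_Mapping.keys (?J x) \<subseteq> map_prod Inl id ` ?K"
    proof
      fix p
      assume "p \<in> Poly_Mapping.keys (?J x)"
      moreover obtain q j where p: "p = (q, j)"
        by fastforce
      ultimately obtain k where "q = Inl k" "(k, j) \<in> ?K"
        by (cases q) (auto simp: in_keys_iff)
      then show "p \<in> map_prod Inl id ` ?K"
        by (auto simp: p intro: image_eqI[of _ _ "(k, j)"])
    qed
  qed simp
  also have "\<dots> = (\<Sum>p\<in>?K. \<bar>Poly_Mapping.lookup x p\<bar>)"
    by (subst sum.reindex) (auto simp: inj_on_def intro!: sum.cong)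
  also have "\<dots> = norm x"
    by (rule norm_poly_mapping_eq_sum[symmetric]) auto
  finally show "norm (?J x) \<le> norm x * 1"
    by simp
qed

text \<open>The line is identified with the reals through its basis vector, so a bare vector v
  stands for 1 \<otimes> v.\<close>

definition tensor_inr :: "('j \<Rightarrow>\<^sub>0 real) \<Rightarrow> (('k + unit) \<times> 'j \<Rightarrow>\<^sub>0 real)"
  where "tensor_inr v = tensor_vec (dsum_vec 0 (Poly_Mapping.single () 1)) v"

definition tensor_outl :: "(('k + unit) \<times> 'j \<Rightarrow>\<^sub>0 real) \<Rightarrow> ('k \<times> 'j \<Rightarrow>\<^sub>0 real)"
  where "tensor_outl = Poly_Mapping.map_key (map_prod Inl id)"

definition tensor_outr :: "(('k + unit) \<times> 'j \<Rightarrow>\<^sub>0 real) \<Rightarrow> ('j \<Rightarrow>\<^sub>0 real)"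
  where "tensor_outr = Poly_Mapping.map_key (\<lambda>j. (Inr (), j))"

lemma lookup_tensor_outl [simp]: "Poly_Mapping.lookup (tensor_outl z) (k, j) = Poly_Mapping.lookup z (Inl k, j)"
  by (simp add: tensor_outl_def map_key.rep_eq inj_def)

lemma lookup_tensor_outr [simp]: "Poly_Mapping.lookup (tensor_outr z) j = Poly_Mapping.lookup z (Inr (), j)"
  by (simp add: tensor_outr_def map_key.rep_eq inj_def)

lemma bounded_linear_tensor_inr: "bounded_linear tensor_inr"
  unfolding tensor_inr_def by (rule bounded_bilinear.bounded_linear_right[OF bounded_bilinear_tensor_vec])

lemma bounded_linear_tensor_outl: "bounded_linear tensor_outl"
  unfolding tensor_outl_def by (rule bounded_linear_map_key) (simp add: inj_def)

lemma bounded_linear_tensor_outr: "bounded_linear tensor_outr"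
  unfolding tensor_outr_def by (rule bounded_linear_map_key) (simp add: inj_def)

lemma tensor_in_out: "tensor_inl (tensor_outl z) + tensor_inr (tensor_outr z) = z"
  by (rule tensor_sum_eqI) (simp_all add: tensor_inr_def lookup_add)

lemma tensor_outl_in [simp]: "tensor_outl (tensor_inl y + tensor_inr v) = y"
  by (rule poly_mapping_eqI) (clarsimp simp: tensor_inr_def lookup_add)

lemma tensor_outr_in [simp]: "tensor_outr (tensor_inl y + tensor_inr v) = v"
  by (rule poly_mapping_eqI) (simp add: tensor_inr_def lookup_add)

lemma tensor_inl_tensor_vec: "tensor_inl (tensor_vec w v) = tensor_vec (dsum_vec w 0) v"
  by (rule tensor_sum_eqI) simp_all

lemma tensor_outl_tensor_vec: "tensor_outl (tensor_vec (dsum_vec w a) v) = tensor_vec w v"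
  by (rule poly_mapping_eqI) clarsimp

lemma tensor_outr_tensor_vec: "tensor_outr (tensor_vec (dsum_vec w a) v) = Poly_Mapping.lookup a () *\<^sub>R v"
  by (rule poly_mapping_eqI) simp

section \<open>Orthogonal representations and the bundle of tensors\<close>

lemma bounded_bilinear_sum:
  assumes "\<And>i. i \<in> I \<Longrightarrow> bounded_bilinear (f i)"
  shows "bounded_bilinear (\<lambda>x y. \<Sum>i\<in>I. f i x y)"
proof
  show "(\<Sum>i\<in>I. f i (a + a') b) = (\<Sum>i\<in>I. f i a b) + (\<Sum>i\<in>I. f i a' b)"
    and "(\<Sum>i\<in>I. f i a (b + b')) = (\<Sum>i\<in>I. f i a b) + (\<Sum>i\<in>I. f i a b')"
    and "(\<Sum>i\<in>I. f i (r *\<^sub>R a) b) = r *\<^sub>R (\<Sum>i\<in>I. f i a b)"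
    and "(\<Sum>i\<in>I. f i a (r *\<^sub>R b)) = r *\<^sub>R (\<Sum>i\<in>I. f i a b)" for a a' b b' r
    using assms
    by (simp_all add: bounded_bilinear.add_left bounded_bilinear.add_right
        bounded_bilinear.scaleR_left bounded_bilinear.scaleR_right sum.distrib scaleR_sum_right)
  have "\<forall>i\<in>I. \<exists>K. \<forall>a b. norm (f i a b) \<le> norm a * norm b * K"
    using assms bounded_bilinear.bounded by blast
  then obtain K where K: "\<And>i a b. i \<in> I \<Longrightarrow> norm (f i a b) \<le> norm a * norm b * K i"
    by metis
  have "norm (\<Sum>i\<in>I. f i a b) \<le> norm a * norm b * (\<Sum>i\<in>I. K i)" for a b
    unfolding sum_distrib_left using K by (rule sum_norm_le)
  then show "\<exists>K. \<forall>a b. norm (\<Sum>i\<in>I. f i a b) \<le> norm a * norm b * K"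
    by blast
qed

lemma orthogonal_rep_fin_dim: "orthogonal_rep V \<Longrightarrow> fin_dim (rcarrier V)"
  by (simp add: orthogonal_rep_def fin_dim_def)

lemma orthogonal_rep_subspace: "orthogonal_rep V \<Longrightarrow> subspace (rcarrier V)"
  by (simp add: orthogonal_rep_def)

lemma rinner_add_left:
  "\<lbrakk>orthogonal_rep V; x \<in> rcarrier V; y \<in> rcarrier V; z \<in> rcarrier V\<rbrakk> \<Longrightarrow>
    rinner V (x + y) z = rinner V x z + rinner V y z"
  and rinner_scale_left:
  "\<lbrakk>orthogonal_rep V; x \<in> rcarrier V; z \<in> rcarrier V\<rbrakk> \<Longrightarrow>
    rinner V (c *\<^sub>R x) z = c * rinner V x z"
  and rinner_commute:
  "\<lbrakk>orthogonal_rep V; x \<in> rcarrier V; z \<in> rcarrier V\<rbrakk> \<Longrightarrow> rinner V x z = rinner V z x"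
  and rinner_pos:
  "\<lbrakk>orthogonal_rep V; x \<in> rcarrier V; x \<noteq> 0\<rbrakk> \<Longrightarrow> rinner V x x > 0"
  by (simp_all add: orthogonal_rep_def inner_product_on_def linear_on_subspace_def)

lemma rinner_add_right:
  "\<lbrakk>orthogonal_rep V; x \<in> rcarrier V; y \<in> rcarrier V; z \<in> rcarrier V\<rbrakk> \<Longrightarrow>
    rinner V z (x + y) = rinner V z x + rinner V z y"
  by (metis orthogonal_rep_subspace rinner_add_left rinner_commute subspace_add)

lemma rinner_scale_right:
  "\<lbrakk>orthogonal_rep V; x \<in> rcarrier V; z \<in> rcarrier V\<rbrakk> \<Longrightarrow>
    rinner V z (c *\<^sub>R x) = c * rinner V z x"
  by (metis orthogonal_rep_subspace rinner_commute rinner_scale_left subspace_scale)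

lemma rinner_nonneg:
  "\<lbrakk>orthogonal_rep V; x \<in> rcarrier V\<rbrakk> \<Longrightarrow> rinner V x x \<ge> 0"
  using inner_product_on_nonneg by (auto simp: orthogonal_rep_def)

text \<open>
  The inner product is only meaningful on the carrier. Precomposing it with a bounded
  projection yields a bounded bilinear form on the whole ambient space.
\<close>

definition ginner :: "'j rep \<Rightarrow> ('j \<Rightarrow>\<^sub>0 real) \<Rightarrow> ('j \<Rightarrow>\<^sub>0 real) \<Rightarrow> real"
  where "ginner V x y = rinner V (projection (rcarrier V) x) (projection (rcarrier V) y)"

lemma ginner_eq: "\<lbrakk>orthogonal_rep V; x \<in> rcarrier V; y \<in> rcarrier V\<rbrakk> \<Longrightarrow> ginner V x y = rinner V x y"
  by (simp add: ginner_def projection_eq orthogonal_rep_fin_dim)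

text \<open>An abstract inner product carries no continuity of its own. Expanded in the finitely
  many coordinates of the carrier, it is a finite sum of constants times products of bounded
  coordinate functionals.\<close>

lemma bounded_bilinear_ginner:
  assumes "orthogonal_rep V"
  shows "bounded_bilinear (ginner V)"
proof -
  let ?K = "\<Union>x\<in>rcarrier V. Poly_Mapping.keys x" and ?p = "projection (rcarrier V)"
  let ?e = "\<lambda>i. Poly_Mapping.single i (1::real)"
  note fd = orthogonal_rep_fin_dim[OF assms]
  note p = bounded_linear_projection[OF fd] projection_in[OF fd] projection_eq[OF fd]
  have coord: "bounded_linear (\<lambda>x. Poly_Mapping.lookup (?p x) i)" for i
    using bounded_linear_compose[OF bounded_linear_lookup p(1)] .
  have add: "ginner V (x + y) z = ginner V x z + ginner V y z"
    and scale: "ginner V (c *\<^sub>R x) z = c * ginner V x z"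
    and add': "ginner V z (x + y) = ginner V z x + ginner V z y"
    and scale': "ginner V z (c *\<^sub>R x) = c * ginner V z x" for x y z c
    using p(1,2) assms by (simp_all add: ginner_def rinner_add_left rinner_scale_left rinner_add_right
        rinner_scale_right linear_add linear_scale bounded_linear.linear)
  have lin: "linear (\<lambda>x. ginner V x z)" "linear (ginner V z)" for z
    by (rule linearI; simp add: add scale add' scale')+
  have expand: "?p x = (\<Sum>i\<in>?K. Poly_Mapping.lookup (?p x) i *\<^sub>R ?e i)" for x
    using p(2)[of x] by (intro poly_mapping_sum_single_superset finite_keys_fin_dim fd) auto
  \<comment> \<open>Projected vectors have their support in \<open>?K\<close>. The basis vectors
    used to expand them need not lie in the carrier; \<open>ginner\<close> is defined for them all
    the same.\<close>
  have "ginner V x y = ginner V (?p x) (?p y)" for x y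
    using p by (simp add: ginner_def)
  also have "\<dots> x y = (\<Sum>j\<in>?K. \<Sum>i\<in>?K. Poly_Mapping.lookup (?p x) i *\<^sub>R (Poly_Mapping.lookup (?p y) j * ginner V (?e i) (?e j)))" for x y
    by (subst expand[of x], subst expand[of y])
      (simp add: linear_sum[OF lin(1)] linear_sum[OF lin(2)] linear_scale[OF lin(1)] linear_scale[OF lin(2)]
        sum_distrib_left mult.left_commute)
  finally have eq: "ginner V = (\<lambda>x y. \<Sum>j\<in>?K. \<Sum>i\<in>?K. Poly_Mapping.lookup (?p x) i *\<^sub>R (Poly_Mapping.lookup (?p y) j * ginner V (?e i) (?e j)))"
    by blast
  show ?thesis
    by (subst eq, intro bounded_bilinear_sum bounded_bilinear.comp[OF bounded_bilinear_scaleR]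
        bounded_linear_compose[OF bounded_linear_mult_left] coord)
qed

text \<open>Contraction of the second tensor factor with the functional \<open>\<langle>e, -\<rangle>\<close>.\<close>

definition contract :: "'j rep \<Rightarrow> ('j \<Rightarrow>\<^sub>0 real) \<Rightarrow> ('k \<times> 'j \<Rightarrow>\<^sub>0 real) \<Rightarrow> ('k \<Rightarrow>\<^sub>0 real)"
  where "contract V e y =
    (\<Sum>j\<in>(\<Union>v\<in>rcarrier V. Poly_Mapping.keys v). ginner V e (Poly_Mapping.single j 1) *\<^sub>R slice j y)"

lemma bounded_bilinear_contract:
  assumes "orthogonal_rep V"
  shows "bounded_bilinear (contract V)"
  unfolding contract_def
  by (intro bounded_bilinear_sum bounded_bilinear.comp[OF bounded_bilinear_scaleR]
      bounded_linear_slice bounded_bilinear.bounded_linear_left[OF bounded_bilinear_ginner] assms)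

text \<open>All coordinates of \<open>v\<close> occur in the defining sum, so pairing them with the
  basis vectors reassembles the pairing of \<open>e\<close> with \<open>v\<close>. This identifies
  the coordinate formula as the intended contraction.\<close>

lemma contract_tensor_vec:
  assumes "orthogonal_rep V" "v \<in> rcarrier V"
  shows "contract V e (tensor_vec w v) = ginner V e v *\<^sub>R w"
proof -
  let ?K = "\<Union>x\<in>rcarrier V. Poly_Mapping.keys x"
  have "contract V e (tensor_vec w v) =
      (\<Sum>j\<in>?K. Poly_Mapping.lookup v j * ginner V e (Poly_Mapping.single j 1)) *\<^sub>R w"
    by (simp add: contract_def slice_tensor_vec scaleR_sum_left mult.commute)
  also have "(\<Sum>j\<in>?K. Poly_Mapping.lookup v j * ginner V e (Poly_Mapping.single j 1)) =
      ginner V e (\<Sum>j\<in>?K. Poly_Mapping.lookup v j *\<^sub>R Poly_Mapping.single j 1)"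
    using bounded_bilinear_ginner[OF assms(1)]
    by (simp add: bounded_bilinear.sum_right bounded_bilinear.scaleR_right)
  also have "(\<Sum>j\<in>?K. Poly_Mapping.lookup v j *\<^sub>R Poly_Mapping.single j 1) = v"
    using assms by (intro poly_mapping_sum_single_superset[symmetric] finite_keys_fin_dim orthogonal_rep_fin_dim) auto
  finally show ?thesis .
qed

lemma linear_contract: "orthogonal_rep V \<Longrightarrow> linear (contract V e)"
  by (simp add: bounded_bilinear_contract bounded_bilinear.bounded_linear_right bounded_linear.linear)

lemma contract_in:
  assumes "orthogonal_rep V" "y \<in> tensor_space W X" "X \<subseteq> rcarrier V" "subspace W"
  shows "contract V e y \<in> W"
  using assms(2) linear_contract[OF assms(1)] assms(4)
  by (rule linear_tensor_space_image) (use assms in \<open>auto simp: contract_tensor_vec subspace_scale\<close>)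

section \<open>Orthonormal bases and orthogonal complements\<close>

definition orthonormal :: "'j rep \<Rightarrow> ('j \<Rightarrow>\<^sub>0 real) set \<Rightarrow> bool"
  where "orthonormal V E \<longleftrightarrow> finite E \<and> E \<subseteq> rcarrier V \<and>
    (\<forall>e\<in>E. \<forall>e'\<in>E. rinner V e e' = (if e = e' then 1 else 0))"

lemma linear_ginner: "orthogonal_rep V \<Longrightarrow> linear (ginner V z)" "orthogonal_rep V \<Longrightarrow> linear (\<lambda>x. ginner V x z)"
  by (simp_all add: bounded_bilinear_ginner bounded_bilinear.bounded_linear_left
      bounded_bilinear.bounded_linear_right bounded_linear.linear)

text \<open>The Gram-Schmidt residue: orthogonality to each member of \<open>E\<close> is a
  computation, and linearity extends it to the span.\<close>

lemma orthonormal_residue: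
  assumes "orthogonal_rep V" "orthonormal V E" "v \<in> rcarrier V"
  shows "v - (\<Sum>e\<in>E. ginner V e v *\<^sub>R e) \<in> orth_complement V (span E)"
proof -
  let ?r = "v - (\<Sum>e\<in>E. ginner V e v *\<^sub>R e)"
  note sub = orthogonal_rep_subspace[OF assms(1)]
  note E = assms(2)[unfolded orthonormal_def]
  have r: "?r \<in> rcarrier V"
    using E assms(3) sub by (intro subspace_diff subspace_sum subspace_scale) auto
  have "ginner V s ?r = 0" if "s \<in> span E" for s
  proof -
    have "ginner V e' ?r = 0" if "e' \<in> E" for e'
    proof -
      have "ginner V e' ?r = ginner V e' v - (\<Sum>e\<in>E. ginner V e v * ginner V e' e)"
        using linear_ginner(1)[OF assms(1)] by (simp add: linear_diff linear_sum linear_scale)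
      also have "(\<Sum>e\<in>E. ginner V e v * ginner V e' e) = (\<Sum>e\<in>E. if e = e' then ginner V e v else 0)"
        using E that by (intro sum.cong refl) (auto simp: ginner_eq[OF assms(1)] subset_iff)
      also have "\<dots> = ginner V e' v"
        using E that by simp
      finally show ?thesis
        by simp
    qed
    then show ?thesis
      using linear_eq_on_span[OF linear_ginner(2)[OF assms(1)] linear_zero, of E ?r s] that by auto
  qed
  moreover have "span E \<subseteq> rcarrier V"
    using E sub by (intro span_minimal) auto
  ultimately show ?thesis
    using r assms(1) unfolding orth_complement_def by (auto simp: ginner_eq rinner_commute subset_iff)
qed

text \<open>The residue lies in the span as well as in its complement, so positive definiteness
  forces it to vanish.\<close>

lemma orthonormal_expansion:
  assumes "orthogonal_rep V" "orthonormal V E" "v \<in> span E"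
  shows "v = (\<Sum>e\<in>E. ginner V e v *\<^sub>R e)"
proof (rule ccontr)
  let ?r = "v - (\<Sum>e\<in>E. ginner V e v *\<^sub>R e)"
  assume "v \<noteq> (\<Sum>e\<in>E. ginner V e v *\<^sub>R e)"
  then have "?r \<noteq> 0"
    by simp
  have "span E \<subseteq> rcarrier V"
    using assms(2) orthogonal_rep_subspace[OF assms(1)] by (intro span_minimal) (auto simp: orthonormal_def)
  then have "?r \<in> orth_complement V (span E)"
    using assms orthonormal_residue by blast
  moreover have "?r \<in> span E"
    using assms(3) by (intro span_diff span_sum span_scale) (auto intro: span_base)
  ultimately show False
    using rinner_pos[OF assms(1) _ \<open>?r \<noteq> 0\<close>] by (auto simp: orth_complement_def)
qed

text \<open>Gram-Schmidt, one generator at a time: a generator with zero residue is dropped, any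
  other contributes its normalised residue.\<close>

lemma ex_orthonormal_basis:
  assumes "orthogonal_rep V" "finite B" "B \<subseteq> rcarrier V"
  shows "\<exists>E. orthonormal V E \<and> span E = span B"
  using assms(2,3)
proof (induction B rule: finite_induct)
  case empty
  then show ?case
    by (intro exI[of _ "{}"]) (simp add: orthonormal_def)
next
  case (insert b B)
  then obtain E where E: "orthonormal V E" "span E = span B"
    by auto
  let ?r = "b - (\<Sum>e\<in>E. ginner V e b *\<^sub>R e)"
  have sum: "(\<Sum>e\<in>E. ginner V e b *\<^sub>R e) \<in> span E"
    by (intro span_sum span_scale) (auto intro: span_base)
  have r: "?r \<in> orth_complement V (span E)"
    using orthonormal_residue[OF assms(1) E(1)] insert.prems by simp
  then have rV: "?r \<in> rcarrier V"
    by (simp add: orth_complement_def)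
  show ?case
  proof (cases "?r = 0")
    case True
    then have "b \<in> span B"
      using sum E(2) by simp
    then show ?thesis
      using E by (metis span_redundant)
  next
    case False
    define n where "n = sqrt (rinner V ?r ?r)"
    define a where "a = (1 / n) *\<^sub>R ?r"
    have n: "n > 0" "n * n = rinner V ?r ?r"
      using rinner_pos[OF assms(1) rV False] by (simp_all add: n_def)
    have aV: "a \<in> rcarrier V"
      using rV orthogonal_rep_subspace[OF assms(1)] by (simp add: a_def subspace_scale)
    have aa: "rinner V a a = 1"
      using n rV aV assms(1) by (simp add: a_def rinner_scale_left rinner_scale_right
          orthogonal_rep_subspace subspace_scale) (simp add: field_simps flip: n(2))
    have ae: "rinner V a e = 0" if "e \<in> E" for e
    proof -
      have "e \<in> rcarrier V"
        using that E(1) by (auto simp: orthonormal_def)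
      then show ?thesis
        using r that assms(1) rV by (simp add: a_def rinner_scale_left orth_complement_def span_base)
    qed
    have ea: "rinner V e a = 0" if "e \<in> E" for e
      using ae[OF that] rinner_commute[OF assms(1) aV, of e] that E(1) by (auto simp: orthonormal_def)
    have "a \<notin> E"
      using aa ae by fastforce
    then have "orthonormal V (insert a E)"
      using E(1) aV aa ae ea unfolding orthonormal_def by auto
    moreover have "span (insert a E) = span (insert b B)"
    proof (rule subset_antisym)
      have "?r \<in> span (insert b B)"
        using sum E(2) by (intro span_diff) (auto intro: span_base subsetD[OF span_mono, rotated])
      then have "a \<in> span (insert b B)"
        by (simp only: a_def span_scale)
      moreover have "E \<subseteq> span (insert b B)"
        using E(2) span_superset[of E] span_mono[of B "insert b B"] by blast
      ultimately show "span (insert a E) \<subseteq> span (insert b B)"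
        by (intro span_minimal) auto
      have "n *\<^sub>R a \<in> span (insert a E)"
        by (intro span_scale span_base) simp
      then have "?r \<in> span (insert a E)"
        using n(1) by (simp add: a_def)
      moreover have "(\<Sum>e\<in>E. ginner V e b *\<^sub>R e) \<in> span (insert a E)"
        using sum span_mono[of E "insert a E"] by blast
      ultimately have "?r + (\<Sum>e\<in>E. ginner V e b *\<^sub>R e) \<in> span (insert a E)"
        by (rule span_add)
      then have "b \<in> span (insert a E)"
        by simp
      moreover have "B \<subseteq> span (insert a E)"
        using E(2) span_superset[of B] span_mono[of E "insert a E"] by blast
      ultimately show "span (insert b B) \<subseteq> span (insert a E)"
        by (intro span_minimal) auto
    qed
    ultimately show ?thesis
      by blast
  qed
qed

lemma fin_dim_orthonormal_basis:
  assumes "orthogonal_rep V" "fin_dim S" "S \<subseteq> rcarrier V"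
  obtains E where "orthonormal V E" "span E = S"
proof -
  obtain B where "finite B" "span B = S"
    using assms(2) by (auto simp: fin_dim_def)
  moreover have "B \<subseteq> rcarrier V"
    using calculation assms(3) span_superset by blast
  ultimately show ?thesis
    using ex_orthonormal_basis[OF assms(1)] that by metis
qed

text \<open>The moving space becomes a family of linear equations inside a fixed one. For S = f(U)
  the equations depend continuously on f, which makes the bundle accessible to closedness and
  compactness arguments.\<close>

lemma tensor_space_orth_complement_iff:
  assumes V: "orthogonal_rep V" and S: "fin_dim S" "S \<subseteq> rcarrier V"
  shows "y \<in> tensor_space W (orth_complement V S) \<longleftrightarrow>
    y \<in> tensor_space W (rcarrier V) \<and> (\<forall>s\<in>S. contract V s y = 0)"
proof (intro iffI conjI ballI)
  assume y: "y \<in> tensor_space W (orth_complement V S)"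
  then show "y \<in> tensor_space W (rcarrier V)"
    by (rule tensor_space_subset[OF _ subspace_tensor_space])
      (auto simp: orth_complement_def intro: tensor_vec_in_tensor_space)
  show "contract V s y = 0" if "s \<in> S" for s
  proof (rule linear_eq_on_tensor_space[OF y linear_contract[OF V] linear_zero])
    show "contract V s (tensor_vec w v) = 0" if "v \<in> orth_complement V S" for w v
      using that \<open>s \<in> S\<close> S V
      by (auto simp: orth_complement_def contract_tensor_vec ginner_eq rinner_commute subset_iff)
  qed
next
  assume y: "y \<in> tensor_space W (rcarrier V) \<and> (\<forall>s\<in>S. contract V s y = 0)"
  obtain E where E: "orthonormal V E" "span E = S"
    using fin_dim_orthonormal_basis[OF V S] by blast
  \<comment> \<open>The identity tensored with the orthogonal projection onto the complement; it
    fixes \<open>y\<close> because all contractions of \<open>y\<close> vanish.\<close>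
  let ?f = "\<lambda>y. y - (\<Sum>e\<in>E. tensor_vec (contract V e y) e)"
  have "linear ?f"
    using linear_contract[OF V]
    by (intro linear_compose_sub linear_ident linear_compose_sum ballI
        linear_compose[OF _ linear_tensor_vec_left, unfolded comp_def])
  moreover have "?f (tensor_vec w v) \<in> tensor_space W (orth_complement V S)"
    if "w \<in> W" "v \<in> rcarrier V" for w v
  proof -
    have "?f (tensor_vec w v) = tensor_vec w (v - (\<Sum>e\<in>E. ginner V e v *\<^sub>R e))"
      using that V by (simp add: contract_tensor_vec linear_diff[OF linear_tensor_vec_right]
          linear_sum[OF linear_tensor_vec_right] linear_scale[OF linear_tensor_vec_right]
          linear_scale[OF linear_tensor_vec_left])
    then show ?thesis
      using orthonormal_residue[OF V E(1) that(2)] that(1) E(2) by (simp add: tensor_vec_in_tensor_space)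
  qed
  ultimately have "?f y \<in> tensor_space W (orth_complement V S)"
    using linear_tensor_space_image[OF conjunct1[OF y] _ subspace_tensor_space, of ?f] by blast
  moreover have "(\<Sum>e\<in>E. tensor_vec (contract V e y) e) = 0"
    using y E(2) by (intro sum.neutral ballI) (auto simp: span_base linear_0[OF linear_tensor_vec_left])
  ultimately show "y \<in> tensor_space W (orth_complement V S)"
    by simp
qed

text \<open>Norm and inner product are unrelated a priori, but an orthonormal basis controls both:
  each coordinate of \<open>v\<close> is at most the length of \<open>v\<close>.\<close>

lemma norm_le_sqrt_rinner:
  assumes "orthogonal_rep V"
  obtains M where "M > 0" "\<And>v. v \<in> rcarrier V \<Longrightarrow> norm v \<le> M * sqrt (rinner V v v)"
proof -
  obtain E where E: "orthonormal V E" "span E = rcarrier V"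
    using fin_dim_orthonormal_basis[OF assms orthogonal_rep_fin_dim[OF assms]] by blast
  then have finE: "finite E"
    by (simp add: orthonormal_def)
  show ?thesis
  proof
    \<comment> \<open>The added 1 keeps the constant positive when \<open>E\<close> is
      empty.\<close>
    show "(\<Sum>e\<in>E. norm e) + 1 > 0"
      by (simp add: add_nonneg_pos sum_nonneg)
    fix v
    assume v: "v \<in> rcarrier V"
    let ?c = "\<lambda>e. ginner V e v"
    have v_eq: "v = (\<Sum>e\<in>E. ?c e *\<^sub>R e)"
      using orthonormal_expansion[OF assms E(1)] v E(2) by simp
    have "rinner V v v = ginner V v (\<Sum>e\<in>E. ?c e *\<^sub>R e)"
      using v_eq v assms by (simp add: ginner_eq)
    also have "\<dots> = (\<Sum>e\<in>E. ?c e * ginner V v e)"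
      using linear_ginner(1)[OF assms] by (simp add: linear_sum linear_scale)
    also have "\<dots> = (\<Sum>e\<in>E. ?c e ^ 2)"
      using E v assms by (intro sum.cong refl) (auto simp: power2_eq_square ginner_eq rinner_commute orthonormal_def subset_iff)
    finally have inner: "rinner V v v = (\<Sum>e\<in>E. ?c e ^ 2)" .
    have "\<bar>?c e\<bar> \<le> sqrt (rinner V v v)" if "e \<in> E" for e
    proof -
      have "?c e ^ 2 \<le> rinner V v v"
        unfolding inner using that finE by (intro member_le_sum) auto
      then show ?thesis
        using real_le_rsqrt by (metis power2_abs)
    qed
    then have "norm (?c e *\<^sub>R e) \<le> norm e * sqrt (rinner V v v)" if "e \<in> E" for e
      using that by (simp add: mult.commute mult_left_mono)
    then have "norm (\<Sum>e\<in>E. ?c e *\<^sub>R e) \<le> (\<Sum>e\<in>E. norm e * sqrt (rinner V v v))"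
      by (rule sum_norm_le)
    also have "\<dots> \<le> ((\<Sum>e\<in>E. norm e) + 1) * sqrt (rinner V v v)"
      using rinner_nonneg[OF assms v] by (simp add: sum_distrib_right[symmetric] mult_right_mono)
    finally show "norm v \<le> ((\<Sum>e\<in>E. norm e) + 1) * sqrt (rinner V v v)"
      using v_eq by simp
  qed
qed

lemma closed_Collect_ball:
  assumes "\<And>i. i \<in> I \<Longrightarrow> closed {x. P i x}"
  shows "closed {x. \<forall>i\<in>I. P i x}"
proof -
  have "{x. \<forall>i\<in>I. P i x} = (\<Inter>i\<in>I. {x. P i x})"
    by auto
  then show ?thesis
    using assms by auto
qed

section \<open>Compactness of the isometries and local compactness of the bundle\<close>

lemma isometriesD:
  assumes "f \<in> isometries U V"
  shows "u \<in> rcarrier U \<Longrightarrow> f u \<in> rcarrier V"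
    and "u \<in> rcarrier U \<Longrightarrow> u' \<in> rcarrier U \<Longrightarrow> f (u + u') = f u + f u'"
    and "u \<in> rcarrier U \<Longrightarrow> f (c *\<^sub>R u) = c *\<^sub>R f u"
    and "u \<in> rcarrier U \<Longrightarrow> u' \<in> rcarrier U \<Longrightarrow> rinner V (f u) (f u') = rinner U u u'"
    and "linear_on_subspace (rcarrier U) f"
    and "f \<in> extensional (rcarrier U)"
  using assms by (auto simp: isometries_def linear_on_subspace_def PiE_iff)

text \<open>The value of an isometry is bounded in terms of the argument alone, so Tychonoff gives a
  compact product for pointwise convergence; linearity and preservation of the inner product are
  closed conditions there.\<close>

lemma compact_isometries:
  assumes U: "orthogonal_rep U" and V: "orthogonal_rep V"
  shows "compact (isometries U V)"
proof -
  obtain M where M: "\<And>v. v \<in> rcarrier V \<Longrightarrow> norm v \<le> M * sqrt (rinner V v v)"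
    using norm_le_sqrt_rinner[OF V] by blast
  \<comment> \<open>Outside the carrier the factor is the single value \<open>undefined\<close>,
    which builds in extensionality. The closed conditions in \<open>?D\<close> use
    \<open>ginner\<close> because it is continuous on the whole ambient space.\<close>
  let ?C = "PiE UNIV (\<lambda>u. if u \<in> rcarrier U then rcarrier V \<inter> cball 0 (M * sqrt (rinner U u u)) else {undefined})"
  let ?D = "{f. \<forall>u\<in>rcarrier U. \<forall>u'\<in>rcarrier U. f (u + u') = f u + f u'} \<inter>
    {f. \<forall>c. \<forall>u\<in>rcarrier U. f (c *\<^sub>R u) = c *\<^sub>R f u} \<inter>
    {f. \<forall>u\<in>rcarrier U. \<forall>u'\<in>rcarrier U. ginner V (f u) (f u') = rinner U u u'}"
  have "compactin (product_topology (\<lambda>i. euclidean) UNIV) ?C"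
    unfolding compactin_PiE using compact_fin_dim_cball[OF orthogonal_rep_fin_dim[OF V]]
    by (auto simp: Int_commute)
  then have "compact ?C"
    by (simp add: euclidean_product_topology compactin_euclidean_iff)
  moreover have "closed ?D"
    by (intro closed_Int closed_Collect_ball closed_Collect_all closed_Collect_eq continuous_intros
        continuous_on_product_coordinates bounded_bilinear.continuous_on[OF bounded_bilinear_ginner[OF V]])
  ultimately have "compact (?C \<inter> ?D)"
    by (rule compact_Int_closed)
  moreover have "isometries U V = ?C \<inter> ?D"
  proof (intro equalityI subsetI IntI)
    fix f
    assume f: "f \<in> isometries U V"
    note f' = isometriesD[OF f]
    show "f \<in> ?C"
      using f'(1,4,6) M by (auto simp: extensional_def) (metis f'(4))
    show "f \<in> {f. \<forall>u\<in>rcarrier U. \<forall>u'\<in>rcarrier U. f (u + u') = f u + f u'}"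
      "f \<in> {f. \<forall>c. \<forall>u\<in>rcarrier U. f (c *\<^sub>R u) = c *\<^sub>R f u}"
      using f' by auto
    show "f \<in> {f. \<forall>u\<in>rcarrier U. \<forall>u'\<in>rcarrier U. ginner V (f u) (f u') = rinner U u u'}"
      using f'(1,4) V by (simp add: ginner_eq)
  next
    fix f
    assume f: "f \<in> ?C \<inter> ?D"
    have c: "f u \<in> (if u \<in> rcarrier U then rcarrier V \<inter> cball 0 (M * sqrt (rinner U u u)) else {undefined})" for u
      using f by (simp add: PiE_iff)
    have fV: "f u \<in> rcarrier V" if "u \<in> rcarrier U" for u
      using c[of u] that by simp
    have fn: "f u = undefined" if "u \<notin> rcarrier U" for u
      using c[of u] that by simp
    have "ginner V (f u) (f u') = rinner V (f u) (f u')" if "u \<in> rcarrier U" "u' \<in> rcarrier U" for u u'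
      using fV that V by (simp add: ginner_eq)
    with f fV fn show "f \<in> isometries U V"
      unfolding isometries_def linear_on_subspace_def by (auto simp: PiE_iff extensional_def)
  qed
  ultimately show ?thesis
    by simp
qed

lemma fin_dim_isometry_image:
  assumes "orthogonal_rep U" "f \<in> isometries U V"
  shows "fin_dim (f ` rcarrier U)" "f ` rcarrier U \<subseteq> rcarrier V"
proof -
  obtain F where F: "linear F" "\<And>u. u \<in> rcarrier U \<Longrightarrow> F u = f u"
    using linear_on_subspace_extend[OF orthogonal_rep_subspace[OF assms(1)] isometriesD(5)[OF assms(2)]] by blast
  obtain B where B: "finite B" "span B = rcarrier U"
    using orthogonal_rep_fin_dim[OF assms(1)] by (auto simp: fin_dim_def)
  have "f ` rcarrier U = F ` span B"
    using F(2) B(2) by (auto simp: image_iff)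
  then have "f ` rcarrier U = span (F ` B)"
    by (simp add: linear_span_image[OF F(1)])
  then show "fin_dim (f ` rcarrier U)"
    using B(1) unfolding fin_dim_def by blast
  show "f ` rcarrier U \<subseteq> rcarrier V"
    using isometriesD(1)[OF assms(2)] by auto
qed

lemma C2gamma_iff:
  assumes "orthogonal_rep U" "orthogonal_rep V"
  shows "(f, x) \<in> C2gamma W U V \<longleftrightarrow> f \<in> isometries U V \<and>
    x \<in> tensor_space (rcarrier W) (rcarrier V) \<and> (\<forall>u\<in>rcarrier U. contract V (f u) x = 0)"
  using tensor_space_orth_complement_iff[OF assms(2) fin_dim_isometry_image[OF assms(1)]]
  by (auto simp: C2gamma_def)

text \<open>The disc bundle is a fixed compact set, isometries times a ball, cut out by contraction
  equations that are closed in the pair.\<close>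

lemma compact_C2gamma_norm_le:
  assumes "orthogonal_rep U" "orthogonal_rep V" "orthogonal_rep W"
  shows "compact {p \<in> C2gamma W U V. norm (snd p) \<le> r}"
proof -
  let ?T = "tensor_space (rcarrier W) (rcarrier V)"
  have "compact (isometries U V \<times> (?T \<inter> cball 0 r))"
    using assms by (intro compact_Times compact_isometries compact_fin_dim_cball fin_dim_tensor_space orthogonal_rep_fin_dim)
  moreover have "closed {p. \<forall>u\<in>rcarrier U. contract V (fst p u) (snd p) = (0 :: 'c \<Rightarrow>\<^sub>0 real)}"
    by (intro closed_Collect_ball closed_Collect_eq continuous_intros
        bounded_bilinear.continuous_on[OF bounded_bilinear_contract[OF assms(2)]]
        continuous_on_compose2[OF continuous_on_product_coordinates]) auto
  ultimately have "compact (isometries U V \<times> (?T \<inter> cball 0 r) \<inter>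
      {p. \<forall>u\<in>rcarrier U. contract V (fst p u) (snd p) = (0 :: 'c \<Rightarrow>\<^sub>0 real)})"
    by (rule compact_Int_closed)
  moreover have "{p \<in> C2gamma W U V. norm (snd p) \<le> r} = isometries U V \<times> (?T \<inter> cball 0 r) \<inter>
      {p. \<forall>u\<in>rcarrier U. contract V (fst p u) (snd p) = 0}"
    by (auto simp: C2gamma_iff[OF assms(1,2)])
  ultimately show ?thesis
    by simp
qed

lemma Hausdorff_space_bundle:
  "Hausdorff_space (top_of_set (S :: ('k, 'i, 'j) bundle_point set))"
proof -
  have "Hausdorff_space (prod_topology (product_topology (\<lambda>i :: 'i \<Rightarrow>\<^sub>0 real. euclidean :: ('j \<Rightarrow>\<^sub>0 real) topology) UNIV)
      (euclidean :: ('k \<times> 'j \<Rightarrow>\<^sub>0 real) topology))"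
    by (simp add: Hausdorff_space_prod_topology Hausdorff_space_product_topology)
  then show ?thesis
    by (simp add: euclidean_product_topology Hausdorff_space_subtopology)
qed

text \<open>The open sublevel set slightly above the level of a point is a neighbourhood inside a
  compact sublevel set.\<close>

lemma locally_compact_space_exhaustion:
  fixes \<rho> :: "'a::topological_space \<Rightarrow> real"
  assumes "continuous_on UNIV \<rho>" "\<And>r. compact {x \<in> S. \<rho> x \<le> r}"
  shows "locally_compact_space (top_of_set S)"
  unfolding locally_compact_space_def
proof
  fix x
  assume x: "x \<in> topspace (top_of_set S)"
  let ?K = "{y \<in> S. \<rho> y \<le> \<rho> x + 1}"
  let ?N = "{y. \<rho> y < \<rho> x + 1}"
  have "open ?N"
    using assms(1) by (intro open_Collect_less continuous_on_const)
  then have "openin (top_of_set S) (S \<inter> ?N)"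
    by (rule openin_open_Int)
  moreover have "compactin (top_of_set S) ?K"
    using assms(2) by (auto simp: compactin_subtopology compactin_euclidean_iff)
  ultimately show "\<exists>N K. openin (top_of_set S) N \<and> compactin (top_of_set S) K \<and> x \<in> N \<and> N \<subseteq> K"
    using x by (intro exI[of _ "S \<inter> ?N"] exI[of _ ?K]) auto
qed

lemma locally_compact_space_C2gamma:
  assumes "orthogonal_rep U" "orthogonal_rep V" "orthogonal_rep W"
  shows "locally_compact_space (top_of_set (C2gamma W U V))"
  using compact_C2gamma_norm_le[OF assms]
  by (intro locally_compact_space_exhaustion[of "\<lambda>p. norm (snd p)"] continuous_intros)

lemma locally_compact_space_fin_dim:
  assumes "fin_dim S"
  shows "locally_compact_space (top_of_set (S :: ('i \<Rightarrow>\<^sub>0 real) set))"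
proof (rule locally_compact_space_exhaustion[of norm])
  have "{x \<in> S. norm x \<le> r} = S \<inter> cball 0 r" for r
    by auto
  then show "compact {x \<in> S. norm x \<le> r}" for r
    using compact_fin_dim_cball[OF assms] by metis
qed (intro continuous_intros)

lemma Hausdorff_space_C2J:
  assumes "orthogonal_rep U" "orthogonal_rep V" "orthogonal_rep W"
  shows "Hausdorff_space (stop (C2J W U V))"
  using locally_compact_space_C2gamma[OF assms] Hausdorff_space_bundle
  by (simp add: C2J_def c2_compactification_def Hausdorff_space_Alexandroff_compactification)

section \<open>Cutting a vector of the complement into height and direction\<close>

lemma ginner_simps:
  assumes "orthogonal_rep V"
  shows "ginner V (x + y) z = ginner V x z + ginner V y z" "ginner V z (x + y) = ginner V z x + ginner V z y"
    and "ginner V (c *\<^sub>R x) z = c * ginner V x z" "ginner V z (c *\<^sub>R x) = c * ginner V z x"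
    and "ginner V 0 z = 0"
  using bounded_bilinear_ginner[OF assms]
  by (simp_all add: bounded_bilinear.add_left bounded_bilinear.add_right bounded_bilinear.scaleR_left
      bounded_bilinear.scaleR_right bounded_bilinear.zero_left)

lemma contract_simps:
  assumes "orthogonal_rep V"
  shows "contract V (x + y) z = contract V x z + contract V y z"
    and "contract V (c *\<^sub>R x) z = c *\<^sub>R contract V x z"
    and "contract V x (z + z') = contract V x z + contract V x z'"
    and "contract V x (z - z') = contract V x z - contract V x z'"
  by (simp_all only: bounded_bilinear.add_left[OF bounded_bilinear_contract[OF assms]]
      bounded_bilinear.scaleR_left[OF bounded_bilinear_contract[OF assms]]
      bounded_bilinear.add_right[OF bounded_bilinear_contract[OF assms]]
      bounded_bilinear.diff_right[OF bounded_bilinear_contract[OF assms]])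

lemma dsum_vec_add: "dsum_vec u v + dsum_vec u' v' = dsum_vec (u + u') (v + v')"
  using linear_add[OF linear_dsum_vec, of "(u, v)" "(u', v')"] by simp

lemma dsum_vec_scale: "c *\<^sub>R dsum_vec u v = dsum_vec (c *\<^sub>R u) (c *\<^sub>R v)"
  using linear_scale[OF linear_dsum_vec, of c "(u, v)"] by simp

lemma dsum_vec_eq_iff: "dsum_vec u v = dsum_vec u' v' \<longleftrightarrow> u = u' \<and> v = v'"
  by (metis dsum_fst_vec dsum_snd_vec)

lemma rep_dsum_simps [simp]:
  "dsum_vec u v \<in> rcarrier (U \<oplus>\<^sub>r V) \<longleftrightarrow> u \<in> rcarrier U \<and> v \<in> rcarrier V"
  "ract (U \<oplus>\<^sub>r V) (dsum_vec u v) = dsum_vec (ract U u) (ract V v)"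
  "rinner (U \<oplus>\<^sub>r V) (dsum_vec u v) (dsum_vec u' v') = rinner U u u' + rinner V v v'"
  by (auto simp: dsum_def dsum_vec_eq_iff)

lemma rep_line_simps [simp]:
  "rcarrier (line \<epsilon>) = UNIV"
  "ract (line \<epsilon>) a = \<epsilon> *\<^sub>R a"
  "rinner (line \<epsilon>) a b = Poly_Mapping.lookup a () * Poly_Mapping.lookup b ()"
  by (simp_all add: line_def)

lemma rcarrier_dsumE:
  assumes "x \<in> rcarrier (U \<oplus>\<^sub>r V)"
  obtains u v where "x = dsum_vec u v" "u \<in> rcarrier U" "v \<in> rcarrier V"
  using assms by (auto simp: dsum_def)

lemma ract_linear:
  assumes "orthogonal_rep V" "x \<in> rcarrier V"
  shows "ract V x \<in> rcarrier V" "ract V (c *\<^sub>R x) = c *\<^sub>R ract V x"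
    "y \<in> rcarrier V \<Longrightarrow> ract V (x + y) = ract V x + ract V y"
    "y \<in> rcarrier V \<Longrightarrow> rinner V (ract V x) (ract V y) = rinner V x y"
  using assms by (auto simp: orthogonal_rep_def linear_on_subspace_def)

lemma ract_0: "orthogonal_rep V \<Longrightarrow> ract V 0 = 0"
  using ract_linear(2)[of V 0 0] orthogonal_rep_subspace[of V] by (simp add: subspace_0)

lemma tensor_map_ract:
  assumes "orthogonal_rep W" "orthogonal_rep V"
  shows "linear (tensor_map (rcarrier W) (rcarrier V) (ract W) (ract V))"
    and "\<lbrakk>w \<in> rcarrier W; v \<in> rcarrier V\<rbrakk> \<Longrightarrow>
      tensor_map (rcarrier W) (rcarrier V) (ract W) (ract V) (tensor_vec w v) = tensor_vec (ract W w) (ract V v)"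
  using tensor_map_characterization[of "rcarrier W" "rcarrier V" "ract W" "ract V"] assms
  by (auto simp: orthogonal_rep_def)

lemma subspace_orth_complement:
  assumes "orthogonal_rep V" "S \<subseteq> rcarrier V"
  shows "subspace (orth_complement V S)"
proof -
  have "orth_complement V S = {x \<in> rcarrier V. \<forall>s\<in>S. ginner V x s = 0}"
    using assms by (auto simp: orth_complement_def ginner_eq subset_iff)
  then show ?thesis
    using orthogonal_rep_subspace[OF assms(1)]
    by (auto simp: subspace_def ginner_simps[OF assms(1)])
qed

text \<open>Distributivity: both component maps send elementary tensors into the right spaces, and a
  tensor is the sum of its two parts put back.\<close>

lemma tensor_space_dsum_line_iff:
  assumes "subspace W" "subspace X"
  shows "z \<in> tensor_space {dsum_vec w a |w a. w \<in> W \<and> a \<in> UNIV} X \<longleftrightarrow>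
    tensor_outl z \<in> tensor_space W X \<and> tensor_outr z \<in> X"
proof
  assume z: "z \<in> tensor_space {dsum_vec w a |w a. w \<in> W \<and> a \<in> UNIV} X"
  have "tensor_outl z \<in> tensor_space W X"
    by (rule linear_tensor_space_image[OF z bounded_linear.linear[OF bounded_linear_tensor_outl] subspace_tensor_space])
      (auto simp: tensor_outl_tensor_vec tensor_vec_in_tensor_space)
  moreover have "tensor_outr z \<in> X"
    by (rule linear_tensor_space_image[OF z bounded_linear.linear[OF bounded_linear_tensor_outr] assms(2)])
      (auto simp: tensor_outr_tensor_vec subspace_scale assms(2))
  ultimately show "tensor_outl z \<in> tensor_space W X \<and> tensor_outr z \<in> X" ..
next
  let ?T = "tensor_space {dsum_vec w a |w a. w \<in> W \<and> a \<in> (UNIV :: (unit \<Rightarrow>\<^sub>0 real) set)} X"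
  assume z: "tensor_outl z \<in> tensor_space W X \<and> tensor_outr z \<in> X"
  have "tensor_inl (tensor_outl z) \<in> ?T"
    by (rule linear_tensor_space_image[OF conjunct1[OF z] bounded_linear.linear[OF bounded_linear_tensor_inl] subspace_tensor_space])
      (auto simp: tensor_inl_tensor_vec intro!: tensor_vec_in_tensor_space)
  moreover have "tensor_inr (tensor_outr z) \<in> ?T"
    using z subspace_0[OF assms(1)] unfolding tensor_inr_def by (intro tensor_vec_in_tensor_space) auto
  ultimately have "tensor_inl (tensor_outl z) + tensor_inr (tensor_outr z) \<in> ?T"
    by (rule subspace_add[OF subspace_tensor_space])
  then show "z \<in> ?T"
    by (simp only: tensor_in_out)
qed

text \<open>Distributivity in the fibre over \<open>f\<close>. It supplies the coordinates (y, v) of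
  the overview as \<open>tensor_outl\<close> and \<open>tensor_outr\<close>.\<close>

lemma C2gamma_dsum_line_iff:
  assumes "orthogonal_rep U" "orthogonal_rep V" "orthogonal_rep W"
  shows "(f, z) \<in> C2gamma (W \<oplus>\<^sub>r line \<epsilon>) U V \<longleftrightarrow>
    (f, tensor_outl z) \<in> C2gamma W U V \<and> tensor_outr z \<in> orth_complement V (f ` rcarrier U)"
proof -
  have "rcarrier (W \<oplus>\<^sub>r line \<epsilon>) = {dsum_vec w a |w a. w \<in> rcarrier W \<and> a \<in> UNIV}"
    by (simp add: dsum_def)
  then show ?thesis
    using tensor_space_dsum_line_iff[OF orthogonal_rep_subspace[OF assms(3)]
        subspace_orth_complement[OF assms(2) fin_dim_isometry_image(2)[OF assms(1)]]]
    by (auto simp: C2gamma_def)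
qed

subsection \<open>Isometries from a sum with a line\<close>

text \<open>An isometry from the sum of U and a line amounts to an isometry from U and a unit vector
  normal to its image. \<open>frame_res\<close> and \<open>frame_vec\<close> extract these data and
  \<open>frame_ext\<close> reassembles them.\<close>

definition frame_res :: "'i rep \<Rightarrow> (('i + unit \<Rightarrow>\<^sub>0 real) \<Rightarrow> 'b) \<Rightarrow> ('i \<Rightarrow>\<^sub>0 real) \<Rightarrow> 'b"
  where "frame_res U F = restrict (\<lambda>u. F (dsum_vec u 0)) (rcarrier U)"

definition frame_vec :: "(('i + unit \<Rightarrow>\<^sub>0 real) \<Rightarrow> 'b) \<Rightarrow> 'b"
  where "frame_vec F = F (dsum_vec 0 (Poly_Mapping.single () 1))"

text \<open>The domain is the carrier of \<open>U \<oplus>\<^sub>r line \<epsilon>\<close>, spelled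
  out because it does not depend on the sign.\<close>

definition frame_ext ::
    "'i rep \<Rightarrow> (('i \<Rightarrow>\<^sub>0 real) \<Rightarrow> ('j \<Rightarrow>\<^sub>0 real)) \<Rightarrow> ('j \<Rightarrow>\<^sub>0 real) \<Rightarrow> ('i + unit \<Rightarrow>\<^sub>0 real) \<Rightarrow> ('j \<Rightarrow>\<^sub>0 real)"
  where "frame_ext U f e = restrict (\<lambda>x. f (dsum_fst x) + Poly_Mapping.lookup (dsum_snd x) () *\<^sub>R e)
    {dsum_vec u a |u a. u \<in> rcarrier U}"

lemma unit_vec_eq: "a = Poly_Mapping.lookup a () *\<^sub>R Poly_Mapping.single () (1::real)"
  by (rule poly_mapping_eqI) simp

definition unit_normal :: "'j rep \<Rightarrow> ('j \<Rightarrow>\<^sub>0 real) set \<Rightarrow> ('j \<Rightarrow>\<^sub>0 real) set"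
  where "unit_normal V S = {e \<in> orth_complement V S. rinner V e e = 1}"

lemma unit_normalD:
  assumes "e \<in> unit_normal V S"
  shows "e \<in> rcarrier V" "s \<in> S \<Longrightarrow> rinner V e s = 0" "rinner V e e = 1"
  using assms by (auto simp: unit_normal_def orth_complement_def)

text \<open>The trivial and the sign line are treated together: they are
  \<open>line \<epsilon>\<close> with \<epsilon> equal to 1 or -1.\<close>

locale line_cone =
  fixes U :: "'i rep" and V :: "'j rep" and W :: "'k rep" and \<epsilon> :: real
  assumes U: "orthogonal_rep U" and V: "orthogonal_rep V" and W: "orthogonal_rep W"
    and eps: "\<epsilon> * \<epsilon> = 1"
begin

abbreviation A :: "unit rep" where "A \<equiv> line \<epsilon>"

lemma A: "orthogonal_rep A"
  using eps by (rule orthogonal_rep_line)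

lemma UA: "orthogonal_rep (U \<oplus>\<^sub>r A)"
  using U A by (rule orthogonal_rep_dsum)

lemma WA: "orthogonal_rep (W \<oplus>\<^sub>r A)"
  using W A by (rule orthogonal_rep_dsum)

lemma zero_in: "0 \<in> rcarrier U" "0 \<in> rcarrier V" "0 \<in> rcarrier W"
  using U V W by (simp_all add: orthogonal_rep_subspace subspace_0)

lemma isometry_eq_frame:
  assumes "F \<in> isometries (U \<oplus>\<^sub>r A) V" "u \<in> rcarrier U"
  shows "F (dsum_vec u a) = frame_res U F u + Poly_Mapping.lookup a () *\<^sub>R frame_vec F"
proof -
  have "dsum_vec u a = dsum_vec u 0 + Poly_Mapping.lookup a () *\<^sub>R dsum_vec 0 (Poly_Mapping.single () 1)"
    by (simp add: dsum_vec_add dsum_vec_scale flip: unit_vec_eq)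
  also have "F \<dots> = F (dsum_vec u 0) + Poly_Mapping.lookup a () *\<^sub>R F (dsum_vec 0 (Poly_Mapping.single () 1))"
    using assms zero_in by (subst isometriesD(2)[OF assms(1)]) (auto simp: dsum_vec_scale isometriesD(3)[OF assms(1), symmetric])
  finally show ?thesis
    using assms(2) by (simp add: frame_res_def frame_vec_def)
qed

text \<open>In the orthogonal sum, (0,1) is a unit vector orthogonal to every (u,0), and F preserves
  this. Extensionality settles equality with the reassembled map off the carrier.\<close>

lemma frame_isometries:
  assumes F: "F \<in> isometries (U \<oplus>\<^sub>r A) V"
  shows "frame_res U F \<in> isometries U V"
    and "frame_vec F \<in> unit_normal V (frame_res U F ` rcarrier U)"
    and "F = frame_ext U (frame_res U F) (frame_vec F)"
proof -
  have in': "dsum_vec u 0 \<in> rcarrier (U \<oplus>\<^sub>r A)" if "u \<in> rcarrier U" for u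
    using that by simp
  have add: "F (dsum_vec (u + u') 0) = F (dsum_vec u 0) + F (dsum_vec u' 0)" if "u \<in> rcarrier U" "u' \<in> rcarrier U" for u u'
    using isometriesD(2)[OF F in'[OF that(1)] in'[OF that(2)]] by (simp add: dsum_vec_add)
  have scale: "F (dsum_vec (c *\<^sub>R u) 0) = c *\<^sub>R F (dsum_vec u 0)" if "u \<in> rcarrier U" for u c
    using isometriesD(3)[OF F in'[OF that], of c] by (simp add: dsum_vec_scale)
  have inner: "rinner V (F (dsum_vec u 0)) (F (dsum_vec u' 0)) = rinner U u u'" if "u \<in> rcarrier U" "u' \<in> rcarrier U" for u u'
    using isometriesD(4)[OF F in'[OF that(1)] in'[OF that(2)]] by simp
  show "frame_res U F \<in> isometries U V"
    using add scale inner isometriesD(1)[OF F in'] orthogonal_rep_subspace[OF U]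
    unfolding isometries_def linear_on_subspace_def frame_res_def by (auto simp: subspace_add subspace_scale)
  have e: "frame_vec F \<in> rcarrier V"
    using isometriesD(1)[OF F] zero_in by (simp add: frame_vec_def)
  have "rinner U 0 u = 0" if "u \<in> rcarrier U" for u
    using rinner_scale_left[OF U that that, of 0] by simp
  then have "rinner V (frame_vec F) (F (dsum_vec u 0)) = 0" if "u \<in> rcarrier U" for u
    using that zero_in isometriesD(4)[OF F, of "dsum_vec 0 (Poly_Mapping.single () 1)" "dsum_vec u 0"]
    by (simp add: frame_vec_def)
  moreover have "rinner V (frame_vec F) (frame_vec F) = 1"
    using zero_in isometriesD(4)[OF F, of "dsum_vec 0 (Poly_Mapping.single () 1)" "dsum_vec 0 (Poly_Mapping.single () 1)"]
      rinner_scale_left[OF U zero_in(1) zero_in(1), of 0]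
    by (simp add: frame_vec_def)
  ultimately show "frame_vec F \<in> unit_normal V (frame_res U F ` rcarrier U)"
    using e by (auto simp: unit_normal_def orth_complement_def frame_res_def)
  show "F = frame_ext U (frame_res U F) (frame_vec F)"
  proof
    fix x
    show "F x = frame_ext U (frame_res U F) (frame_vec F) x"
    proof (cases "x \<in> rcarrier (U \<oplus>\<^sub>r A)")
      case True
      then obtain u a where "x = dsum_vec u a" "u \<in> rcarrier U"
        by (rule rcarrier_dsumE)
      then show ?thesis
        using isometry_eq_frame[OF F] by (auto simp: frame_ext_def)
    next
      case False
      then show ?thesis
        using isometriesD(6)[OF F] by (auto simp: frame_ext_def extensional_def)
    qed
  qed
qed

text \<open>Because \<open>e\<close> is a unit vector orthogonal to the image of \<open>f\<close>,
  the mixed terms drop out of the inner product of two extended values.\<close>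

lemma frame_ext_simps:
  assumes "f \<in> isometries U V" "e \<in> unit_normal V (f ` rcarrier U)"
  shows "frame_ext U f e \<in> isometries (U \<oplus>\<^sub>r A) V"
    and "frame_res U (frame_ext U f e) = f"
    and "frame_vec (frame_ext U f e) = e"
proof -
  note f = isometriesD[OF assms(1)] and e = unit_normalD[OF assms(2)]
  have f0: "f 0 = 0"
    using f(3)[OF zero_in(1), of 0] by simp
  have ext: "frame_ext U f e (dsum_vec u a) = f u + Poly_Mapping.lookup a () *\<^sub>R e" if "u \<in> rcarrier U" for u a
    using that by (auto simp: frame_ext_def)
  have mem: "frame_ext U f e (dsum_vec u a) \<in> rcarrier V" if "u \<in> rcarrier U" for u a
    using that f(1) e(1) orthogonal_rep_subspace[OF V] by (simp add: ext subspace_add subspace_scale)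
  have inner: "rinner V (frame_ext U f e (dsum_vec u a)) (frame_ext U f e (dsum_vec u' a')) =
      rinner (U \<oplus>\<^sub>r A) (dsum_vec u a) (dsum_vec u' a')" if "u \<in> rcarrier U" "u' \<in> rcarrier U" for u a u' a'
  proof -
    have fe: "ginner V e (f u) = 0" "ginner V (f u) e = 0" "ginner V e e = 1" "ginner V (f u) (f u') = rinner U u u'"
      "ginner V e (f u') = 0"
      using that e f(1,4) rinner_commute[OF V f(1)[OF that(1)] e(1)] by (simp_all add: ginner_eq[OF V])
    have "rinner V (frame_ext U f e (dsum_vec u a)) (frame_ext U f e (dsum_vec u' a')) =
        ginner V (f u + Poly_Mapping.lookup a () *\<^sub>R e) (f u' + Poly_Mapping.lookup a' () *\<^sub>R e)"
      using mem that V by (simp add: ginner_eq flip: ext)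
    also have "\<dots> = rinner U u u' + Poly_Mapping.lookup a () * Poly_Mapping.lookup a' ()"
      using fe by (simp add: ginner_simps[OF V])
    finally show ?thesis
      by simp
  qed
  have add: "frame_ext U f e (dsum_vec u a + dsum_vec u' a') = frame_ext U f e (dsum_vec u a) + frame_ext U f e (dsum_vec u' a')"
    if "u \<in> rcarrier U" "u' \<in> rcarrier U" for u a u' a'
    using that f(2) orthogonal_rep_subspace[OF U] by (simp add: dsum_vec_add ext subspace_add lookup_add algebra_simps)
  have scale: "frame_ext U f e (c *\<^sub>R dsum_vec u a) = c *\<^sub>R frame_ext U f e (dsum_vec u a)"
    if "u \<in> rcarrier U" for u a c
    using that f(3) orthogonal_rep_subspace[OF U] by (simp add: dsum_vec_scale ext subspace_scale algebra_simps)
  have carrier: "rcarrier (U \<oplus>\<^sub>r A) = {dsum_vec u a |u a. u \<in> rcarrier U}"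
    by (simp add: dsum_def)
  have "frame_ext U f e \<in> extensional (rcarrier (U \<oplus>\<^sub>r A))"
    by (simp add: frame_ext_def carrier)
  then show "frame_ext U f e \<in> isometries (U \<oplus>\<^sub>r A) V"
    unfolding isometries_def linear_on_subspace_def PiE_iff
    using mem inner add scale by (auto elim!: rcarrier_dsumE)
  show "frame_res U (frame_ext U f e) = f"
    using f(6) ext by (auto simp: frame_res_def extensional_def fun_eq_iff)
  show "frame_vec (frame_ext U f e) = e"
    using ext[OF zero_in(1)] f0 by (simp add: frame_vec_def)
qed

lemma frame_ginner:
  assumes "F \<in> isometries (U \<oplus>\<^sub>r A) V"
  shows "ginner V (frame_vec F) (frame_vec F) = 1"
    and "u \<in> rcarrier U \<Longrightarrow> ginner V (frame_res U F u) (frame_vec F) = 0"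
  using unit_normalD[OF frame_isometries(2)[OF assms]] isometriesD(1)[OF frame_isometries(1)[OF assms]]
    V rinner_commute[OF V] by (auto simp: ginner_eq)

section \<open>Composition with the sphere, and its inverse by contraction\<close>

definition thom_sum :: "('k, 'i + unit, 'j) bundle_point \<Rightarrow> ('k \<times> unit \<Rightarrow>\<^sub>0 real) \<Rightarrow> ('k \<times> 'j \<Rightarrow>\<^sub>0 real)"
  where "thom_sum p s = snd p + tensor_vec (slice () s) (frame_vec (fst p))"

text \<open>Contraction with any value of F kills x, and contraction with e turns s \<otimes> e back
  into s. This is where uniqueness of the decomposition comes from.\<close>

lemma thom_sum_in:
  assumes "(F, x) \<in> C2gamma W (U \<oplus>\<^sub>r A) V" "s \<in> tensor_space (rcarrier W) UNIV"
  shows "(frame_res U F, thom_sum (F, x) s) \<in> C2gamma W U V"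
    and "contract V (frame_vec F) (thom_sum (F, x) s) = slice () s"
proof -
  have F: "F \<in> isometries (U \<oplus>\<^sub>r A) V" and x: "x \<in> tensor_space (rcarrier W) (rcarrier V)"
    and contr: "\<And>u. u \<in> rcarrier (U \<oplus>\<^sub>r A) \<Longrightarrow> contract V (F u) x = 0"
    using assms(1) by (auto simp: C2gamma_iff[OF UA V])
  note frame = frame_isometries[OF F]
  have e: "frame_vec F \<in> rcarrier V"
    using unit_normalD(1)[OF frame(2)] .
  have s: "slice () s \<in> rcarrier W"
    using slice_in[OF assms(2) orthogonal_rep_subspace[OF W]] .
  have "thom_sum (F, x) s \<in> tensor_space (rcarrier W) (rcarrier V)"
    unfolding thom_sum_def using x e s
    by (auto intro!: subspace_add[OF subspace_tensor_space] tensor_vec_in_tensor_space)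
  moreover have contr_sum: "contract V v (thom_sum (F, x) s) = contract V v x + ginner V v (frame_vec F) *\<^sub>R slice () s" for v
    using e by (simp add: thom_sum_def contract_simps[OF V] contract_tensor_vec[OF V])
  moreover have "contract V (frame_res U F u) x = 0" if "u \<in> rcarrier U" for u
    using contr[of "dsum_vec u 0"] that by (simp add: frame_res_def)
  ultimately show "(frame_res U F, thom_sum (F, x) s) \<in> C2gamma W U V"
    using frame(1) frame_ginner(2)[OF F] by (auto simp: C2gamma_iff[OF U V])
  show "contract V (frame_vec F) (thom_sum (F, x) s) = slice () s"
    using contr_sum contr[of "dsum_vec 0 (Poly_Mapping.single () 1)"] frame_ginner(1)[OF F] zero_in
    by (simp add: frame_vec_def[of F, symmetric])
qed

text \<open>Contracting with f(u) + a e gives a times the contraction of y with e, once from y and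
  once from the subtracted term, so the difference is orthogonal to the whole enlarged
  frame.\<close>

lemma thom_split:
  assumes fy: "(f, y) \<in> C2gamma W U V" and e: "e \<in> unit_normal V (f ` rcarrier U)"
  shows "(frame_ext U f e, y - tensor_vec (contract V e y) e) \<in> C2gamma W (U \<oplus>\<^sub>r A) V"
    and "contract V e y \<in> rcarrier W"
proof -
  have f: "f \<in> isometries U V" and y: "y \<in> tensor_space (rcarrier W) (rcarrier V)"
    and contr: "\<And>u. u \<in> rcarrier U \<Longrightarrow> contract V (f u) y = 0"
    using fy by (auto simp: C2gamma_iff[OF U V])
  note ext = frame_ext_simps[OF f e] and e' = unit_normalD[OF e]
  show w: "contract V e y \<in> rcarrier W"
    using contract_in[OF V y] orthogonal_rep_subspace[OF W] by simp
  have "y - tensor_vec (contract V e y) e \<in> tensor_space (rcarrier W) (rcarrier V)"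
    using y w e'(1) by (intro subspace_diff[OF subspace_tensor_space] tensor_vec_in_tensor_space)
  moreover have "contract V (f u + a *\<^sub>R e) (y - tensor_vec (contract V e y) e) = 0" if "u \<in> rcarrier U" for u and a :: real
  proof -
    have "ginner V (f u) e = 0" "ginner V e e = 1"
      using e' that isometriesD(1)[OF f that] rinner_commute[OF V isometriesD(1)[OF f that] e'(1)]
      by (simp_all add: ginner_eq[OF V])
    then have "ginner V (f u + a *\<^sub>R e) e = a"
      by (simp add: ginner_simps[OF V])
    moreover have "contract V (f u + a *\<^sub>R e) y = a *\<^sub>R contract V e y"
      using contr[OF that] by (simp add: contract_simps[OF V])
    ultimately show ?thesis
      using e'(1) by (simp add: contract_simps(4)[OF V] contract_tensor_vec[OF V])
  qed
  moreover have "frame_ext U f e x \<in> {f u + a *\<^sub>R e |u a. u \<in> rcarrier U}" if "x \<in> rcarrier (U \<oplus>\<^sub>r A)" for x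
    using that isometry_eq_frame[OF ext(1)] ext(2,3) by (auto elim!: rcarrier_dsumE)
  ultimately show "(frame_ext U f e, y - tensor_vec (contract V e y) e) \<in> C2gamma W (U \<oplus>\<^sub>r A) V"
    using ext(1) by (fastforce simp: C2gamma_iff[OF UA V])
qed

text \<open>Identifies \<open>thom_sum\<close> as the vector component of the composite. The two
  tensor maps involved are determined on tensors only, so the comparison is made on elementary ones:
  F sends (0,a) to a times e.\<close>

lemma restricted_comp_Some:
  assumes "(F, x) \<in> C2gamma W (U \<oplus>\<^sub>r A) V" "s \<in> tensor_space (rcarrier W) UNIV"
  shows "restricted_comp W U A (Some (Some (F, x), Some s)) = Some (frame_res U F, thom_sum (F, x) s)"
proof -
  have F: "F \<in> isometries (U \<oplus>\<^sub>r A) V"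
    using assms(1) by (auto simp: C2gamma_def)
  have id: "linear_on_subspace (rcarrier W) id" and in2: "linear_on_subspace UNIV (dsum_vec (0 :: 'i \<Rightarrow>\<^sub>0 real))"
    by (simp_all add: linear_on_subspace_def dsum_vec_add dsum_vec_scale)
  note incl = tensor_map_characterization[OF orthogonal_rep_subspace[OF W] subspace_UNIV id in2]
  note comp = tensor_map_characterization[OF orthogonal_rep_subspace[OF W] orthogonal_rep_subspace[OF UA]
      id isometriesD(5)[OF F]]
  have "(tensor_map (rcarrier W) (rcarrier (U \<oplus>\<^sub>r A)) id F \<circ> tensor_map (rcarrier W) UNIV id (dsum_vec 0)) s =
      tensor_vec (slice () s) (frame_vec F)"
  proof (rule linear_eq_on_tensor_space[OF assms(2)])
    show "linear (tensor_map (rcarrier W) (rcarrier (U \<oplus>\<^sub>r A)) id F \<circ> tensor_map (rcarrier W) UNIV id (dsum_vec (0 :: 'i \<Rightarrow>\<^sub>0 real)))"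
      using incl(1) comp(1) by (rule linear_compose)
    show "linear (\<lambda>s. tensor_vec (slice () s) (frame_vec F))"
      using linear_compose[OF bounded_linear.linear[OF bounded_linear_slice] linear_tensor_vec_left]
      by (simp add: comp_def)
    show "(tensor_map (rcarrier W) (rcarrier (U \<oplus>\<^sub>r A)) id F \<circ> tensor_map (rcarrier W) UNIV id (dsum_vec 0)) (tensor_vec w a) =
        tensor_vec (slice () (tensor_vec w a)) (frame_vec F)" if "w \<in> rcarrier W" for w a
    proof -
      have "F (dsum_vec 0 a) = Poly_Mapping.lookup a () *\<^sub>R frame_vec F"
        using isometry_eq_frame[OF F zero_in(1), of a] isometriesD(3)[OF frame_isometries(1)[OF F] zero_in(1), of 0] by simp
      then show ?thesis
        using that zero_in by (simp add: incl(2) comp(2) slice_tensor_vec linear_scale[OF linear_tensor_vec_left]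
            linear_scale[OF linear_tensor_vec_right])
    qed
  qed
  then show ?thesis
    by (simp add: restricted_comp_def C2J_comp_def tensor_sphere_incl_def thom_sum_def frame_res_def compose_def cong: restrict_cong)
qed

text \<open>Stretches [0,1) to [0,\<infinity>). Division by zero makes \<open>height 1\<close> equal
  to 0, but t = 1 is collapsed before this value could be used.\<close>

definition height :: "real \<Rightarrow> real"
  where "height t = t / (1 - t)"

definition cone_point ::
    "('k, 'i + unit, 'j) bundle_point \<Rightarrow> ('k \<times> unit \<Rightarrow>\<^sub>0 real) \<Rightarrow> real \<Rightarrow> ('k + unit, 'i, 'j) bundle_point"
  where "cone_point p s t =
    (frame_res U (fst p), tensor_inl (thom_sum p s) + tensor_inr (height t *\<^sub>R frame_vec (fst p)))"

lemma height_bij: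
  assumes "c > 0"
  shows "\<exists>t. 0 < t \<and> t < 1 \<and> height t = c"
  \<comment> \<open>The inverse of t/(1 - t) is c/(1 + c).\<close>
  using assms by (intro exI[of _ "c / (1 + c)"]) (auto simp: height_def field_simps)

lemma height_pos: "0 < t \<Longrightarrow> t < 1 \<Longrightarrow> height t > 0"
  by (simp add: height_def)

lemma height_inj: "0 < t \<Longrightarrow> t < 1 \<Longrightarrow> 0 < t' \<Longrightarrow> t' < 1 \<Longrightarrow> height t = height t' \<Longrightarrow> t = t'"
  by (simp add: height_def field_simps)

lemma tensor_inr_0 [simp]: "tensor_inr 0 = 0"
  by (simp add: linear_0 bounded_linear.linear bounded_linear_tensor_inr)

lemma tensor_outl_inl [simp]: "tensor_outl (tensor_inl y :: ('k + unit) \<times> 'j \<Rightarrow>\<^sub>0 real) = y"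
  using tensor_outl_in[of y 0] by simp

lemma tensor_outr_inl [simp]: "tensor_outr (tensor_inl y :: ('k + unit) \<times> 'j \<Rightarrow>\<^sub>0 real) = 0"
  using tensor_outr_in[of y 0] by simp

section \<open>The open cone as the part with nonzero line component\<close>

lemma cone_point_in:
  assumes "p \<in> C2gamma W (U \<oplus>\<^sub>r A) V" "s \<in> tensor_space (rcarrier W) UNIV"
  shows "cone_point p s t \<in> C2gamma (W \<oplus>\<^sub>r A) U V"
proof -
  obtain F x where p: "p = (F, x)"
    by fastforce
  have F: "F \<in> isometries (U \<oplus>\<^sub>r A) V"
    using assms(1) by (auto simp: C2gamma_def p)
  have "frame_vec F \<in> orth_complement V (frame_res U F ` rcarrier U)"
    using frame_isometries(2)[OF F] by (simp add: unit_normal_def)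
  then have "height t *\<^sub>R frame_vec F \<in> orth_complement V (frame_res U F ` rcarrier U)"
    by (intro subspace_scale subspace_orth_complement V fin_dim_isometry_image[OF U] frame_isometries(1)[OF F])
  then show ?thesis
    using thom_sum_in(1) assms by (simp add: p cone_point_def C2gamma_dsum_line_iff[OF U V W])
qed

lemma base_point_in_iff: "(f, tensor_inl y) \<in> C2gamma (W \<oplus>\<^sub>r A) U V \<longleftrightarrow> (f, y) \<in> C2gamma W U V"
proof -
  have "f \<in> isometries U V \<Longrightarrow> 0 \<in> orth_complement V (f ` rcarrier U)"
    by (rule subspace_0[OF subspace_orth_complement[OF V fin_dim_isometry_image(2)[OF U]]])
  moreover have "(f, y) \<in> C2gamma W U V \<Longrightarrow> f \<in> isometries U V"
    by (simp add: C2gamma_def)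
  ultimately show ?thesis
    by (auto simp: C2gamma_dsum_line_iff[OF U V W])
qed

text \<open>The length of the line component is the height, as e is a unit vector, and so determines
  t. Its direction is then e, which with the restriction determines F; contraction with e gives s,
  and subtraction gives x.\<close>

lemma cone_point_inj:
  assumes p: "p \<in> C2gamma W (U \<oplus>\<^sub>r A) V" "p' \<in> C2gamma W (U \<oplus>\<^sub>r A) V"
    and s: "s \<in> tensor_space (rcarrier W) UNIV" "s' \<in> tensor_space (rcarrier W) UNIV"
    and t: "0 < t" "t < 1" "0 < t'" "t' < 1"
    and eq: "cone_point p s t = cone_point p' s' t'"
  shows "p = p' \<and> s = s' \<and> t = t'"
proof -
  obtain F x F' x' where Fx: "p = (F, x)" "p' = (F', x')"
    by fastforce
  have F: "F \<in> isometries (U \<oplus>\<^sub>r A) V" "F' \<in> isometries (U \<oplus>\<^sub>r A) V"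
    using p by (auto simp: C2gamma_def Fx)
  have res: "frame_res U F = frame_res U F'"
    and sum: "thom_sum p s = thom_sum p' s'"
    and vec: "height t *\<^sub>R frame_vec F = height t' *\<^sub>R frame_vec F'"
    using eq tensor_outl_in tensor_outr_in unfolding cone_point_def Fx by (metis fst_conv snd_conv)+
  have "height t * height t = ginner V (height t *\<^sub>R frame_vec F) (height t *\<^sub>R frame_vec F)"
    using frame_ginner(1)[OF F(1)] by (simp add: ginner_simps[OF V])
  also have "\<dots> = height t' * height t'"
    unfolding vec using frame_ginner(1)[OF F(2)] by (simp add: ginner_simps[OF V])
  finally have ht: "height t = height t'"
    using height_pos t by (metis abs_of_pos power2_eq_iff power2_eq_square abs_minus_cancel)
  then have "t = t'"
    using height_inj t by blast
  moreover have e: "frame_vec F = frame_vec F'"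
    using vec ht height_pos[OF t(1,2)] by simp
  then have "F = F'"
    using frame_isometries(3)[OF F(1)] frame_isometries(3)[OF F(2)] res by simp
  moreover have "slice () s = slice () s'"
    using thom_sum_in(2) p s e sum unfolding Fx by metis
  then have "s = s'"
    by (intro poly_mapping_eqI) (metis lookup_slice old.unit.exhaust surj_pair)
  moreover have "x = x'"
    using sum calculation by (simp add: thom_sum_def Fx)
  ultimately show ?thesis
    by (simp add: Fx)
qed

lemma cone_point_surj:
  assumes z: "(f, z) \<in> C2gamma (W \<oplus>\<^sub>r A) U V" and nz: "tensor_outr z \<noteq> 0"
  shows "\<exists>p\<in>C2gamma W (U \<oplus>\<^sub>r A) V. \<exists>s\<in>tensor_space (rcarrier W) UNIV. \<exists>t. 0 < t \<and> t < 1 \<and> (f, z) = cone_point p s t"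
proof -
  let ?v = "tensor_outr z" and ?y = "tensor_outl z"
  have y: "(f, ?y) \<in> C2gamma W U V" and v: "?v \<in> orth_complement V (f ` rcarrier U)"
    using z by (auto simp: C2gamma_dsum_line_iff[OF U V W])
  then have f: "f \<in> isometries U V"
    by (simp add: C2gamma_def)
  have vV: "?v \<in> rcarrier V"
    using v by (simp add: orth_complement_def)
  define c where "c = sqrt (rinner V ?v ?v)"
  have c: "c > 0" "c * c = rinner V ?v ?v"
    using rinner_pos[OF V vV nz] by (simp_all add: c_def)
  define e where "e = (1 / c) *\<^sub>R ?v"
  have "e \<in> orth_complement V (f ` rcarrier U)"
    unfolding e_def using v by (intro subspace_scale subspace_orth_complement V fin_dim_isometry_image(2)[OF U f])
  moreover have "rinner V e e = 1"
    using c vV V by (simp add: e_def rinner_scale_left rinner_scale_right orthogonal_rep_subspace subspace_scale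
        flip: c(2))
  ultimately have e: "e \<in> unit_normal V (f ` rcarrier U)"
    by (simp add: unit_normal_def)
  note split = thom_split[OF y e] and ext = frame_ext_simps[OF f e]
  obtain t where t: "0 < t" "t < 1" "height t = c"
    using height_bij[OF c(1)] by blast
  \<comment> \<open>The sphere lives on W \<otimes> \<real> rather than on W, so the contraction is
    tensored with the basis vector; \<open>slice ()\<close> undoes this.\<close>
  define s where "s = tensor_vec (contract V e ?y) (Poly_Mapping.single () (1::real))"
  have s: "s \<in> tensor_space (rcarrier W) UNIV" "slice () s = contract V e ?y"
    using split(2) by (simp_all add: s_def tensor_vec_in_tensor_space slice_tensor_vec)
  have "cone_point (frame_ext U f e, ?y - tensor_vec (contract V e ?y) e) s t = (f, z)"
    using ext s(2) t c(1) tensor_in_out[of z] by (simp add: cone_point_def thom_sum_def e_def)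
  then show ?thesis
    using split(1) s(1) t by metis
qed

end

section \<open>The homeomorphism\<close>

lemma C2J_simps [simp]:
  "stop (C2J W U V) = Alexandroff_compactification (top_of_set (C2gamma W U V))"
  "sact (C2J W U V) = map_option (C2gamma_act W U V)"
  "spt (C2J W U V) = None"
  by (simp_all add: C2J_def c2_compactification_def)

lemma tensor_sphere_simps [simp]:
  "stop (tensor_sphere W A) = Alexandroff_compactification (top_of_set (tensor_space (rcarrier W) (rcarrier A)))"
  "sact (tensor_sphere W A) = map_option (tensor_map (rcarrier W) (rcarrier A) (ract W) (ract A))"
  "spt (tensor_sphere W A) = None"
  by (simp_all add: tensor_sphere_def c2_compactification_def)

lemma smash_simps [simp]:
  "sact (smash X Y) = map_option (map_prod (sact X) (sact Y))"
  "spt (smash X Y) = None"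
  by (simp_all add: smash_def)

lemma hocofibre_sact [simp]: "sact (hocofibre X Y f) = map_sum (map_prod (sact X) id) (sact Y)"
  by (simp add: hocofibre_def)

lemma topspace_smash: "topspace (stop (smash X Y)) = smash_proj X Y ` (topspace (stop X) \<times> topspace (stop Y))"
  by (simp add: stop_smash)

context line_cone
begin

section \<open>The comparison map on normal forms\<close>

abbreviation "source \<equiv> smash (C2J W (U \<oplus>\<^sub>r A) V) (tensor_sphere W A)"

abbreviation "cofibre \<equiv> hocofibre source (C2J W U V) (restricted_comp W U A)"

text \<open>Defined on the representatives chosen by \<open>hocofibre_proj\<close>. There the cone
  clause occurs only with 0 < t < 1, so no compatibility with the identifications has to be built
  in.\<close>

definition cofibre_map ::
    "(((('k, 'i + unit, 'j) bundle_point option \<times> ('k \<times> unit \<Rightarrow>\<^sub>0 real) option) option \<times> real) +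
      ('k, 'i, 'j) bundle_point option) \<Rightarrow> ('k + unit, 'i, 'j) bundle_point option"
  where "cofibre_map z =
    (case z of
       Inl q \<Rightarrow> (case q of (Some (Some p, Some s), t) \<Rightarrow> Some (cone_point p s t) | _ \<Rightarrow> None)
     | Inr q \<Rightarrow> map_option (map_prod id tensor_inl) q)"

lemma cofibre_map_simps [simp]:
  "cofibre_map (Inl (Some (Some p, Some s), t)) = Some (cone_point p s t)"
  "cofibre_map (Inr None) = None"
  "cofibre_map (Inr (Some (f, y))) = Some (f, tensor_inl y)"
  by (simp_all add: cofibre_map_def)

lemma hocofibre_proj_cone:
  assumes "p \<in> C2gamma W (U \<oplus>\<^sub>r A) V" "s \<in> tensor_space (rcarrier W) UNIV"
  shows "hocofibre_proj source (C2J W U V) (restricted_comp W U A)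
      (Inl (smash_proj (C2J W (U \<oplus>\<^sub>r A) V) (tensor_sphere W A) (Some p, Some s), t)) =
    (if t = 1 then Inr None else if t = 0 then Inr (Some (frame_res U (fst p), thom_sum p s))
     else Inl (Some (Some p, Some s), t))"
  using restricted_comp_Some[of "fst p" "snd p" s] assms
  by (simp add: hocofibre_proj_def smash_proj_def)

lemma hocofibre_proj_base:
  assumes "a = None \<or> b = None"
  shows "hocofibre_proj source (C2J W U V) (restricted_comp W U A)
    (Inl (smash_proj (C2J W (U \<oplus>\<^sub>r A) V) (tensor_sphere W A) (a, b), t)) = Inr None"
  using assms by (auto simp: hocofibre_proj_def smash_proj_def)

text \<open>Both ends of the cone and all base points are represented in the target, so only the
  open cone on finite points is added to it.\<close>

lemma topspace_cofibre:
  "topspace (stop cofibre) = Inr ` insert None (Some ` C2gamma W U V) \<union>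
    {Inl (Some (Some p, Some s), t) |p s t.
      p \<in> C2gamma W (U \<oplus>\<^sub>r A) V \<and> s \<in> tensor_space (rcarrier W) UNIV \<and> 0 < t \<and> t < 1}"
    (is "_ = ?B \<union> ?C")
proof -
  let ?q = "hocofibre_proj source (C2J W U V) (restricted_comp W U A)"
  let ?sp = "smash_proj (C2J W (U \<oplus>\<^sub>r A) V) (tensor_sphere W A)"
  let ?X = "insert None (Some ` C2gamma W (U \<oplus>\<^sub>r A) V)" and ?S = "insert None (Some ` tensor_space (rcarrier W) UNIV)"
  have "topspace (stop cofibre) = ?q ` (Inl ` (?sp ` (?X \<times> ?S) \<times> {0..1}) \<union> Inr ` insert None (Some ` C2gamma W U V))"
    by (simp add: hocofibre_def topspace_smash)
  also have "\<dots> = ?B \<union> ?C"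
  proof (intro equalityI subsetI)
    fix z
    assume "z \<in> ?q ` (Inl ` (?sp ` (?X \<times> ?S) \<times> {0..1}) \<union> Inr ` insert None (Some ` C2gamma W U V))"
    then consider a b t where "a \<in> ?X" "b \<in> ?S" "t \<in> {0..1}" "z = ?q (Inl (?sp (a, b), t))"
      | y where "y \<in> insert None (Some ` C2gamma W U V)" "z = ?q (Inr y)"
      by blast
    then show "z \<in> ?B \<union> ?C"
    proof cases
      case 1
      show ?thesis
      proof (cases "a = None \<or> b = None")
        case True
        then show ?thesis
          using hocofibre_proj_base 1(4) by auto
      next
        case False
        then obtain p s where ps: "a = Some p" "b = Some s" "p \<in> C2gamma W (U \<oplus>\<^sub>r A) V" "s \<in> tensor_space (rcarrier W) UNIV"
          using 1(1,2) by auto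
        then have "(frame_res U (fst p), thom_sum p s) \<in> C2gamma W U V"
          using thom_sum_in(1)[of "fst p" "snd p" s] by simp
        moreover have "z = (if t = 1 then Inr None else if t = 0 then Inr (Some (frame_res U (fst p), thom_sum p s))
            else Inl (Some (Some p, Some s), t))"
          using 1(4) ps(1,2) hocofibre_proj_cone[OF ps(3,4), of t] by simp
        ultimately consider "z \<in> ?B" | "t \<noteq> 0" "t \<noteq> 1" "z = Inl (Some (Some p, Some s), t)"
          by (auto split: if_splits)
        then show ?thesis
        proof cases
          case 2
          then have "0 < t" "t < 1"
            using 1(3) by auto
          then show ?thesis
            using 2 ps(3,4) by blast
        qed blast
      qed
    next
      case 2
      then have "z = Inr y"
        by (simp add: hocofibre_proj_def)
      then show ?thesis
        using 2(1) by blast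
    qed
  next
    fix z
    assume "z \<in> ?B \<union> ?C"
    then consider y where "y \<in> insert None (Some ` C2gamma W U V)" "z = Inr y"
      | p s t where "p \<in> C2gamma W (U \<oplus>\<^sub>r A) V" "s \<in> tensor_space (rcarrier W) UNIV" "0 < t" "t < 1"
        "z = Inl (Some (Some p, Some s), t)"
      by blast
    then show "z \<in> ?q ` (Inl ` (?sp ` (?X \<times> ?S) \<times> {0..1}) \<union> Inr ` insert None (Some ` C2gamma W U V))"
    proof cases
      case 1
      then have "z = ?q (Inr y)"
        by (simp add: hocofibre_proj_def)
      then show ?thesis
        using 1(1) by blast
    next
      case 2
      then have "z = ?q (Inl (?sp (Some p, Some s), t))"
        using hocofibre_proj_cone[OF 2(1,2)] by simp
      moreover have "(Some p, Some s) \<in> ?X \<times> ?S" "t \<in> {0..1}"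
        using 2 by auto
      ultimately show ?thesis
        by blast
    qed
  qed
  finally show ?thesis .
qed

lemma cofibre_cases [consumes 1, case_names pt base cone]:
  assumes "z \<in> topspace (stop cofibre)"
  obtains "z = Inr None"
  | f y where "z = Inr (Some (f, y))" "(f, y) \<in> C2gamma W U V"
  | p s t where "z = Inl (Some (Some p, Some s), t)" "p \<in> C2gamma W (U \<oplus>\<^sub>r A) V"
      "s \<in> tensor_space (rcarrier W) UNIV" "0 < t" "t < 1"
proof -
  consider "z = Inr None" | q where "z = Inr (Some q)" "q \<in> C2gamma W U V"
    | p s t where "z = Inl (Some (Some p, Some s), t)" "p \<in> C2gamma W (U \<oplus>\<^sub>r A) V"
      "s \<in> tensor_space (rcarrier W) UNIV" "0 < t" "t < 1"
    using assms unfolding topspace_cofibre by blast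
  then show ?thesis
    using that by cases (auto intro: surj_pair)
qed

text \<open>The line component is a positive multiple of a unit vector on the open cone and 0 on the
  base, which keeps the two images apart.\<close>

lemma cone_point_ne_base:
  assumes "p \<in> C2gamma W (U \<oplus>\<^sub>r A) V" "0 < t" "t < 1"
  shows "cone_point p s t \<noteq> (f, tensor_inl y)"
proof
  assume "cone_point p s t = (f, tensor_inl y)"
  then have "tensor_outr (snd (cone_point p s t)) = 0"
    by simp
  then have "height t *\<^sub>R frame_vec (fst p) = 0"
    by (simp add: cone_point_def)
  then have "frame_vec (fst p) = 0"
    using height_pos[OF assms(2,3)] by simp
  moreover have "ginner V (frame_vec (fst p)) (frame_vec (fst p)) = 1"
    using assms(1) by (intro frame_ginner) (auto simp: C2gamma_def)
  ultimately show False
    by (simp add: ginner_simps[OF V])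
qed

lemma bij_betw_cofibre_map:
  "bij_betw cofibre_map (topspace (stop cofibre)) (insert None (Some ` C2gamma (W \<oplus>\<^sub>r A) U V))"
proof (rule bij_betw_imageI)
  have inl: "y = y'" if "tensor_inl y = (tensor_inl y' :: ('k + unit) \<times> 'j \<Rightarrow>\<^sub>0 real)" for y y'
    using that tensor_outl_inl by metis
  note ne = cone_point_ne_base cone_point_ne_base[symmetric]
  show "inj_on cofibre_map (topspace (stop cofibre))"
  proof (rule inj_onI)
    fix z z'
    assume z: "z \<in> topspace (stop cofibre)" and z': "z' \<in> topspace (stop cofibre)"
      and eq: "cofibre_map z = cofibre_map z'"
    from z show "z = z'"
    proof (cases rule: cofibre_cases)
      case pt
      from z' show ?thesis
        using eq pt by (cases rule: cofibre_cases) auto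
    next
      case (base f y)
      from z' show ?thesis
        using eq base ne by (cases rule: cofibre_cases) (auto dest: inl)
    next
      case (cone p s t)
      from z' show ?thesis
      proof (cases rule: cofibre_cases)
        case (cone p' s' t')
        then show ?thesis
          using eq \<open>z = _\<close> cone_point_inj[of p p' s s' t t'] \<open>p \<in> _\<close> \<open>s \<in> _\<close> \<open>0 < t\<close> \<open>t < 1\<close> by simp
      qed (use eq cone ne in auto)
    qed
  qed
  show "cofibre_map ` topspace (stop cofibre) = insert None (Some ` C2gamma (W \<oplus>\<^sub>r A) U V)"
  proof (intro equalityI subsetI)
    fix w
    assume "w \<in> cofibre_map ` topspace (stop cofibre)"
    then obtain z where "z \<in> topspace (stop cofibre)" "w = cofibre_map z"
      by blast
    then show "w \<in> insert None (Some ` C2gamma (W \<oplus>\<^sub>r A) U V)"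
      by (cases rule: cofibre_cases) (auto simp: cone_point_in base_point_in_iff)
  next
    fix w
    assume "w \<in> insert None (Some ` C2gamma (W \<oplus>\<^sub>r A) U V)"
    then consider "w = None" | f z where "w = Some (f, z)" "(f, z) \<in> C2gamma (W \<oplus>\<^sub>r A) U V"
      by auto
    then show "w \<in> cofibre_map ` topspace (stop cofibre)"
    proof cases
      case 1
      then show ?thesis
        unfolding topspace_cofibre by (intro image_eqI[of _ _ "Inr None"]) auto
    next
      case 2
      show ?thesis
      \<comment> \<open>The vanishing of the line component decides whether the preimage lies in the
        base or in the open cone.\<close>
      proof (cases "tensor_outr z = 0")
        case True
        then have z: "z = tensor_inl (tensor_outl z)"
          using tensor_in_out[of z] by simp
        then have "(f, tensor_outl z) \<in> C2gamma W U V"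
          using 2(2) base_point_in_iff by metis
        then show ?thesis
          using z 2(1) unfolding topspace_cofibre
          by (intro image_eqI[of _ _ "Inr (Some (f, tensor_outl z))"]) auto
      next
        case False
        then obtain p s t where "p \<in> C2gamma W (U \<oplus>\<^sub>r A) V" "s \<in> tensor_space (rcarrier W) UNIV"
          "0 < t" "t < 1" "(f, z) = cone_point p s t"
          using cone_point_surj[OF 2(2)] by blast
        moreover from this have "Inl (Some (Some p, Some s), t) \<in> topspace (stop cofibre)"
          unfolding topspace_cofibre by blast
        ultimately show ?thesis
          using 2(1) by (intro image_eqI[of _ _ "Inl (Some (Some p, Some s), t)"]) simp_all
      qed
    qed
  qed
qed

subsection \<open>Equivariance\<close>

abbreviation tau :: "('k \<times> 'j \<Rightarrow>\<^sub>0 real) \<Rightarrow> ('k \<times> 'j \<Rightarrow>\<^sub>0 real)"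
  where "tau \<equiv> tensor_map (rcarrier W) (rcarrier V) (ract W) (ract V)"

abbreviation tau' :: "(('k + unit) \<times> 'j \<Rightarrow>\<^sub>0 real) \<Rightarrow> (('k + unit) \<times> 'j \<Rightarrow>\<^sub>0 real)"
  where "tau' \<equiv> tensor_map (rcarrier (W \<oplus>\<^sub>r A)) (rcarrier V) (ract (W \<oplus>\<^sub>r A)) (ract V)"

lemma tau_inl:
  assumes "y \<in> tensor_space (rcarrier W) (rcarrier V)"
  shows "tau' (tensor_inl y) = tensor_inl (tau y)"
proof -
  have "(tau' \<circ> tensor_inl) y = (tensor_inl \<circ> tau) y"
  proof (rule linear_eq_on_tensor_space[OF assms])
    show "linear (tau' \<circ> tensor_inl)" "linear (tensor_inl \<circ> tau)"
      using tensor_map_ract(1)[OF WA V] tensor_map_ract(1)[OF W V] bounded_linear.linear[OF bounded_linear_tensor_inl]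
      by (auto intro: linear_compose)
  qed (simp add: tensor_inl_tensor_vec tensor_map_ract(2)[OF WA V] tensor_map_ract(2)[OF W V])
  then show ?thesis
    by simp
qed

lemma tau_inr:
  assumes "v \<in> rcarrier V"
  shows "tau' (tensor_inr v) = tensor_inr (\<epsilon> *\<^sub>R ract V v)"
proof -
  have "dsum_vec (0 :: 'k \<Rightarrow>\<^sub>0 real) (\<epsilon> *\<^sub>R Poly_Mapping.single () 1) = \<epsilon> *\<^sub>R dsum_vec 0 (Poly_Mapping.single () 1)"
    by (simp add: dsum_vec_scale)
  then show ?thesis
    using zero_in assms
    by (simp add: tensor_inr_def tensor_map_ract(2)[OF WA V] ract_0[OF W]
        linear_scale[OF linear_tensor_vec_left] linear_scale[OF linear_tensor_vec_right])
qed

lemma frame_res_act: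
  assumes "F \<in> isometries (U \<oplus>\<^sub>r A) V"
  shows "frame_res U (isometries_act (U \<oplus>\<^sub>r A) V F) = isometries_act U V (frame_res U F)"
  using ract_linear(1)[OF U] by (auto simp: frame_res_def isometries_act_def fun_eq_iff)

text \<open>\<sigma> sends (0,1) to (0,\<epsilon>), so conjugation multiplies the image of the basis
  vector by \<epsilon>.\<close>

lemma frame_vec_act:
  assumes "F \<in> isometries (U \<oplus>\<^sub>r A) V"
  shows "frame_vec (isometries_act (U \<oplus>\<^sub>r A) V F) = \<epsilon> *\<^sub>R ract V (frame_vec F)"
proof -
  have "frame_vec (isometries_act (U \<oplus>\<^sub>r A) V F) = ract V (F (dsum_vec 0 (\<epsilon> *\<^sub>R Poly_Mapping.single () 1)))"
    using zero_in by (simp add: frame_vec_def isometries_act_def ract_0[OF U])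
  also have "F (dsum_vec 0 (\<epsilon> *\<^sub>R Poly_Mapping.single () 1)) = F (\<epsilon> *\<^sub>R dsum_vec 0 (Poly_Mapping.single () 1))"
    by (simp add: dsum_vec_scale)
  also have "\<dots> = \<epsilon> *\<^sub>R frame_vec F"
    using zero_in by (simp add: isometriesD(3)[OF assms] frame_vec_def)
  also have "ract V (\<epsilon> *\<^sub>R frame_vec F) = \<epsilon> *\<^sub>R ract V (frame_vec F)"
    using unit_normalD(1)[OF frame_isometries(2)[OF assms]] by (rule ract_linear(2)[OF V])
  finally show ?thesis .
qed

lemma slice_act:
  assumes "s \<in> tensor_space (rcarrier W) UNIV"
  shows "slice () (tensor_map (rcarrier W) (rcarrier A) (ract W) (ract A) s) = \<epsilon> *\<^sub>R ract W (slice () s)"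
proof -
  \<comment> \<open>The action is linear on the carrier only; a globally linear extension is needed
    for comparison on elementary tensors.\<close>
  obtain G where G: "linear G" "\<And>w. w \<in> rcarrier W \<Longrightarrow> G w = ract W w"
    using linear_on_subspace_extend[OF orthogonal_rep_subspace[OF W], of "ract W"] W
    unfolding orthogonal_rep_def by metis
  note act = tensor_map_ract[OF W A]
  have "(slice () \<circ> tensor_map (rcarrier W) (rcarrier A) (ract W) (ract A)) s = (\<lambda>s. \<epsilon> *\<^sub>R G (slice () s)) s"
  proof (rule linear_eq_on_tensor_space[OF assms])
    show "linear (slice () \<circ> tensor_map (rcarrier W) (rcarrier A) (ract W) (ract A))"
      using act(1) bounded_linear.linear[OF bounded_linear_slice] by (rule linear_compose)
    show "linear (\<lambda>s. \<epsilon> *\<^sub>R G (slice () s))"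
      using linear_compose[OF bounded_linear.linear[OF bounded_linear_slice] G(1)]
      by (intro linear_compose_scale_right) (simp add: comp_def)
    show "(slice () \<circ> tensor_map (rcarrier W) (rcarrier A) (ract W) (ract A)) (tensor_vec w a) =
        \<epsilon> *\<^sub>R G (slice () (tensor_vec w a))" if "w \<in> rcarrier W" for w a
      using that act(2)[of w a] G(2)[OF that] by (simp add: slice_tensor_vec linear_scale[OF G(1)])
  qed
  then show ?thesis
    using G(2) slice_in[OF assms orthogonal_rep_subspace[OF W]] by simp
qed

text \<open>The signs from \<open>slice_act\<close> and \<open>frame_vec_act\<close> multiply to 1
  in the W-component by \<open>eps\<close>. The single sign left in the line component is the one in
  \<open>tau_inr\<close>.\<close>

lemma cone_point_act:
  assumes "p \<in> C2gamma W (U \<oplus>\<^sub>r A) V" "s \<in> tensor_space (rcarrier W) UNIV"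
  shows "cone_point (C2gamma_act W (U \<oplus>\<^sub>r A) V p) (tensor_map (rcarrier W) (rcarrier A) (ract W) (ract A) s) t =
    C2gamma_act (W \<oplus>\<^sub>r A) U V (cone_point p s t)"
proof -
  obtain F x where p: "p = (F, x)"
    by fastforce
  have F: "F \<in> isometries (U \<oplus>\<^sub>r A) V" and x: "x \<in> tensor_space (rcarrier W) (rcarrier V)"
    using assms(1) by (auto simp: C2gamma_iff[OF UA V] p)
  have y: "thom_sum p s \<in> tensor_space (rcarrier W) (rcarrier V)"
    using thom_sum_in(1)[of F x s] assms by (auto simp: C2gamma_iff[OF U V] p)
  let ?e = "frame_vec F"
  have e: "?e \<in> rcarrier V"
    using unit_normalD(1)[OF frame_isometries(2)[OF F]] .
  have s: "slice () s \<in> rcarrier W"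
    using slice_in[OF assms(2) orthogonal_rep_subspace[OF W]] .
  have "tensor_vec (\<epsilon> *\<^sub>R ract W (slice () s)) (\<epsilon> *\<^sub>R ract V ?e) = tau (tensor_vec (slice () s) ?e)"
    using eps by (simp add: tensor_map_ract(2)[OF W V s e] linear_scale[OF linear_tensor_vec_left]
        linear_scale[OF linear_tensor_vec_right])
  then have sum: "thom_sum (C2gamma_act W (U \<oplus>\<^sub>r A) V p) (tensor_map (rcarrier W) (rcarrier A) (ract W) (ract A) s) = tau (thom_sum p s)"
    using tensor_map_ract(1)[OF W V] slice_act[OF assms(2)] frame_vec_act[OF F]
    by (simp add: thom_sum_def p C2gamma_act_def linear_add)
  have "tau' (tensor_inl (thom_sum p s) + tensor_inr (height t *\<^sub>R ?e)) =
      tau' (tensor_inl (thom_sum p s)) + tau' (tensor_inr (height t *\<^sub>R ?e))"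
    by (rule linear_add[OF tensor_map_ract(1)[OF WA V]])
  also have "\<dots> = tensor_inl (tau (thom_sum p s)) + tensor_inr (height t *\<^sub>R \<epsilon> *\<^sub>R ract V ?e)"
    using e orthogonal_rep_subspace[OF V] by (simp add: tau_inl[OF y] tau_inr subspace_scale ract_linear(2)[OF V] mult.commute)
  finally show ?thesis
    using sum frame_res_act[OF F] frame_vec_act[OF F] by (simp add: cone_point_def p C2gamma_act_def)
qed

lemma cofibre_map_equivariant:
  assumes "z \<in> topspace (stop cofibre)"
  shows "cofibre_map (sact cofibre z) = sact (C2J (W \<oplus>\<^sub>r A) U V) (cofibre_map z)"
  using assms
proof (cases rule: cofibre_cases)
  case (base f y)
  then have "y \<in> tensor_space (rcarrier W) (rcarrier V)"
    by (auto simp: C2gamma_iff[OF U V])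
  then show ?thesis
    using base by (simp add: C2gamma_act_def tau_inl)
next
  case (cone p s t)
  then show ?thesis
    using cone_point_act[OF cone(2,3)] by simp
qed simp

subsection \<open>Continuity\<close>

text \<open>The isometry enters only through evaluation at fixed vectors, which is continuous for
  pointwise convergence. The interval is open at 1 to keep the denominator of \<open>height\<close>
  nonzero.\<close>

lemma continuous_on_cone_point:
  "continuous_on ((G \<times> S) \<times> {0..<1}) (\<lambda>((p, s), t). cone_point p s t)"
proof -
  let ?D = "(G \<times> S) \<times> {0..<1::real}"
  have F: "continuous_on ?D (\<lambda>q. fst (fst (fst q)) u)" for u
    by (rule continuous_on_product_then_coordinatewise) (intro continuous_on_fst continuous_on_id)
  have "continuous_on ?D (\<lambda>q. frame_res U (fst (fst (fst q))))"
  proof (rule continuous_on_coordinatewise_then_product)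
    show "continuous_on ?D (\<lambda>q. frame_res U (fst (fst (fst q))) u)" for u
      using F by (cases "u \<in> rcarrier U") (simp_all add: frame_res_def)
  qed
  moreover have "continuous_on ?D (\<lambda>q. frame_vec (fst (fst (fst q))))"
    unfolding frame_vec_def by (rule F)
  moreover have "continuous_on ?D (\<lambda>q. height (snd q))"
    unfolding height_def by (intro continuous_intros) auto
  ultimately show ?thesis
    unfolding cone_point_def thom_sum_def case_prod_unfold
    by (intro continuous_on_Pair continuous_on_add continuous_on_tensor_vec continuous_on_scaleR
        continuous_on_fst continuous_on_snd continuous_on_id bounded_linear.continuous_on[OF bounded_linear_tensor_inl]
        bounded_linear.continuous_on[OF bounded_linear_tensor_inr] bounded_linear.continuous_on[OF bounded_linear_slice])
qed

text \<open>A bound on the image bounds y and v separately. The size of v keeps t away from 1,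
  contraction of y with e bounds s, and x is the difference of y and s \<otimes> e.\<close>

lemma cone_point_proper:
  assumes "r \<ge> 0"
  shows "\<exists>a b c. c < 1 \<and> (\<forall>p\<in>C2gamma W (U \<oplus>\<^sub>r A) V. \<forall>s\<in>tensor_space (rcarrier W) UNIV. \<forall>t\<in>{0..<1}.
    norm (snd (cone_point p s t)) \<le> r \<longrightarrow> norm (snd p) \<le> a \<and> norm s \<le> b \<and> t \<le> c)"
proof -
  obtain M where M: "M > 0" "\<And>v. v \<in> rcarrier V \<Longrightarrow> norm v \<le> M * sqrt (rinner V v v)"
    using norm_le_sqrt_rinner[OF V] by blast
  obtain B where B: "B \<ge> 0" "\<And>v v'. norm (ginner V v v') \<le> norm v * norm v' * B"
    using bounded_bilinear.nonneg_bounded[OF bounded_bilinear_ginner[OF V]] by blast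
  obtain Kc where Kc: "Kc \<ge> 0" "\<And>v and y :: 'k \<times> 'j \<Rightarrow>\<^sub>0 real. norm (contract V v y) \<le> norm v * norm y * Kc"
    using bounded_bilinear.nonneg_bounded[OF bounded_bilinear_contract[OF V]] by blast
  obtain L where L: "L \<ge> 0" "\<And>z :: ('k + unit) \<times> 'j \<Rightarrow>\<^sub>0 real. norm (tensor_outl z) \<le> norm z * L"
    using bounded_linear.nonneg_bounded[OF bounded_linear_tensor_outl] by blast
  obtain L' where L': "L' \<ge> 0" "\<And>z :: ('k + unit) \<times> 'j \<Rightarrow>\<^sub>0 real. norm (tensor_outr z) \<le> norm z * L'"
    using bounded_linear.nonneg_bounded[OF bounded_linear_tensor_outr] by blast
  \<comment> \<open>\<open>b\<close> bounds the contraction of y with e, from a bound M for e and r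
    * L for y; \<open>d\<close> bounds 1 plus the squared height.\<close>
  define b where "b = M * (r * L) * Kc"
  define d where "d = 1 + (r * L') * (r * L') * B"
  have d: "d > 0"
    using assms L' B by (simp add: d_def add_pos_nonneg)
  have "norm x \<le> r * L + b * M \<and> norm s \<le> b * norm (Poly_Mapping.single () (1::real)) \<and> t \<le> d / (1 + d)"
    if p: "(F, x) \<in> C2gamma W (U \<oplus>\<^sub>r A) V" and s: "s \<in> tensor_space (rcarrier W) UNIV" and t: "0 \<le> t" "t < 1"
      and r: "norm (snd (cone_point (F, x) s t)) \<le> r" for F x s t
  proof -
    let ?e = "frame_vec F" and ?y = "thom_sum (F, x) s" and ?z = "snd (cone_point (F, x) s t)"
    have F: "F \<in> isometries (U \<oplus>\<^sub>r A) V"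
      using p by (simp add: C2gamma_def)
    have e: "norm ?e \<le> M"
      using M(2)[of ?e] unit_normalD(1,3)[OF frame_isometries(2)[OF F]] by simp
    have "norm ?y \<le> norm ?z * L"
      using L(2)[of ?z] by (simp add: cone_point_def)
    also have "\<dots> \<le> r * L"
      using r L(1) by (rule mult_right_mono)
    finally have y: "norm ?y \<le> r * L" .
    have "norm (height t *\<^sub>R ?e) \<le> norm ?z * L'"
      using L'(2)[of ?z] by (simp add: cone_point_def)
    also have "\<dots> \<le> r * L'"
      using r L'(1) by (rule mult_right_mono)
    finally have v: "norm (height t *\<^sub>R ?e) \<le> r * L'" .
    have "height t * height t = ginner V (height t *\<^sub>R ?e) (height t *\<^sub>R ?e)"
      using frame_ginner(1)[OF F] by (simp add: ginner_simps[OF V])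
    also have "\<dots> \<le> norm (height t *\<^sub>R ?e) * norm (height t *\<^sub>R ?e) * B"
      using B(2)[of "height t *\<^sub>R ?e" "height t *\<^sub>R ?e"] by (simp only: real_norm_def abs_le_iff)
    also have "\<dots> \<le> (r * L') * (r * L') * B"
      using v B(1) assms L'(1) by (intro mult_right_mono mult_mono) auto
    finally have "1 + height t * height t \<le> d"
      by (simp add: d_def)
    \<comment> \<open>This passes from the bound on the squared height to one on the height without
      a square root; d/(1 + d) is then the parameter of height d.\<close>
    moreover have "2 * height t \<le> 1 + height t * height t"
      using zero_le_square[of "height t - 1"] by (simp add: algebra_simps)
    moreover have "0 \<le> height t * height t"
      by simp
    ultimately have "height t \<le> d"
      by linarith
    then have "t \<le> d / (1 + d)"
      using t d by (simp add: height_def field_simps)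
    moreover have slice: "norm (slice () s) \<le> b"
    proof -
      have "norm (slice () s) \<le> norm ?e * norm ?y * Kc"
        using Kc(2)[of ?e ?y] thom_sum_in(2)[OF p s] by simp
      also have "\<dots> \<le> M * (r * L) * Kc"
        using e y Kc(1) M(1) by (intro mult_right_mono mult_mono) auto
      finally show ?thesis
        by (simp add: b_def)
    qed
    moreover have "s = tensor_vec (slice () s) (Poly_Mapping.single () 1)"
      by (rule poly_mapping_eqI) auto
    then have "norm s = norm (slice () s) * norm (Poly_Mapping.single () (1::real))"
      by (metis norm_tensor_vec)
    moreover have "norm x \<le> r * L + b * M"
    proof -
      have "0 \<le> b"
        using slice norm_ge_zero order_trans by blast
      have "x = ?y - tensor_vec (slice () s) ?e"
        by (simp add: thom_sum_def)
      then have "norm x \<le> norm ?y + norm (slice () s) * norm ?e"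
        using norm_triangle_ineq4 norm_tensor_vec by metis
      also have "\<dots> \<le> r * L + b * M"
        using y slice e \<open>0 \<le> b\<close> by (intro add_mono mult_mono) auto
      finally show ?thesis .
    qed
    ultimately show ?thesis
      by (simp add: mult_right_mono)
  qed
  moreover have "d / (1 + d) < 1"
    using d by (simp add: field_simps)
  ultimately show ?thesis
    by (intro exI[of _ "r * L + b * M"] exI[of _ "b * norm (Poly_Mapping.single () (1::real))"] exI[of _ "d / (1 + d)"]) auto
qed

lemma compactin_norm_bound:
  assumes "compactin (top_of_set S) (K :: ('a, 'b, 'c) bundle_point set)"
  obtains r where "r \<ge> 0" "\<And>p. p \<in> K \<Longrightarrow> norm (snd p) \<le> r"
proof -
  have "compact K"
    using assms by (simp add: compactin_subtopology compactin_euclidean_iff)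
  then have "compact (snd ` K)"
    by (intro compact_continuous_image continuous_intros)
  then obtain r where "r > 0" "\<forall>x\<in>snd ` K. norm x \<le> r"
    using compact_imp_bounded bounded_pos by metis
  then show ?thesis
    using that[of r] by auto
qed

lemma compactin_C2gamma_norm_le:
  assumes "orthogonal_rep X" "orthogonal_rep Y" "orthogonal_rep Z"
  shows "compactin (Alexandroff_compactification (top_of_set (C2gamma Z X Y))) (Some ` {p \<in> C2gamma Z X Y. norm (snd p) \<le> r})"
  using compact_C2gamma_norm_le[OF assms]
  by (intro image_compactin[OF _ continuous_map_Some]) (auto simp: compactin_subtopology compactin_euclidean_iff)

text \<open>The inclusion of the vectors with line component 0 is proper because
  \<open>tensor_outl\<close> is a bounded left inverse.\<close>

lemma continuous_map_base:
  "continuous_map (stop (C2J W U V)) (stop (C2J (W \<oplus>\<^sub>r A) U V)) (cofibre_map \<circ> Inr)"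
  unfolding C2J_simps
proof (rule continuous_map_into_Alexandroff)
  let ?Y = "Alexandroff_compactification (top_of_set (C2gamma W U V))"
  let ?g = "map_prod id tensor_inl :: ('k, 'i, 'j) bundle_point \<Rightarrow> ('k + unit, 'i, 'j) bundle_point"
  show "Hausdorff_space ?Y"
    using Hausdorff_space_C2J[OF U V W] by simp
  show "openin ?Y (Some ` C2gamma W U V)"
    by simp
  have "continuous_on (C2gamma W U V) ?g"
    unfolding map_prod_def case_prod_unfold id_def
    by (intro continuous_intros bounded_linear.continuous_on[OF bounded_linear_tensor_inl])
  then have "continuous_map (top_of_set (C2gamma W U V)) (top_of_set (C2gamma (W \<oplus>\<^sub>r A) U V)) ?g"
    by (auto simp: base_point_in_iff)
  then show "continuous_map (subtopology ?Y (Some ` C2gamma W U V)) (top_of_set (C2gamma (W \<oplus>\<^sub>r A) U V)) (?g \<circ> the)"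
    by (rule continuous_map_compose[OF continuous_map_the_Alexandroff[of "top_of_set (C2gamma W U V)", simplified]])
  show "(cofibre_map \<circ> Inr) z = Some ((?g \<circ> the) z)" if "z \<in> Some ` C2gamma W U V" for z
    using that by auto
  show "(cofibre_map \<circ> Inr) z = None" if "z \<in> topspace ?Y - Some ` C2gamma W U V" for z
    using that by auto
  fix K
  assume K: "compactin (top_of_set (C2gamma (W \<oplus>\<^sub>r A) U V)) K"
  obtain r where r: "r \<ge> 0" "\<And>p. p \<in> K \<Longrightarrow> norm (snd p) \<le> r"
    using compactin_norm_bound[OF K] by blast
  obtain L where L: "L \<ge> 0" "\<And>z :: ('k + unit) \<times> 'j \<Rightarrow>\<^sub>0 real. norm (tensor_outl z) \<le> norm z * L"
    using bounded_linear.nonneg_bounded[OF bounded_linear_tensor_outl] by blast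
  have "norm y \<le> r * L" if "(f, tensor_inl y) \<in> K" for f y
  proof -
    have "norm y \<le> norm (tensor_inl y :: ('k + unit) \<times> 'j \<Rightarrow>\<^sub>0 real) * L"
      using L(2)[of "tensor_inl y"] by simp
    also have "\<dots> \<le> r * L"
      using r(2)[OF that] L(1) by (simp add: mult_right_mono)
    finally show ?thesis .
  qed
  then have "{z \<in> Some ` C2gamma W U V. (?g \<circ> the) z \<in> K} \<subseteq> Some ` {p \<in> C2gamma W U V. norm (snd p) \<le> r * L}"
    by auto
  then show "\<exists>C. compactin ?Y C \<and> C \<subseteq> Some ` C2gamma W U V \<and> {z \<in> Some ` C2gamma W U V. (?g \<circ> the) z \<in> K} \<subseteq> C"
    using compactin_C2gamma_norm_le[OF U V W] by (intro exI[of _ "Some ` {p \<in> C2gamma W U V. norm (snd p) \<le> r * L}"]) auto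
qed

lemma continuous_map_cone:
  "continuous_map
    (prod_topology (prod_topology (stop (C2J W (U \<oplus>\<^sub>r A) V)) (stop (tensor_sphere W A))) (top_of_set {0..1}))
    (stop (C2J (W \<oplus>\<^sub>r A) U V))
    (\<lambda>(p, t). cofibre_map (hocofibre_proj source (C2J W U V) (restricted_comp W U A)
      (Inl (smash_proj (C2J W (U \<oplus>\<^sub>r A) V) (tensor_sphere W A) p, t))))"
  unfolding C2J_simps tensor_sphere_simps rep_line_simps
proof (rule continuous_map_into_Alexandroff)
  let ?G = "C2gamma W (U \<oplus>\<^sub>r A) V" and ?S = "tensor_space (rcarrier W) (UNIV :: (unit \<Rightarrow>\<^sub>0 real) set)"
  let ?T = "C2gamma (W \<oplus>\<^sub>r A) U V"
  let ?X = "Alexandroff_compactification (top_of_set ?G)" and ?Sp = "Alexandroff_compactification (top_of_set ?S)"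
  let ?Z = "prod_topology (prod_topology ?X ?Sp) (top_of_set {0..1::real})"
  let ?\<Omega> = "(Some ` ?G \<times> Some ` ?S) \<times> {0..<1::real}"
  let ?h = "\<lambda>((p, s), t). cone_point p s t" and ?the = "map_prod (map_prod the the) (id :: real \<Rightarrow> real)"
  have S: "fin_dim ?S"
    using W A by (metis fin_dim_tensor_space orthogonal_rep_fin_dim rep_line_simps(1))
  have "Hausdorff_space ?X"
    using Hausdorff_space_C2J[OF UA V W] by simp
  moreover have "Hausdorff_space ?Sp"
    using locally_compact_space_fin_dim[OF S]
    by (simp add: Hausdorff_space_Alexandroff_compactification Hausdorff_space_subtopology)
  ultimately show "Hausdorff_space ?Z"
    by (simp add: Hausdorff_space_prod_topology Hausdorff_space_subtopology)
  have "openin (top_of_set {0..1}) ({0..1} \<inter> {..<1::real})"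
    by (rule openin_open_Int) simp
  moreover have "{0..1} \<inter> {..<1::real} = {0..<1}"
    by auto
  ultimately show "openin ?Z ?\<Omega>"
    by (simp add: openin_prod_Times_iff)
  have sub: "subtopology ?Z ?\<Omega> = prod_topology (prod_topology (subtopology ?X (Some ` ?G)) (subtopology ?Sp (Some ` ?S))) (top_of_set {0..<1})"
    by (simp add: subtopology_Times subtopology_subtopology Int_absorb1 subset_iff)
  have "continuous_map (subtopology ?X (Some ` ?G)) (top_of_set ?G) the" "continuous_map (subtopology ?Sp (Some ` ?S)) (top_of_set ?S) the"
    using continuous_map_the_Alexandroff[of "top_of_set ?G"] continuous_map_the_Alexandroff[of "top_of_set ?S"] by simp_all
  then have the: "continuous_map (subtopology ?Z ?\<Omega>) (prod_topology (prod_topology (top_of_set ?G) (top_of_set ?S)) (top_of_set {0..<1})) ?the"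
    unfolding sub map_prod_def continuous_map_prod_top by simp
  have "continuous_map (prod_topology (prod_topology (top_of_set ?G) (top_of_set ?S)) (top_of_set {0..<1})) (top_of_set ?T) ?h"
    using continuous_on_cone_point[of ?G ?S] cone_point_in by auto
  then show "continuous_map (subtopology ?Z ?\<Omega>) (top_of_set ?T) (?h \<circ> ?the)"
    by (rule continuous_map_compose[OF the])
  let ?\<phi> = "\<lambda>(p, t). cofibre_map (hocofibre_proj source (C2J W U V) (restricted_comp W U A)
      (Inl (smash_proj (C2J W (U \<oplus>\<^sub>r A) V) (tensor_sphere W A) p, t)))"
  show "?\<phi> z = Some ((?h \<circ> ?the) z)" if z: "z \<in> ?\<Omega>" for z
  proof -
    obtain p s t where "z = ((Some p, Some s), t)" "p \<in> ?G" "s \<in> ?S" "0 \<le> t" "t < 1"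
      using z by auto
    \<comment> \<open>At t = 0 the projection passes to the base through the composition; the result
      agrees with the cone formula because \<open>height 0\<close> is 0.\<close>
    then show ?thesis
      by (auto simp: hocofibre_proj_cone cone_point_def height_def)
  qed
  show "?\<phi> z = None" if z: "z \<in> topspace ?Z - ?\<Omega>" for z
  proof -
    obtain a b t where abt: "z = ((a, b), t)" "a \<in> insert None (Some ` ?G)" "b \<in> insert None (Some ` ?S)" "0 \<le> t" "t \<le> 1"
      using z by auto
    show ?thesis
    proof (cases "a = None \<or> b = None")
      case True
      then show ?thesis
        by (simp add: abt(1) hocofibre_proj_base)
    next
      case False
      then show ?thesis
        using z abt by (auto simp: hocofibre_proj_cone)
    qed
  qed
  fix K
  assume K: "compactin (top_of_set ?T) K"
  obtain r where r: "r \<ge> 0" "\<And>p. p \<in> K \<Longrightarrow> norm (snd p) \<le> r"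
    using compactin_norm_bound[OF K] by blast
  obtain a b c where c: "c < 1" and abc: "\<And>p s t. \<lbrakk>p \<in> ?G; s \<in> ?S; t \<in> {0..<1}; norm (snd (cone_point p s t)) \<le> r\<rbrakk> \<Longrightarrow>
      norm (snd p) \<le> a \<and> norm s \<le> b \<and> t \<le> c"
    using cone_point_proper[OF r(1)] by blast
  \<comment> \<open>Cutting the interval at c < 1 keeps this compact box inside
    \<open>?\<Omega>\<close>.\<close>
  let ?C = "(Some ` {p \<in> ?G. norm (snd p) \<le> a} \<times> Some ` (?S \<inter> cball 0 b)) \<times> {0..c}"
  have "compactin ?Sp (Some ` (?S \<inter> cball 0 b))"
    using compact_fin_dim_cball[OF S]
    by (intro image_compactin[OF _ continuous_map_Some]) (auto simp: compactin_subtopology compactin_euclidean_iff)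
  moreover have "compactin (top_of_set {0..1}) {0..c}"
    using c by (auto simp: compactin_subtopology compactin_euclidean_iff)
  ultimately have "compactin ?Z ?C"
    using compactin_C2gamma_norm_le[OF UA V W] by (simp add: compactin_Times)
  moreover have "?C \<subseteq> ?\<Omega>"
    using c by auto
  moreover have "{z \<in> ?\<Omega>. (?h \<circ> ?the) z \<in> K} \<subseteq> ?C"
  proof
    fix z
    assume "z \<in> {z \<in> ?\<Omega>. (?h \<circ> ?the) z \<in> K}"
    then obtain p s t where z: "z = ((Some p, Some s), t)" "p \<in> ?G" "s \<in> ?S" "t \<in> {0..<1}" "cone_point p s t \<in> K"
      by auto
    then show "z \<in> ?C"
      using abc[OF z(2-4) r(2)[OF z(5)]] by auto
  qed
  ultimately show "\<exists>C. compactin ?Z C \<and> C \<subseteq> ?\<Omega> \<and> {z \<in> ?\<Omega>. (?h \<circ> ?the) z \<in> K} \<subseteq> C"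
    by blast
qed

lemma cofibre_homeomorphic: "c2_homeomorphic cofibre (C2J (W \<oplus>\<^sub>r A) U V)"
proof (rule hocofibre_smash_homeomorphic)
  show "Hausdorff_space (stop (C2J (W \<oplus>\<^sub>r A) U V))"
    by (rule Hausdorff_space_C2J[OF U V WA])
  show "bij_betw cofibre_map (topspace (stop cofibre)) (topspace (stop (C2J (W \<oplus>\<^sub>r A) U V)))"
    using bij_betw_cofibre_map by simp
qed (use continuous_map_cone continuous_map_base cofibre_map_equivariant in simp_all)

end

theorem proposition4:
  fixes U V W :: "(nat \<times> c2) rep" and A :: "unit rep"
  assumes "C2J00_object U" "C2J00_object V" "C2J00_object W"
    and "A = trivial_line \<or> A = sign_line"
  shows "c2_homeomorphic
    (hocofibre (smash (C2J W (U \<oplus>\<^sub>r A) V) (tensor_sphere W A)) (C2J W U V) (restricted_comp W U A))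
    (C2J (W \<oplus>\<^sub>r A) U V)"
proof -
  \<comment> \<open>The sign is 1 for the trivial line and -1 for the sign line.\<close>
  obtain \<epsilon> where \<epsilon>: "A = line \<epsilon>" "\<epsilon> * \<epsilon> = 1"
    using assms(4) by (auto simp: trivial_line_def sign_line_def)
  interpret line_cone U V W \<epsilon>
    using assms(1-3) \<epsilon>(2) by unfold_locales (simp_all add: C2J00_object_def)
  show ?thesis
    using cofibre_homeomorphic by (simp add: \<epsilon>(1))
qed

end
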